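(* Let $\mathbf{oMDP}=\mathrm{Int}(\mathbf{roMDP})$ and $\mathbb{S}=\mathrm{Int}(\mathbb{S}_{\to})$, and let $\mathcal{S}=\mathrm{Int}(\mathcal{S}_{\to})\colon \mathbf{oMDP}\to\mathbb{S}$ be the functor that is the identity on objects and sends an arrow $\mathcal{A}\colon(\vec m,\overleftarrow m)\to(\vec n,\overleftarrow n)$ of $\mathbf{oMDP}$ (that is, an roMDP $\mathcal{A}\colon \vec m+\overleftarrow n\to \vec n+\overleftarrow m$) to $\mathcal{S}_{\to}(\mathcal{A})$. Then $\mathcal{S}$ is a compact closed functor. In particular, for all composable arrows $\mathcal{A},\mathcal{B}$ of $\mathbf{oMDP}$ and all arrows $\mathcal{A}',\mathcal{B}'$ of $\mathbf{oMDP}$, $$\mathcal{S}(\mathcal{A}\,;\,\mathcal{B})=\mathcal{S}(\mathcal{A})\,;\,\mathcal{S}(\mathcal{B}),\qquad \mathcal{S}(\mathcal{A}'\oplus\mathcal{B}')=\mathcal{S}(\mathcal{A}')\oplus\mathcal{S}(\mathcal{B}'),$$ where $;$ and $\oplus$ on each side are the composition and monoidal product of the respective $\mathrm{Int}$ categories.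
   Context: Notation: for $k\in\mathbb{N}$, $[k]=\{1,\dots,k\}$ ($[0]=\emptyset$), $[a,b]=\{a,\dots,b\}$; $X+Y$ is disjoint union. Fix a nonempty finite set $A$ of actions. Rightward open MDPs. An roMDP $\mathcal{A}\colon m\to n$ is a tuple $(m,n,Q,A,E,P,R)$ where $Q$ is a finite set of positions; $E\colon[m]\to Q+[n]$ (elements of $[m]$ are entrances, elements of $[n]$ exits); $P\colon Q\times A\times(Q+[n])\to\mathbb{R}_{\ge0}$ with $\sum_{s'}P(s,a,s')\in\{0,1\}$ for all $s\in Q,a\in A$; $R\colon Q\to\mathbb{R}_{\ge0}$; and the unique-access condition holds: with $\mathrm{exits}(s)=\{t\in[n]\mid\exists a.\,P(s,a,t)>0\}$ for $s\in Q$ and $\mathrm{exits}(i)=\{E(i)\}$ if $E(i)\in[n]$, $\emptyset$ otherwise, for $i\in[m]$, we require that for $s,s'\in[m]+Q$, $\mathrm{exits}(s)\cap\mathrm{exits}(s')\neq\emptyset$ implies $s=s'$, and that $P(s,a,t)>0$ and $P(s,b,t)>0$ with $t\in[n]$ imply $a=b$. Two roMDPs $m\to n$ are isomorphic if a bijection $\eta$ between their position sets (extended by the identity on exits) preserves $E$, $P$ and $R$. $\mathbf{roMDP}$ is the category with objects natural numbers and arrows isomorphism classes of roMDPs, with operations: - Sequential composition of $\mathcal{A}\colon m\to k$, $\mathcal{B}\colon k\to n$: positions $Q^{\mathcal A}+Q^{\mathcal B}$; $E(i)=E^{\mathcal A}(i)$ if $E^{\mathcal A}(i)\in Q^{\mathcal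 A}$, else $E^{\mathcal B}(E^{\mathcal A}(i))$; for $s\in Q^{\mathcal A}$: $P(s,a,s')=P^{\mathcal A}(s,a,s')$ if $s'\in Q^{\mathcal A}$, and $\sum_{i\in[k]}P^{\mathcal A}(s,a,i)\cdot[E^{\mathcal B}(i)=s']$ if $s'\in Q^{\mathcal B}+[n]$; for $s\in Q^{\mathcal B}$: $P(s,a,s')=P^{\mathcal B}(s,a,s')$ if $s'\in Q^{\mathcal B}+[n]$, $0$ otherwise; rewards combined by case distinction. - Sum $\mathcal{A}\oplus\mathcal{B}\colon m+k\to n+l$ for $\mathcal A\colon m\to n$, $\mathcal B\colon k\to l$: disjoint union of positions, entrances of $\mathcal B$ shifted by $m$, exits of $\mathcal B$ shifted by $n$. - Identity $\mathcal I_m$: no positions, $E(i)=i$. Swap $\mathcal S_{m,n}\colon m+n\to n+m$: no positions, $E(i)=i+n$ for $i\le m$, $E(i)=i-m$ for $i>m$. - Trace: for $\mathcal{A}\colon l+m\to l+n$, $\mathrm{tr}^l_{m,n}(\mathcal A)\colon m\to n$ has positions $Q^{\mathcal A}$ and rewards $R^{\mathcal A}$. For $i\in[m]$ let $i_0=i+l$, $i_j=E^{\mathcal A}(i_{j-1})$, and $k$ the first index with $i_k\in[l+1,l+n]+Q^{\mathcal A}$ (exits in $[l]$ are fed back as entrances in $[l]$); $E(i)=i_k-l$ if $i_k$ is an exit, else $i_k$. For $t\in[l+1,l+n]+Q^{\mathcal A}$ let $\mathrm{prec}(t)$ be the set of $i\in[l]$ such that the sequence $i_0=i$, $i_{j+1}=E^{\mathcal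 A}(i_j)$ stays in $[l]$ until it reaches $t$. Then $P(q,a,q')=P^{\mathcal A}(q,a,q'+l)+\sum_{i\in\mathrm{prec}(q'+l)}P^{\mathcal A}(q,a,i)$ for $q'\in[n]$ and $P(q,a,q')=P^{\mathcal A}(q,a,q')+\sum_{i\in\mathrm{prec}(q')}P^{\mathcal A}(q,a,i)$ for $q'\in Q^{\mathcal A}$. $\mathbf{roMDP}$ is a traced symmetric monoidal category with these operations (tensor on objects is addition). Semantic categories. $\mathbb{S}^{\mathrm{MC}}_{\to}$ has objects natural numbers; an arrow $f\colon m\to n$ assigns to each $(i,j)\in[m]\times[n]$ a pair $(p_{i,j},r_{i,j})\in\mathbb{R}_{\ge0}^2$ with $\sum_j p_{i,j}\le1$ for each $i$ and $p_{i,j}=0\Rightarrow r_{i,j}=0$. Composition of $f\colon m\to l$, $g\colon l\to n$: with matrices $P^f=[p^f_{i,k}]$ etc., $P^{f;g}=P^fP^g$ and $R^{f;g}=P^fR^g+R^fP^g$. Sum $f\oplus g$ is block-diagonal (pairs $(0,0)$ off the blocks); identity $\mathrm{id}_m(i,j)=(\delta_{ij},0)$; swap $m+n\to n+m$ has $(1,0)$ exactly at $(i,i+n)$ for $i\le m$ and $(i,i-m)$ for $i>m$, $(0,0)$ elsewhere. Trace of $h\colon l+m\to l+n$: $p^{\mathrm{tr}(h)}_{i,j}=p^h_{l+i,l+j}+\sum_{d\in\mathbb N}(A_pB_p^dC_p)_{i,j}$ with $A_p=[p^h_{l+i,k}]_{i\in[m],k\in[l]}$, $B_p=[p^h_{k,k'}]_{k,k'\in[l]}$,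 $C_p=[p^h_{k',l+j}]_{k'\in[l],j\in[n]}$; and $r^{\mathrm{tr}(h)}_{i,j}=r^h_{l+i,l+j}+\sum_{d}(AB^dC)_{i,j}$ with $A=(A_p\ \ A_r)$, $B=\begin{pmatrix}B_p&B_r\\0&B_p\end{pmatrix}$, $C=\begin{pmatrix}C_r\\C_p\end{pmatrix}$, where $A_r,B_r,C_r$ are the same matrices with $r^h$ in place of $p^h$. $\mathbb{S}_{\to}$ has objects natural numbers and arrows $m\to n$ the sets of arrows $m\to n$ of $\mathbb{S}^{\mathrm{MC}}_{\to}$; $;,\oplus,\mathrm{tr}$ are applied elementwise ($F;G=\{f;g\mid f\in F,g\in G\}$ etc.), identities and swaps are singletons of those of $\mathbb{S}^{\mathrm{MC}}_{\to}$. Solution functor on roMDPs. For an roMDP $\mathcal{A}$ and a memoryless scheduler $\tau\colon Q\to A$, the induced rightward open Markov chain $\mathcal{A}_\tau$ has the same data but action set $\{\star\}$ and $P(s,\star,t)=P^{\mathcal A}(s,\tau(s),t)$. For a Markov chain (single action), a path from entrance $i$ to exit $j$ is a sequence $i,s_1,\dots,s_k,j$ of positions $s_1,\dots,s_k$ whose first element after $i$ is $E(i)$; its probability is $\prod_{t=1}^kP(s_t,\star,s_{t+1})$ ($s_{k+1}=j$) and its reward $\sum_tR(s_t)$. $\mathrm{RPr}_{i,j}$ is the sum of path probabilities from $i$ to $j$, and $\mathrm{ERw}_{i,j}$ the sum of probability times reward over those paths. $\mathcal{S}^{\mathrm{MC}}_{\to}(\mathcal C)(i,j)=(\mathrm{RPr}^{\mathcal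 C}_{i,j},\mathrm{ERw}^{\mathcal C}_{i,j})$, and $\mathcal{S}_{\to}(\mathcal A)=\{\mathcal{S}^{\mathrm{MC}}_{\to}(\mathcal A_\tau)\mid\tau\colon Q^{\mathcal A}\to A\}$. Int construction (Joyal–Street–Verity) of a traced symmetric monoidal category $\mathbb C$ with objects natural numbers: objects are pairs $(\vec m,\overleftarrow m)$; arrows $(\vec m,\overleftarrow m)\to(\vec n,\overleftarrow n)$ are arrows $\vec m+\overleftarrow n\to\vec n+\overleftarrow m$ of $\mathbb C$; the composite of $f\colon(\vec m,\overleftarrow m)\to(\vec l,\overleftarrow l)$ and $g\colon(\vec l,\overleftarrow l)\to(\vec n,\overleftarrow n)$ is $\mathrm{tr}^{\overleftarrow l}\big((\sigma_{\overleftarrow l,\vec m}\oplus\mathrm{id}_{\overleftarrow n});(f\oplus\mathrm{id}_{\overleftarrow n});(\mathrm{id}_{\vec l}\oplus\sigma_{\overleftarrow m,\overleftarrow n});(g\oplus\mathrm{id}_{\overleftarrow m});(\sigma_{\vec n,\overleftarrow l}\oplus\mathrm{id}_{\overleftarrow m})\big)$, where $\sigma$ are swaps; the monoidal product, units and counits are those of the standard Int construction, making $\mathrm{Int}(\mathbb C)$ compact closed; a traced symmetric monoidal functor $F$ induces $\mathrm{Int}(F)$ acting as $F$ on arrows. *)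

theory Defs
  imports "Jordan_Normal_Form.Matrix" "HOL-Analysis.Infinite_Sum"
begin

text \<open>
  The \<open>k\<close>-element set of entrances or exits is \<open>{..<k}\<close>, i.e. indices start at \<open>0\<close>, as in the
  matrix library; the shifts by \<open>l\<close>, \<open>m\<close>, \<open>n\<close> below are unaffected by this. The nonempty finite
  set of actions is a type of class \<open>finite\<close>.
\<close>

section \<open>Rightward open MDPs\<close>

text \<open>
  In values of type \<open>'q + nat\<close>, \<open>Inl q\<close> is a position and \<open>Inr j\<close> an exit. The components
  \<open>entr\<close>, \<open>trans_prob\<close>, \<open>reward\<close> are relevant only on entrances below \<open>n_ents\<close>, on \<open>positions\<close>, and
  on exits below \<open>n_exits\<close>.
\<close>

record ('q, 'a) romdp =
  n_ents :: nat
  n_exits :: nat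
  positions :: "'q set"
  entr :: "nat \<Rightarrow> 'q + nat"
  trans_prob :: "'q \<Rightarrow> 'a \<Rightarrow> 'q + nat \<Rightarrow> real"
  reward :: "'q \<Rightarrow> real"

definition targets :: "('q, 'a) romdp \<Rightarrow> ('q + nat) set" where
  "targets A = positions A <+> {..<n_exits A}"

text \<open>The argument is an element of \<open>[m] + Q\<close>: \<open>Inl i\<close> is an entrance, \<open>Inr s\<close> a position.\<close>

fun exits :: "('q, 'a) romdp \<Rightarrow> nat + 'q \<Rightarrow> nat set" where
  "exits A (Inl i) = {t. t < n_exits A \<and> entr A i = Inr t}"
| "exits A (Inr s) = {t. t < n_exits A \<and> (\<exists>a. trans_prob A s a (Inr t) > 0)}"

definition unique_access :: "('q, 'a) romdp \<Rightarrow> bool" where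
  "unique_access A \<longleftrightarrow>
     (\<forall>s \<in> {..<n_ents A} <+> positions A. \<forall>s' \<in> {..<n_ents A} <+> positions A.
        exits A s \<inter> exits A s' \<noteq> {} \<longrightarrow> s = s') \<and>
     (\<forall>s \<in> positions A. \<forall>a b. \<forall>t < n_exits A.
        trans_prob A s a (Inr t) > 0 \<and> trans_prob A s b (Inr t) > 0 \<longrightarrow> a = b)"

definition is_romdp :: "('q, 'a) romdp \<Rightarrow> bool" where
  "is_romdp A \<longleftrightarrow>
     finite (positions A) \<and>
     (\<forall>i < n_ents A. entr A i \<in> targets A) \<and>
     (\<forall>s \<in> positions A. \<forall>a. \<forall>t \<in> targets A. trans_prob A s a t \<ge> 0) \<and>
     (\<forall>s \<in> positions A. \<forall>a. (\<Sum>t \<in> targets A. trans_prob A s a t) \<in> {0, 1}) \<and>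
     (\<forall>s \<in> positions A. reward A s \<ge> 0) \<and>
     unique_access A"

definition romdp_iso :: "('q, 'a) romdp \<Rightarrow> ('r, 'a) romdp \<Rightarrow> bool" where
  "romdp_iso A B \<longleftrightarrow>
     n_ents A = n_ents B \<and> n_exits A = n_exits B \<and>
     (\<exists>\<eta>. bij_betw \<eta> (positions A) (positions B) \<and>
        (\<forall>i < n_ents A. entr B i = map_sum \<eta> id (entr A i)) \<and>
        (\<forall>s \<in> positions A. \<forall>a. \<forall>t \<in> targets A.
           trans_prob B (\<eta> s) a (map_sum \<eta> id t) = trans_prob A s a t) \<and>
        (\<forall>s \<in> positions A. reward B (\<eta> s) = reward A s))"

subsection \<open>Operations\<close>

fun seq_prob :: "('q, 'a) romdp \<Rightarrow> ('r, 'a) romdp \<Rightarrow> 'q + 'r \<Rightarrow> 'a \<Rightarrow> ('q + 'r) + nat \<Rightarrow> real" where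
  "seq_prob A B (Inl s) a (Inl (Inl s')) = trans_prob A s a (Inl s')"
| "seq_prob A B (Inl s) a (Inl (Inr s')) =
     (\<Sum>i<n_exits A. trans_prob A s a (Inr i) * of_bool (entr B i = Inl s'))"
| "seq_prob A B (Inl s) a (Inr j) =
     (\<Sum>i<n_exits A. trans_prob A s a (Inr i) * of_bool (entr B i = Inr j))"
| "seq_prob A B (Inr s) a (Inl (Inl s')) = 0"
| "seq_prob A B (Inr s) a (Inl (Inr s')) = trans_prob B s a (Inl s')"
| "seq_prob A B (Inr s) a (Inr j) = trans_prob B s a (Inr j)"

definition romdp_seq :: "('q, 'a) romdp \<Rightarrow> ('r, 'a) romdp \<Rightarrow> ('q + 'r, 'a) romdp" where
  "romdp_seq A B =
     \<lparr> n_ents = n_ents A, n_exits = n_exits B, positions = positions A <+> positions B,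
       entr = (\<lambda>i. case entr A i of Inl s \<Rightarrow> Inl (Inl s) | Inr k \<Rightarrow> map_sum Inr id (entr B k)),
       trans_prob = seq_prob A B,
       reward = case_sum (reward A) (reward B) \<rparr>"

fun sum_prob :: "('q, 'a) romdp \<Rightarrow> ('r, 'a) romdp \<Rightarrow> 'q + 'r \<Rightarrow> 'a \<Rightarrow> ('q + 'r) + nat \<Rightarrow> real" where
  "sum_prob A B (Inl s) a (Inl (Inl s')) = trans_prob A s a (Inl s')"
| "sum_prob A B (Inl s) a (Inl (Inr s')) = 0"
| "sum_prob A B (Inl s) a (Inr j) =
     (if j < n_exits A then trans_prob A s a (Inr j) else 0)"
| "sum_prob A B (Inr s) a (Inl (Inl s')) = 0"
| "sum_prob A B (Inr s) a (Inl (Inr s')) = trans_prob B s a (Inl s')"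
| "sum_prob A B (Inr s) a (Inr j) =
     (if j < n_exits A then 0 else trans_prob B s a (Inr (j - n_exits A)))"

definition romdp_sum :: "('q, 'a) romdp \<Rightarrow> ('r, 'a) romdp \<Rightarrow> ('q + 'r, 'a) romdp" where
  "romdp_sum A B =
     \<lparr> n_ents = n_ents A + n_ents B, n_exits = n_exits A + n_exits B,
       positions = positions A <+> positions B,
       entr = (\<lambda>i. if i < n_ents A then map_sum Inl id (entr A i)
                   else map_sum Inr (\<lambda>j. j + n_exits A) (entr B (i - n_ents A))),
       trans_prob = sum_prob A B,
       reward = case_sum (reward A) (reward B) \<rparr>"

definition romdp_id :: "nat \<Rightarrow> ('q, 'a) romdp" where
  "romdp_id m =
     \<lparr> n_ents = m, n_exits = m, positions = {}, entr = Inr,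
       trans_prob = (\<lambda>_ _ _. 0), reward = (\<lambda>_. 0) \<rparr>"

definition romdp_swap :: "nat \<Rightarrow> nat \<Rightarrow> ('q, 'a) romdp" where
  "romdp_swap m n =
     \<lparr> n_ents = m + n, n_exits = n + m, positions = {},
       entr = (\<lambda>i. Inr (if i < m then i + n else i - m)),
       trans_prob = (\<lambda>_ _ _. 0), reward = (\<lambda>_. 0) \<rparr>"

text \<open>
  \<open>trace_seq A i j\<close> is the \<open>j\<close>-th element of the sequence started at the entrance \<open>i\<close>, each exit
  being fed back as the entrance with the same index. The initial \<open>Inr i\<close> stands for the entrance
  \<open>i\<close>; from index \<open>1\<close> on, \<open>Inr k\<close> is the exit \<open>k\<close>. Values after the sequence has left the exits
  in \<open>{..<l}\<close> are never used.
\<close>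

primrec trace_seq :: "('q, 'a) romdp \<Rightarrow> nat \<Rightarrow> nat \<Rightarrow> 'q + nat" where
  "trace_seq A i 0 = Inr i"
| "trace_seq A i (Suc j) = (case trace_seq A i j of Inl s \<Rightarrow> Inl s | Inr k \<Rightarrow> entr A k)"

definition trace_prec :: "nat \<Rightarrow> ('q, 'a) romdp \<Rightarrow> 'q + nat \<Rightarrow> nat set" where
  "trace_prec l A t =
     {i. i < l \<and> (\<exists>k. trace_seq A i k = t \<and> (\<forall>j<k. trace_seq A i j \<in> Inr ` {..<l}))}"

definition trace_entr :: "nat \<Rightarrow> ('q, 'a) romdp \<Rightarrow> nat \<Rightarrow> 'q + nat" where
  "trace_entr l A i =
     (let k = (LEAST k. k \<ge> 1 \<and> trace_seq A (i + l) k \<notin> Inr ` {..<l})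
      in map_sum id (\<lambda>j. j - l) (trace_seq A (i + l) k))"

definition romdp_trace :: "nat \<Rightarrow> ('q, 'a) romdp \<Rightarrow> ('q, 'a) romdp" where
  "romdp_trace l A =
     \<lparr> n_ents = n_ents A - l, n_exits = n_exits A - l, positions = positions A,
       entr = trace_entr l A,
       trans_prob = (\<lambda>q a t. let t' = map_sum id (\<lambda>j. j + l) t
                      in trans_prob A q a t' + (\<Sum>i \<in> trace_prec l A t'. trans_prob A q a (Inr i))),
       reward = reward A \<rparr>"

section \<open>Traced symmetric monoidal structures on the natural numbers\<close>

text \<open>
  Objects are the natural numbers, the tensor on objects is addition, and the structural
  isomorphisms other than the symmetry are identities.
\<close>

record 'f tsmc =
  hom :: "nat \<Rightarrow> nat \<Rightarrow> 'f set"
  cmp :: "'f \<Rightarrow> 'f \<Rightarrow> 'f"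
  ident :: "nat \<Rightarrow> 'f"
  tens :: "'f \<Rightarrow> 'f \<Rightarrow> 'f"
  swp :: "nat \<Rightarrow> nat \<Rightarrow> 'f"
  tr :: "nat \<Rightarrow> 'f \<Rightarrow> 'f"

subsection \<open>The category of roMDPs\<close>

text \<open>
  As position sets are finite, every isomorphism class has representatives whose positions are
  natural numbers; an arrow is the set of all these representatives.
\<close>

type_synonym 'a romdp_arrow = "(nat, 'a) romdp set"

definition iso_class :: "('q, 'a) romdp \<Rightarrow> 'a romdp_arrow" where
  "iso_class A = {B. is_romdp B \<and> romdp_iso A B}"

definition roMDP :: "('a::finite) romdp_arrow tsmc" where
  "roMDP =
     \<lparr> hom = (\<lambda>m n. {iso_class A | A :: (nat, 'a) romdp.
                       is_romdp A \<and> n_ents A = m \<and> n_exits A = n}),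
       cmp = (\<lambda>X Y. \<Union>A\<in>X. \<Union>B\<in>Y. iso_class (romdp_seq A B)),
       ident = (\<lambda>m. iso_class (romdp_id m :: (nat, 'a) romdp)),
       tens = (\<lambda>X Y. \<Union>A\<in>X. \<Union>B\<in>Y. iso_class (romdp_sum A B)),
       swp = (\<lambda>m n. iso_class (romdp_swap m n :: (nat, 'a) romdp)),
       tr = (\<lambda>l X. \<Union>A\<in>X. iso_class (romdp_trace l A)) \<rparr>"

subsection \<open>The semantic categories\<close>

text \<open>An arrow of the semantic category of Markov chains is a matrix of pairs \<open>(p, r)\<close>.\<close>

type_synonym mc_arrow = "(real \<times> real) mat"

definition mc_hom :: "nat \<Rightarrow> nat \<Rightarrow> mc_arrow set" where
  "mc_hom m n =
     {f \<in> carrier_mat m n.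
        (\<forall>i<m. \<forall>j<n. fst (f $$ (i,j)) \<ge> 0 \<and> snd (f $$ (i,j)) \<ge> 0) \<and>
        (\<forall>i<m. (\<Sum>j<n. fst (f $$ (i,j))) \<le> 1) \<and>
        (\<forall>i<m. \<forall>j<n. fst (f $$ (i,j)) = 0 \<longrightarrow> snd (f $$ (i,j)) = 0)}"

abbreviation p_mat :: "mc_arrow \<Rightarrow> real mat" where
  "p_mat f \<equiv> map_mat fst f"

abbreviation r_mat :: "mc_arrow \<Rightarrow> real mat" where
  "r_mat f \<equiv> map_mat snd f"

definition pair_mat :: "real mat \<Rightarrow> real mat \<Rightarrow> mc_arrow" where
  "pair_mat P R = mat (dim_row P) (dim_col P) (\<lambda>ij. (P $$ ij, R $$ ij))"

definition mc_comp :: "mc_arrow \<Rightarrow> mc_arrow \<Rightarrow> mc_arrow" where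
  "mc_comp f g = pair_mat (p_mat f * p_mat g) (p_mat f * r_mat g + r_mat f * p_mat g)"

definition mc_sum :: "mc_arrow \<Rightarrow> mc_arrow \<Rightarrow> mc_arrow" where
  "mc_sum f g =
     four_block_mat f (0\<^sub>m (dim_row f) (dim_col g)) (0\<^sub>m (dim_row g) (dim_col f)) g"

definition mc_id :: "nat \<Rightarrow> mc_arrow" where
  "mc_id m = mat m m (\<lambda>(i,j). (of_bool (i = j), 0))"

definition mc_swap :: "nat \<Rightarrow> nat \<Rightarrow> mc_arrow" where
  "mc_swap m n =
     mat (m + n) (n + m) (\<lambda>(i,j). (of_bool (j = (if i < m then i + n else i - m)), 0))"

definition submat :: "real mat \<Rightarrow> nat \<Rightarrow> nat \<Rightarrow> nat \<Rightarrow> nat \<Rightarrow> real mat" where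
  "submat M r c nr nc = mat nr nc (\<lambda>(i,j). M $$ (r + i, c + j))"

definition mc_trace :: "nat \<Rightarrow> mc_arrow \<Rightarrow> mc_arrow" where
  "mc_trace l h =
     (let m = dim_row h - l; n = dim_col h - l; P = p_mat h; R = r_mat h;
          A\<^sub>p = submat P l 0 m l; B\<^sub>p = submat P 0 0 l l; C\<^sub>p = submat P 0 l l n;
          A\<^sub>r = submat R l 0 m l; B\<^sub>r = submat R 0 0 l l; C\<^sub>r = submat R 0 l l n;
          A = four_block_mat A\<^sub>p A\<^sub>r (0\<^sub>m 0 l) (0\<^sub>m 0 l);
          B = four_block_mat B\<^sub>p B\<^sub>r (0\<^sub>m l l) B\<^sub>p;
          C = C\<^sub>r @\<^sub>r C\<^sub>p
      in mat m n (\<lambda>(i,j).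
           (P $$ (l + i, l + j) + (\<Sum>d. (A\<^sub>p * B\<^sub>p ^\<^sub>m d * C\<^sub>p) $$ (i,j)),
            R $$ (l + i, l + j) + (\<Sum>d. (A * B ^\<^sub>m d * C) $$ (i,j)))))"

definition semR :: "mc_arrow set tsmc" where
  "semR =
     \<lparr> hom = (\<lambda>m n. Pow (mc_hom m n)),
       cmp = (\<lambda>F G. {mc_comp f g | f g. f \<in> F \<and> g \<in> G}),
       ident = (\<lambda>m. {mc_id m}),
       tens = (\<lambda>F G. {mc_sum f g | f g. f \<in> F \<and> g \<in> G}),
       swp = (\<lambda>m n. {mc_swap m n}),
       tr = (\<lambda>l F. mc_trace l ` F) \<rparr>"

section \<open>The solution functor on roMDPs\<close>

definition induced_mc :: "('q, 'a) romdp \<Rightarrow> ('q \<Rightarrow> 'a) \<Rightarrow> ('q, unit) romdp" where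
  "induced_mc A \<tau> =
     \<lparr> n_ents = n_ents A, n_exits = n_exits A, positions = positions A, entr = entr A,
       trans_prob = (\<lambda>s _ t. trans_prob A s (\<tau> s) t), reward = reward A \<rparr>"

text \<open>A path \<open>i, s\<^sub>1, \<dots>, s\<^sub>k, j\<close> is represented by the list of the positions \<open>s\<^sub>1, \<dots>, s\<^sub>k\<close>.\<close>

definition paths :: "('q, unit) romdp \<Rightarrow> nat \<Rightarrow> nat \<Rightarrow> 'q list set" where
  "paths C i j = {ss. set ss \<subseteq> positions C \<and> hd (map Inl ss @ [Inr j]) = entr C i}"

definition path_prob :: "('q, unit) romdp \<Rightarrow> nat \<Rightarrow> 'q list \<Rightarrow> real" where
  "path_prob C j ss =
     (\<Prod>t<length ss. trans_prob C (ss ! t) () ((map Inl ss @ [Inr j]) ! Suc t))"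

definition path_reward :: "('q, unit) romdp \<Rightarrow> 'q list \<Rightarrow> real" where
  "path_reward C ss = (\<Sum>t<length ss. reward C (ss ! t))"

definition RPr :: "('q, unit) romdp \<Rightarrow> nat \<Rightarrow> nat \<Rightarrow> real" where
  "RPr C i j = (\<Sum>\<^sub>\<infinity>ss \<in> paths C i j. path_prob C j ss)"

definition ERw :: "('q, unit) romdp \<Rightarrow> nat \<Rightarrow> nat \<Rightarrow> real" where
  "ERw C i j = (\<Sum>\<^sub>\<infinity>ss \<in> paths C i j. path_prob C j ss * path_reward C ss)"

definition mc_solution :: "('q, unit) romdp \<Rightarrow> mc_arrow" where
  "mc_solution C = mat (n_ents C) (n_exits C) (\<lambda>(i,j). (RPr C i j, ERw C i j))"

definition romdp_solution :: "('q, 'a) romdp \<Rightarrow> mc_arrow set" where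
  "romdp_solution A = {mc_solution (induced_mc A \<tau>) | \<tau>. True}"

text \<open>Isomorphic roMDPs have the same solution, so this union is over equal sets.\<close>

definition solR :: "'a romdp_arrow \<Rightarrow> mc_arrow set" where
  "solR X = (\<Union>A\<in>X. romdp_solution A)"

section \<open>The Int construction and compact closed functors\<close>

text \<open>
  Structure of a strict compact closed category whose objects are all elements of \<open>'o\<close>. An arrow
  does not determine its source and target, so these are passed explicitly:
  \<open>cc_comp X Y Z f g\<close> is the composite of \<open>f: X \<rightarrow> Y\<close> and \<open>g: Y \<rightarrow> Z\<close>, and
  \<open>cc_tens X Y X' Y' f g\<close> is the monoidal product of \<open>f: X \<rightarrow> Y\<close> and \<open>g: X' \<rightarrow> Y'\<close>. With
  \<open>X\<^sup>*\<close> for \<open>cc_dual X\<close>, the unit \<open>cc_eta X\<close> is an arrow \<open>I \<rightarrow> X \<otimes> X\<^sup>*\<close> and the counit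
  \<open>cc_eps X\<close> an arrow \<open>X\<^sup>* \<otimes> X \<rightarrow> I\<close>.
\<close>

record ('o, 'f) compact_closed =
  cc_hom :: "'o \<Rightarrow> 'o \<Rightarrow> 'f set"
  cc_comp :: "'o \<Rightarrow> 'o \<Rightarrow> 'o \<Rightarrow> 'f \<Rightarrow> 'f \<Rightarrow> 'f"
  cc_id :: "'o \<Rightarrow> 'f"
  cc_I :: 'o
  cc_tens_obj :: "'o \<Rightarrow> 'o \<Rightarrow> 'o"
  cc_tens :: "'o \<Rightarrow> 'o \<Rightarrow> 'o \<Rightarrow> 'o \<Rightarrow> 'f \<Rightarrow> 'f \<Rightarrow> 'f"
  cc_sym :: "'o \<Rightarrow> 'o \<Rightarrow> 'f"
  cc_dual :: "'o \<Rightarrow> 'o"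
  cc_eta :: "'o \<Rightarrow> 'f"
  cc_eps :: "'o \<Rightarrow> 'f"

fun int_comp :: "'f tsmc \<Rightarrow> nat \<times> nat \<Rightarrow> nat \<times> nat \<Rightarrow> nat \<times> nat \<Rightarrow> 'f \<Rightarrow> 'f \<Rightarrow> 'f" where
  "int_comp C (m, m') (l, l') (n, n') f g =
     tr C l'
       (cmp C (tens C (swp C l' m) (ident C n'))
       (cmp C (tens C f (ident C n'))
       (cmp C (tens C (ident C l) (swp C m' n'))
       (cmp C (tens C g (ident C m'))
              (tens C (swp C n l') (ident C m'))))))"

text \<open>
  For \<open>f: m + n' \<rightarrow> n + m'\<close> and \<open>g: k + l' \<rightarrow> l + k'\<close>, the monoidal product is the arrow
  \<open>(m + k) + (n' + l') \<rightarrow> (n + l) + (m' + k')\<close> obtained by permuting the middle wires.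
\<close>

fun int_tens ::
  "'f tsmc \<Rightarrow> nat \<times> nat \<Rightarrow> nat \<times> nat \<Rightarrow> nat \<times> nat \<Rightarrow> nat \<times> nat \<Rightarrow> 'f \<Rightarrow> 'f \<Rightarrow> 'f" where
  "int_tens C (m, m') (n, n') (k, k') (l, l') f g =
     cmp C (tens C (tens C (ident C m) (swp C k n')) (ident C l'))
       (cmp C (tens C f g)
              (tens C (tens C (ident C n) (swp C m' l)) (ident C k')))"

definition Int_cat :: "'f tsmc \<Rightarrow> (nat \<times> nat, 'f) compact_closed" where
  "Int_cat C =
     \<lparr> cc_hom = (\<lambda>(m, m') (n, n'). hom C (m + n') (n + m')),
       cc_comp = int_comp C,
       cc_id = (\<lambda>(m, m'). ident C (m + m')),
       cc_I = (0, 0),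
       cc_tens_obj = (\<lambda>(m, m') (k, k'). (m + k, m' + k')),
       cc_tens = int_tens C,
       cc_sym = (\<lambda>(m, m') (k, k'). tens C (swp C m k) (swp C k' m')),
       cc_dual = (\<lambda>(m, m'). (m', m)),
       cc_eta = (\<lambda>(m, m'). swp C m' m),
       cc_eps = (\<lambda>(m, m'). swp C m' m) \<rparr>"

record ('o, 'f, 'p, 'g) functor_data =
  fobj :: "'o \<Rightarrow> 'p"
  farr :: "'o \<Rightarrow> 'o \<Rightarrow> 'f \<Rightarrow> 'g"

definition Int_functor :: "('f \<Rightarrow> 'g) \<Rightarrow> (nat \<times> nat, 'f, nat \<times> nat, 'g) functor_data" where
  "Int_functor F = \<lparr> fobj = (\<lambda>X. X), farr = (\<lambda>X Y f. F f) \<rparr>"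

text \<open>
  A functor that strictly preserves the symmetric monoidal structure, the duals, the units and the
  counits.
\<close>

definition compact_closed_functor ::
  "('o, 'f) compact_closed \<Rightarrow> ('p, 'g) compact_closed \<Rightarrow> ('o, 'f, 'p, 'g) functor_data \<Rightarrow> bool" where
  "compact_closed_functor C D F \<longleftrightarrow>
     (\<forall>X Y. \<forall>f \<in> cc_hom C X Y. farr F X Y f \<in> cc_hom D (fobj F X) (fobj F Y)) \<and>
     (\<forall>X. farr F X X (cc_id C X) = cc_id D (fobj F X)) \<and>
     (\<forall>X Y Z. \<forall>f \<in> cc_hom C X Y. \<forall>g \<in> cc_hom C Y Z.
        farr F X Z (cc_comp C X Y Z f g) =
        cc_comp D (fobj F X) (fobj F Y) (fobj F Z) (farr F X Y f) (farr F Y Z g)) \<and>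
     fobj F (cc_I C) = cc_I D \<and>
     (\<forall>X Y. fobj F (cc_tens_obj C X Y) = cc_tens_obj D (fobj F X) (fobj F Y)) \<and>
     (\<forall>X Y X' Y'. \<forall>f \<in> cc_hom C X Y. \<forall>g \<in> cc_hom C X' Y'.
        farr F (cc_tens_obj C X X') (cc_tens_obj C Y Y') (cc_tens C X Y X' Y' f g) =
        cc_tens D (fobj F X) (fobj F Y) (fobj F X') (fobj F Y') (farr F X Y f) (farr F X' Y' g)) \<and>
     (\<forall>X Y. farr F (cc_tens_obj C X Y) (cc_tens_obj C Y X) (cc_sym C X Y) =
        cc_sym D (fobj F X) (fobj F Y)) \<and>
     (\<forall>X. fobj F (cc_dual C X) = cc_dual D (fobj F X)) \<and>
     (\<forall>X. farr F (cc_I C) (cc_tens_obj C X (cc_dual C X)) (cc_eta C X) = cc_eta D (fobj F X)) \<and>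
     (\<forall>X. farr F (cc_tens_obj C (cc_dual C X) X) (cc_I C) (cc_eps C X) = cc_eps D (fobj F X))"

definition oMDP :: "(nat \<times> nat, ('a::finite) romdp_arrow) compact_closed" where
  "oMDP = Int_cat roMDP"

definition Sem :: "(nat \<times> nat, mc_arrow set) compact_closed" where
  "Sem = Int_cat semR"

definition Sol :: "(nat \<times> nat, ('a::finite) romdp_arrow, nat \<times> nat, mc_arrow set) functor_data" where
  "Sol = Int_functor solR"

end

theory Submission
  imports Defs
begin

text \<open>
  A path of probability \<open>p\<close> and reward \<open>r\<close> gets as weight the dual number \<open>p + p r \<epsilon>\<close> with
  \<open>\<epsilon>\<^sup>2 = 0\<close>, the product of the weights \<open>P(s, t) (1 + R(s) \<epsilon>)\<close> of its steps. Under this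
  reading, composition and trace in the semantic category of Markov chains are matrix product and
  \<open>D + \<Sum>\<^sub>d A B\<^sup>d C\<close> over the dual numbers. Prescribing values at the exits of a chain, the expected
  values at its positions are the least nonnegative solution of a linear system, the limit of its
  Kleene iteration. Leastness shows that these values are preserved along a map of targets that
  pushes the transition probabilities of one chain forward to those of another. A component embeds
  in this way into a sequential composition or a sum, and a chain into its trace, by sending a fed
  back exit to the target it is finally wired to. In the last case the values on the fed back wires
  are the least solution of \<open>y = C + B y\<close>, which is the Neumann series \<open>\<Sum>\<^sub>d B\<^sup>d C\<close>. Unique access
  ensures that wires that are fed back forever are not reached, so that no probability is lost.
\<close>

section \<open>Dual numbers\<close>

datatype dual = Dual (real_part: real) (dual_part: real)

lemma dual_eqI: "real_part x = real_part y \<Longrightarrow> dual_part x = dual_part y \<Longrightarrow> x = y"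
  by (rule dual.expand) simp

instantiation dual :: comm_ring_1
begin

definition "0 = Dual 0 0"
definition "1 = Dual 1 0"
definition "x + y = Dual (real_part x + real_part y) (dual_part x + dual_part y)"
definition "- x = Dual (- real_part x) (- dual_part x)"
definition "x - y = Dual (real_part x - real_part y) (dual_part x - dual_part y)"
definition "x * y = Dual (real_part x * real_part y)
  (real_part x * dual_part y + dual_part x * real_part y)"

instance
  by standard
    (auto simp: zero_dual_def one_dual_def plus_dual_def uminus_dual_def minus_dual_def
      times_dual_def algebra_simps)

end

instantiation dual :: real_algebra_1
begin

definition "c *\<^sub>R x = Dual (c * real_part x) (c * dual_part x)"

instance
  by standard (auto simp: scaleR_dual_def plus_dual_def times_dual_def algebra_simps)

end

lemma dual_sel [simp]:
  "real_part 0 = 0" "dual_part 0 = 0"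
  "real_part 1 = 1" "dual_part 1 = 0"
  "real_part (x + y) = real_part x + real_part y"
  "dual_part (x + y) = dual_part x + dual_part y"
  "real_part (x - y) = real_part x - real_part y"
  "dual_part (x - y) = dual_part x - dual_part y"
  "real_part (x * y) = real_part x * real_part y"
  "dual_part (x * y) = real_part x * dual_part y + dual_part x * real_part y"
  "real_part (c *\<^sub>R x) = c * real_part x"
  "dual_part (c *\<^sub>R x) = c * dual_part x"
  by (simp_all add: zero_dual_def one_dual_def plus_dual_def minus_dual_def times_dual_def
      scaleR_dual_def)

instantiation dual :: real_normed_algebra_1
begin

definition "norm x = \<bar>real_part x\<bar> + \<bar>dual_part x\<bar>"
definition "sgn x = x /\<^sub>R norm (x :: dual)"
definition "dist x y = norm (x - y :: dual)"
definition "uniformity = (INF e\<in>{0<..}. principal {(x :: dual, y). dist x y < e})"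
definition "open U \<longleftrightarrow> (\<forall>x\<in>U. \<forall>\<^sub>F (x', y) in uniformity. x' = x \<longrightarrow> (y :: dual) \<in> U)"

instance
proof
  fix x y :: dual and c :: real
  show "norm x = 0 \<longleftrightarrow> x = 0"
    by (auto simp: norm_dual_def intro: dual_eqI)
  show "norm (x + y) \<le> norm x + norm y"
    by (simp add: norm_dual_def)
  show "norm (c *\<^sub>R x) = \<bar>c\<bar> * norm x"
    by (simp add: norm_dual_def abs_mult algebra_simps)
  have "norm (x * y) \<le> \<bar>real_part x\<bar> * \<bar>real_part y\<bar> +
      (\<bar>real_part x\<bar> * \<bar>dual_part y\<bar> + \<bar>dual_part x\<bar> * \<bar>real_part y\<bar>)"
    by (simp add: norm_dual_def abs_mult[symmetric] abs_triangle_ineq)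
  also have "\<dots> \<le> norm x * norm y"
    by (simp add: norm_dual_def algebra_simps)
  finally show "norm (x * y) \<le> norm x * norm y" .
qed (simp_all add: sgn_dual_def dist_dual_def uniformity_dual_def open_dual_def norm_dual_def)

end

lemma real_part_sum [simp]: "real_part (sum f S) = (\<Sum>x\<in>S. real_part (f x))"
  and dual_part_sum [simp]: "dual_part (sum f S) = (\<Sum>x\<in>S. dual_part (f x))"
  by (induction S rule: infinite_finite_induct) auto

lemma bounded_linear_real_part: "bounded_linear real_part"
  by (intro bounded_linear_intro[where K = 1]) (auto simp: norm_dual_def)

lemma bounded_linear_dual_part: "bounded_linear dual_part"
  by (intro bounded_linear_intro[where K = 1]) (auto simp: norm_dual_def)

interpretation real_part: comm_ring_hom real_part
  by unfold_locales simp_all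

lemma tendsto_dual_iff:
  "(f \<longlongrightarrow> L) F \<longleftrightarrow> ((\<lambda>x. real_part (f x)) \<longlongrightarrow> real_part L) F \<and>
     ((\<lambda>x. dual_part (f x)) \<longlongrightarrow> dual_part L) F" (is "_ \<longleftrightarrow> ?R \<and> ?D")
proof
  assume "?R \<and> ?D"
  then have "((\<lambda>x. \<bar>real_part (f x) - real_part L\<bar> + \<bar>dual_part (f x) - dual_part L\<bar>)
      \<longlongrightarrow> \<bar>real_part L - real_part L\<bar> + \<bar>dual_part L - dual_part L\<bar>) F"
    by (intro tendsto_intros) auto
  then have "((\<lambda>x. norm (f x - L)) \<longlongrightarrow> 0) F"
    by (simp add: norm_dual_def)
  then show "(f \<longlongrightarrow> L) F"
    by (simp add: tendsto_norm_zero_iff LIM_zero_iff)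
qed (auto intro: bounded_linear.tendsto bounded_linear_real_part bounded_linear_dual_part)

instantiation dual :: "{ordered_comm_ring, ordered_real_vector}"
begin

definition "x \<le> y \<longleftrightarrow> real_part x \<le> real_part y \<and> dual_part x \<le> dual_part y"
definition "x < y \<longleftrightarrow> x \<le> y \<and> \<not> y \<le> (x :: dual)"

instance
  by standard
    (auto simp: less_eq_dual_def less_dual_def intro!: dual_eqI add_mono
      intro: mult_left_mono mult_right_mono)

end

lemma Dual_nonneg: "0 \<le> x \<Longrightarrow> 0 \<le> y \<Longrightarrow> 0 \<le> Dual x y"
  by (simp add: less_eq_dual_def)

lemma of_bool_dual_nonneg [simp]: "0 \<le> (of_bool b :: dual)"
  by (simp add: less_eq_dual_def)

lemma LIMSEQ_dual_le_const:
  fixes L :: dual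
  assumes "X \<longlonglongrightarrow> L" "\<And>n. X n \<le> b"
  shows "L \<le> b"
  using assms by (auto simp: tendsto_dual_iff less_eq_dual_def intro: LIMSEQ_le_const2)

lemma LIMSEQ_dual_ge_const:
  fixes L :: dual
  assumes "X \<longlonglongrightarrow> L" "\<And>n. b \<le> X n"
  shows "b \<le> L"
  using assms by (auto simp: tendsto_dual_iff less_eq_dual_def intro: LIMSEQ_le_const)

lemma incseq_dual_convergent:
  fixes X :: "nat \<Rightarrow> dual"
  assumes "incseq X" "\<And>n. X n \<le> b"
  shows "convergent X"
proof -
  have "incseq (\<lambda>n. real_part (X n))" "incseq (\<lambda>n. dual_part (X n))"
    using assms(1) by (auto simp: incseq_def less_eq_dual_def)
  moreover have "real_part (X n) \<le> real_part b" "dual_part (X n) \<le> dual_part b" for n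
    using assms(2) by (auto simp: less_eq_dual_def)
  ultimately obtain x y where "(\<lambda>n. real_part (X n)) \<longlonglongrightarrow> x" "(\<lambda>n. dual_part (X n)) \<longlonglongrightarrow> y"
    by (metis incseq_convergent)
  then have "X \<longlonglongrightarrow> Dual x y"
    by (simp add: tendsto_dual_iff)
  then show ?thesis
    by (rule convergentI)
qed

section \<open>Kleene iteration\<close>

definition supersolution :: "'i set \<Rightarrow> (('i \<Rightarrow> dual) \<Rightarrow> 'i \<Rightarrow> dual) \<Rightarrow> ('i \<Rightarrow> dual) \<Rightarrow> bool" where
  "supersolution I \<Phi> v \<longleftrightarrow> (\<forall>i\<in>I. 0 \<le> v i \<and> \<Phi> v i \<le> v i)"

abbreviation kleene_iterate :: "(('i \<Rightarrow> dual) \<Rightarrow> 'i \<Rightarrow> dual) \<Rightarrow> nat \<Rightarrow> 'i \<Rightarrow> dual" where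
  "kleene_iterate \<Phi> n \<equiv> (\<Phi> ^^ n) (\<lambda>_. 0)"

locale continuous_operator =
  fixes I :: "'i set" and \<Phi> :: "('i \<Rightarrow> dual) \<Rightarrow> 'i \<Rightarrow> dual"
  assumes nonneg: "i \<in> I \<Longrightarrow> 0 \<le> \<Phi> (\<lambda>_. 0) i"
    and mono: "(\<And>i. i \<in> I \<Longrightarrow> v i \<le> w i) \<Longrightarrow> i \<in> I \<Longrightarrow> \<Phi> v i \<le> \<Phi> w i"
    and tendsto: "(\<And>i. i \<in> I \<Longrightarrow> (\<lambda>n. X n i) \<longlonglongrightarrow> v i) \<Longrightarrow> i \<in> I \<Longrightarrow> (\<lambda>n. \<Phi> (X n) i) \<longlonglongrightarrow> \<Phi> v i"
begin

lemma iterate_nonneg: "i \<in> I \<Longrightarrow> 0 \<le> kleene_iterate \<Phi> n i"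
proof (induction n arbitrary: i)
  case (Suc n)
  have "0 \<le> \<Phi> (\<lambda>_. 0) i" by (rule nonneg[OF Suc.prems])
  also have "\<dots> \<le> \<Phi> (kleene_iterate \<Phi> n) i" by (rule mono[OF Suc.IH Suc.prems])
  finally show ?case by simp
qed simp

lemma iterate_le_Suc: "i \<in> I \<Longrightarrow> kleene_iterate \<Phi> n i \<le> kleene_iterate \<Phi> (Suc n) i"
  by (induction n arbitrary: i) (auto intro: nonneg mono)

lemma iterate_le_supersolution:
  assumes "supersolution I \<Phi> v" "i \<in> I"
  shows "kleene_iterate \<Phi> n i \<le> v i"
  using assms(2)
proof (induction n arbitrary: i)
  case 0
  then show ?case using assms(1) by (simp add: supersolution_def)
next
  case (Suc n)
  have "\<Phi> (kleene_iterate \<Phi> n) i \<le> \<Phi> v i" by (rule mono[OF Suc.IH Suc.prems])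
  also have "\<dots> \<le> v i" using assms(1) Suc.prems by (simp add: supersolution_def)
  finally show ?case by simp
qed

lemma iterate_convergent:
  assumes "supersolution I \<Phi> v" "i \<in> I"
  shows "convergent (\<lambda>n. kleene_iterate \<Phi> n i)"
  using iterate_le_Suc iterate_le_supersolution assms
  by (intro incseq_dual_convergent[of _ "v i"] incseq_SucI) auto

lemma limit_fixed_point:
  assumes "\<And>i. i \<in> I \<Longrightarrow> (\<lambda>n. kleene_iterate \<Phi> n i) \<longlonglongrightarrow> y i" "i \<in> I"
  shows "\<Phi> y i = y i"
proof (rule LIMSEQ_unique)
  show "(\<lambda>n. kleene_iterate \<Phi> (Suc n) i) \<longlonglongrightarrow> \<Phi> y i"
    using tendsto[OF assms] by simp
  show "(\<lambda>n. kleene_iterate \<Phi> (Suc n) i) \<longlonglongrightarrow> y i"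
    by (rule LIMSEQ_Suc[OF assms(1)[OF assms(2)]])
qed

lemma limit_le_supersolution:
  assumes "\<And>i. i \<in> I \<Longrightarrow> (\<lambda>n. kleene_iterate \<Phi> n i) \<longlonglongrightarrow> y i" "supersolution I \<Phi> v" "i \<in> I"
  shows "y i \<le> v i"
  using LIMSEQ_dual_le_const[OF assms(1)[OF assms(3)]] iterate_le_supersolution[OF assms(2,3)] .

lemma iterate_tendsto_least:
  assumes y_super: "supersolution I \<Phi> y"
    and least: "\<And>v i. supersolution I \<Phi> v \<Longrightarrow> i \<in> I \<Longrightarrow> y i \<le> v i" and i_in: "i \<in> I"
  shows "(\<lambda>n. kleene_iterate \<Phi> n i) \<longlonglongrightarrow> y i"
proof -
  define z where "z i = lim (\<lambda>n. kleene_iterate \<Phi> n i)" for i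
  have z_lim: "(\<lambda>n. kleene_iterate \<Phi> n i) \<longlonglongrightarrow> z i" if "i \<in> I" for i
    using iterate_convergent[OF y_super that] by (simp add: z_def convergent_LIMSEQ_iff)
  have "supersolution I \<Phi> z"
    using limit_fixed_point[OF z_lim] LIMSEQ_dual_ge_const[OF z_lim iterate_nonneg]
    by (simp add: supersolution_def)
  then have "y i = z i"
    using least[OF _ i_in] limit_le_supersolution[OF z_lim y_super i_in] by (intro antisym)
  then show ?thesis
    using z_lim[OF i_in] by simp
qed

end

section \<open>One step of an roMDP\<close>

lemma targets_simps [simp]:
  "Inl s \<in> targets A \<longleftrightarrow> s \<in> positions A" "Inr j \<in> targets A \<longleftrightarrow> j < n_exits A"
  by (auto simp: targets_def)

lemma ball_targets:
  "(\<forall>t\<in>targets A. P t) \<longleftrightarrow> (\<forall>s\<in>positions A. P (Inl s)) \<and> (\<forall>j<n_exits A. P (Inr j))"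
  by (auto simp: targets_def)

definition expect :: "('q, 'a) romdp \<Rightarrow> 'a \<Rightarrow> 'q \<Rightarrow> ('q + nat \<Rightarrow> 'v) \<Rightarrow> 'v::real_vector" where
  "expect A a s v = (\<Sum>t\<in>targets A. trans_prob A s a t *\<^sub>R v t)"

definition proper_position :: "('q, 'a) romdp \<Rightarrow> 'q \<Rightarrow> bool" where
  "proper_position A s \<longleftrightarrow> 0 \<le> reward A s \<and>
     (\<forall>a. (\<forall>t\<in>targets A. 0 \<le> trans_prob A s a t) \<and> expect A a s (\<lambda>_. 1 :: real) \<in> {0, 1})"

text \<open>Counting a position once per action merges the two clauses of unique access into one.\<close>

definition accessors :: "('q, 'a) romdp \<Rightarrow> 'q + nat \<Rightarrow> (nat + 'q \<times> 'a) set" where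
  "accessors A t = {i. i < n_ents A \<and> entr A i = t} <+>
     {(s, a). s \<in> positions A \<and> 0 < trans_prob A s a t}"

lemma accessors_simps [simp]:
  "Inl i \<in> accessors A t \<longleftrightarrow> i < n_ents A \<and> entr A i = t"
  "Inr (s, a) \<in> accessors A t \<longleftrightarrow> s \<in> positions A \<and> 0 < trans_prob A s a t"
  by (auto simp: accessors_def)

definition subsingleton :: "'b set \<Rightarrow> bool" where
  "subsingleton S \<longleftrightarrow> (\<forall>x\<in>S. \<forall>y\<in>S. x = y)"

lemma subsingletonI: "(\<And>x y. x \<in> S \<Longrightarrow> y \<in> S \<Longrightarrow> x = y) \<Longrightarrow> subsingleton S"
  by (simp add: subsingleton_def)

lemma subsingletonD: "subsingleton S \<Longrightarrow> x \<in> S \<Longrightarrow> y \<in> S \<Longrightarrow> x = y"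
  by (simp add: subsingleton_def)

lemma subsingleton_image:
  assumes "S \<subseteq> f ` T" "subsingleton T"
  shows "subsingleton S"
proof (rule subsingletonI)
  fix x y assume "x \<in> S" "y \<in> S"
  then obtain u v where "u \<in> T" "x = f u" "v \<in> T" "y = f v"
    using assms(1) by blast
  then show "x = y"
    using subsingletonD[OF assms(2), of u v] by simp
qed

lemma unique_access_iff:
  fixes A :: "('q, 'a) romdp"
  shows "unique_access A \<longleftrightarrow> (\<forall>j<n_exits A. subsingleton (accessors A (Inr j)))"
proof -
  define D where "D = {..<n_ents A} <+> positions A"
  have exits_iff: "s \<in> D \<and> j \<in> exits A s \<longleftrightarrow> j < n_exits A \<and> s \<in> map_sum id fst ` accessors A (Inr j)"
    for j s
    by (cases s) (force simp: D_def accessors_def image_iff)+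
  show ?thesis
  proof (intro iffI allI impI)
    fix j assume unique: "unique_access A" and j_exit: "j < n_exits A"
    show "subsingleton (accessors A (Inr j))"
    proof (rule subsingletonI)
      fix x y assume xy_acc: "x \<in> accessors A (Inr j)" "y \<in> accessors A (Inr j)"
      then have "map_sum id fst x \<in> D" "map_sum id fst y \<in> D"
        "exits A (map_sum id fst x) \<inter> exits A (map_sum id fst y) \<noteq> {}"
        using j_exit exits_iff[of _ j] by blast+
      then have "map_sum id fst x = map_sum id fst y"
        using unique unfolding unique_access_def D_def[symmetric] by blast
      then show "x = y"
        using unique j_exit xy_acc unfolding unique_access_def by (cases x; cases y) auto
    qed
  next
    assume single: "\<forall>j<n_exits A. subsingleton (accessors A (Inr j))"
    have "s = s'" if "s \<in> D" "j \<in> exits A s" "s' \<in> D" "j \<in> exits A s'" for j s s'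
    proof -
      have "j < n_exits A" "s \<in> map_sum id fst ` accessors A (Inr j)"
        "s' \<in> map_sum id fst ` accessors A (Inr j)"
        using exits_iff[of s j] exits_iff[of s' j] that by simp_all
      then show ?thesis
        using single by (intro subsingletonD[OF subsingleton_image[OF subset_refl]]) auto
    qed
    moreover have "a = b"
      if "s \<in> positions A" "j < n_exits A"
        "trans_prob A s a (Inr j) > 0" "trans_prob A s b (Inr j) > 0"
      for s a b j
      using single that subsingletonD[of "accessors A (Inr j)" "Inr (s, a)" "Inr (s, b)"] by simp
    ultimately show "unique_access A"
      unfolding unique_access_def D_def[symmetric] disjoint_iff by blast
  qed
qed

lemma is_romdpD:
  assumes "is_romdp A"
  shows "finite (positions A)" "finite (targets A)"
    "\<And>i. i < n_ents A \<Longrightarrow> entr A i \<in> targets A"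
    "\<And>s a t. s \<in> positions A \<Longrightarrow> t \<in> targets A \<Longrightarrow> 0 \<le> trans_prob A s a t"
    "\<And>s a. s \<in> positions A \<Longrightarrow> expect A a s (\<lambda>_. 1 :: real) \<in> {0, 1}"
    "\<And>s. s \<in> positions A \<Longrightarrow> 0 \<le> reward A s"
  using assms by (auto simp: is_romdp_def targets_def expect_def)

lemma is_romdpI:
  assumes "finite (positions A)" "\<And>i. i < n_ents A \<Longrightarrow> entr A i \<in> targets A"
    "\<And>s. s \<in> positions A \<Longrightarrow> proper_position A s"
    "\<And>j. j < n_exits A \<Longrightarrow> subsingleton (accessors A (Inr j))"
  shows "is_romdp A"
  using assms by (simp add: is_romdp_def proper_position_def expect_def unique_access_iff)

lemma subsingleton_accessors:
  "is_romdp A \<Longrightarrow> j < n_exits A \<Longrightarrow> subsingleton (accessors A (Inr j))"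
  by (simp add: is_romdp_def unique_access_iff)

lemma expect_cong:
  "(\<And>t. t \<in> targets A \<Longrightarrow> v t = w t) \<Longrightarrow> expect A a s v = expect A a s w"
  by (simp add: expect_def)

lemma expect_zero [simp]: "expect A a s (\<lambda>_. 0) = 0"
  by (simp add: expect_def)

lemma expect_diff: "expect A a s (\<lambda>t. v t - w t) = expect A a s v - expect A a s w"
  by (simp add: expect_def scaleR_diff_right sum_subtractf)

lemma expect_sum: "expect A a s (\<lambda>t. \<Sum>k\<in>S. v k t) = (\<Sum>k\<in>S. expect A a s (v k))"
  by (simp add: expect_def scaleR_sum_right sum.swap[of _ _ S])

lemma expect_mult_right:
  "expect A a s (\<lambda>t. v t * c) = expect A a s v * (c :: 'v::real_algebra)"
  by (simp add: expect_def sum_distrib_right)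

lemma real_part_expect: "real_part (expect A a s v) = expect A a s (\<lambda>t. real_part (v t))"
  and dual_part_expect: "dual_part (expect A a s v) = expect A a s (\<lambda>t. dual_part (v t))"
  by (simp_all add: expect_def)

lemma expect_mono:
  fixes v w :: "'q + nat \<Rightarrow> 'v::ordered_real_vector"
  assumes "is_romdp A" "s \<in> positions A" "\<And>t. t \<in> targets A \<Longrightarrow> v t \<le> w t"
  shows "expect A a s v \<le> expect A a s w"
  unfolding expect_def using assms by (intro sum_mono scaleR_left_mono is_romdpD)

lemma expect_one_le: "is_romdp A \<Longrightarrow> s \<in> positions A \<Longrightarrow> expect A a s (\<lambda>_. 1 :: real) \<le> 1"
  using is_romdpD(5)[of A s a] by auto

lemma tendsto_expect:
  fixes L :: "'q + nat \<Rightarrow> 'v::real_normed_vector"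
  assumes "\<And>t. t \<in> targets A \<Longrightarrow> (\<lambda>n. v n t) \<longlonglongrightarrow> L t"
  shows "(\<lambda>n. expect A a s (v n)) \<longlonglongrightarrow> expect A a s L"
  unfolding expect_def using assms by (intro tendsto_intros)

section \<open>Embeddings\<close>

text \<open>The third clause is for the wires that a trace feeds back forever, where \<open>h\<close> leaves the
  targets of \<open>B\<close>.\<close>

definition embeds ::
  "('q \<Rightarrow> 'r) \<Rightarrow> ('q + nat \<Rightarrow> 'r + nat) \<Rightarrow> ('q, 'a) romdp \<Rightarrow> ('r, 'a) romdp \<Rightarrow> bool" where
  "embeds f h A B \<longleftrightarrow> (\<forall>s. h (Inl s) = Inl (f s)) \<and>
     (\<forall>s\<in>positions A. f s \<in> positions B \<and> reward B (f s) = reward A s) \<and>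
     (\<forall>s\<in>positions A. \<forall>a. \<forall>t\<in>targets A. h t \<notin> targets B \<longrightarrow> trans_prob A s a t = 0) \<and>
     (\<forall>s\<in>positions A. \<forall>a. \<forall>t'\<in>targets B.
        trans_prob B (f s) a t' = (\<Sum>t | t \<in> targets A \<and> h t = t'. trans_prob A s a t))"

lemma embedsD:
  assumes "embeds f h A B"
  shows "h (Inl s) = Inl (f s)"
    "s \<in> positions A \<Longrightarrow> f s \<in> positions B"
    "s \<in> positions A \<Longrightarrow> reward B (f s) = reward A s"
    "s \<in> positions A \<Longrightarrow> t \<in> targets A \<Longrightarrow> h t \<notin> targets B \<Longrightarrow> trans_prob A s a t = 0"
    "s \<in> positions A \<Longrightarrow> t' \<in> targets B \<Longrightarrow>
       trans_prob B (f s) a t' = (\<Sum>t | t \<in> targets A \<and> h t = t'. trans_prob A s a t)"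
  using assms unfolding embeds_def by blast+

lemma expect_embeds:
  assumes A_finite: "finite (targets A)" and B_finite: "finite (targets B)"
    and emb: "embeds f h A B" and s_pos: "s \<in> positions A"
  shows "expect B a (f s) v = expect A a s (\<lambda>t. v (h t))"
proof -
  let ?S = "{t \<in> targets A. h t \<in> targets B}"
  have "expect B a (f s) v =
      (\<Sum>t'\<in>targets B. \<Sum>t | t \<in> ?S \<and> h t = t'. trans_prob A s a t *\<^sub>R v (h t))"
    unfolding expect_def
    by (intro sum.cong) (auto simp: embedsD(5)[OF emb s_pos] scaleR_sum_left intro!: sum.cong)
  also have "\<dots> = (\<Sum>t\<in>?S. trans_prob A s a t *\<^sub>R v (h t))"
    using A_finite B_finite by (intro sum.group) auto
  also have "\<dots> = expect A a s (\<lambda>t. v (h t))"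
    unfolding expect_def using A_finite embedsD(4)[OF emb s_pos]
    by (intro sum.mono_neutral_left) auto
  finally show ?thesis .
qed

lemma expect_embeds_le:
  fixes v :: "'r + nat \<Rightarrow> 'v::ordered_real_vector"
  assumes A_romdp: "is_romdp A" and B_finite: "finite (targets B)"
    and emb: "embeds f h A B" and s_pos: "s \<in> positions A"
    and v_le_w: "\<And>t. t \<in> targets A \<Longrightarrow> h t \<in> targets B \<Longrightarrow> v (h t) \<le> w t"
  shows "expect B a (f s) v \<le> expect A a s w"
  unfolding expect_embeds[OF is_romdpD(2)[OF A_romdp] B_finite emb s_pos] unfolding expect_def
proof (rule sum_mono)
  fix t assume t_target: "t \<in> targets A"
  show "trans_prob A s a t *\<^sub>R v (h t) \<le> trans_prob A s a t *\<^sub>R w t"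
    using t_target v_le_w embedsD(4)[OF emb s_pos t_target] is_romdpD(4)[OF A_romdp s_pos t_target]
    by (cases "h t \<in> targets B") (auto intro: scaleR_left_mono)
qed

lemma proper_position_embeds:
  assumes A_romdp: "is_romdp A" and B_finite: "finite (targets B)"
    and emb: "embeds f h A B" and s_pos: "s \<in> positions A"
  shows "proper_position B (f s)"
proof -
  have "0 \<le> trans_prob B (f s) a t" if "t \<in> targets B" for a t
    using is_romdpD(4)[OF A_romdp s_pos] that
    by (auto simp: embedsD(5)[OF emb s_pos] intro!: sum_nonneg)
  then show ?thesis
    using is_romdpD(5,6)[OF A_romdp s_pos] embedsD(3)[OF emb s_pos]
      expect_embeds[OF is_romdpD(2)[OF A_romdp] B_finite emb s_pos, of _ "\<lambda>_. 1 :: real"]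
    by (simp add: proper_position_def)
qed

lemma accessors_embedsE:
  assumes emb: "embeds f h A B" and s_pos: "s \<in> positions A"
    and t'_acc: "t' \<in> targets B" "Inr (f s, a) \<in> accessors B t'"
  obtains t where "t \<in> targets A" "h t = t'" "Inr (s, a) \<in> accessors A t"
proof -
  have "0 < (\<Sum>t | t \<in> targets A \<and> h t = t'. trans_prob A s a t)"
    using t'_acc embedsD(5)[OF emb s_pos] by simp
  then obtain t where "t \<in> targets A" "h t = t'" "0 < trans_prob A s a t"
    by (metis (mono_tags, lifting) mem_Collect_eq not_less sum_nonpos)
  then show ?thesis using that s_pos by simp
qed

lemma embeds_map_sum:
  assumes f_inj: "inj_on f (positions A)" and g_inj: "inj g"
    and range: "\<And>s. s \<in> positions A \<Longrightarrow> f s \<in> positions B" "\<And>j. j < n_exits A \<Longrightarrow> g j < n_exits B"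
    and reward: "\<And>s. s \<in> positions A \<Longrightarrow> reward B (f s) = reward A s"
    and prob: "\<And>s a t. s \<in> positions A \<Longrightarrow> t \<in> targets A \<Longrightarrow>
      trans_prob B (f s) a (map_sum f g t) = trans_prob A s a t"
    and zero: "\<And>s a t. s \<in> positions A \<Longrightarrow> t \<in> targets B \<Longrightarrow> t \<notin> map_sum f g ` targets A \<Longrightarrow>
      trans_prob B (f s) a t = 0"
  shows "embeds f (map_sum f g) A B"
  unfolding embeds_def
proof (intro conjI allI ballI impI)
  fix s a t assume s_pos: "s \<in> positions A" and t_target: "t \<in> targets B"
  show "trans_prob B (f s) a t = (\<Sum>t' | t' \<in> targets A \<and> map_sum f g t' = t. trans_prob A s a t')"
  proof (cases "t \<in> map_sum f g ` targets A")
    case True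
    then obtain t' where t_eq: "t' \<in> targets A" "t = map_sum f g t'" by blast
    have "inj_on (map_sum f g) (targets A)"
      using f_inj g_inj by (intro inj_onI) (auto simp: targets_def dest: inj_onD injD)
    then have "{t \<in> targets A. map_sum f g t = map_sum f g t'} = {t'}"
      using t_eq(1) by (auto dest: inj_onD)
    then show ?thesis by (simp add: t_eq prob[OF s_pos])
  next
    case False
    then have "{t' \<in> targets A. map_sum f g t' = t} = {}" by blast
    then show ?thesis using zero[OF s_pos t_target False] by (metis sum.empty)
  qed
next
  fix s a t assume "t \<in> targets A" "map_sum f g t \<notin> targets B"
  then show "trans_prob A s a t = 0"
    using range by (cases t) auto
qed (use range(1) reward in auto)

section \<open>Schedulers\<close>

lemma induced_mc_simps [simp]:
  "n_ents (induced_mc A \<tau>) = n_ents A" "n_exits (induced_mc A \<tau>) = n_exits A"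
  "positions (induced_mc A \<tau>) = positions A" "entr (induced_mc A \<tau>) = entr A"
  "trans_prob (induced_mc A \<tau>) s u t = trans_prob A s (\<tau> s) t" "reward (induced_mc A \<tau>) = reward A"
  "targets (induced_mc A \<tau>) = targets A"
  by (auto simp: induced_mc_def targets_def)

lemma is_romdp_induced_mc:
  assumes A_romdp: "is_romdp A"
  shows "is_romdp (induced_mc A \<tau>)"
proof (rule is_romdpI)
  fix j assume "j < n_exits (induced_mc A \<tau>)"
  then have j_exit: "j < n_exits A" by simp
  define f where "f = map_sum (id :: nat \<Rightarrow> nat) (\<lambda>(s, _::unit). (s, \<tau> s))"
  have f_accessors: "f z \<in> accessors A (Inr j)" if "z \<in> accessors (induced_mc A \<tau>) (Inr j)" for z
    using that by (cases z) (auto simp: f_def)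
  have "inj f"
    unfolding f_def by (intro sum.inj_map) (auto simp: inj_def)
  show "subsingleton (accessors (induced_mc A \<tau>) (Inr j))"
  proof (rule subsingletonI)
    fix x y assume "x \<in> accessors (induced_mc A \<tau>) (Inr j)" "y \<in> accessors (induced_mc A \<tau>) (Inr j)"
    then have "f x = f y"
      by (intro subsingletonD[OF subsingleton_accessors[OF A_romdp j_exit]] f_accessors)
    then show "x = y"
      by (rule injD[OF \<open>inj f\<close>])
  qed
next
  show "proper_position (induced_mc A \<tau>) s" if "s \<in> positions (induced_mc A \<tau>)" for s
    using is_romdpD(4-6)[OF A_romdp, of s] that by (simp add: proper_position_def expect_def)
qed (use is_romdpD[OF A_romdp] in simp_all)

lemma embeds_induced_mc:
  assumes "embeds f h A B" "\<And>s. s \<in> positions A \<Longrightarrow> \<sigma> (f s) = \<tau> s"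
  shows "embeds f h (induced_mc A \<tau>) (induced_mc B \<sigma>)"
  using assms by (simp add: embeds_def)

section \<open>Paths to an exit\<close>

fun bellman :: "('q, unit) romdp \<Rightarrow> (nat \<Rightarrow> dual) \<Rightarrow> ('q + nat \<Rightarrow> dual) \<Rightarrow> 'q + nat \<Rightarrow> dual" where
  "bellman C c v (Inl s) = Dual 1 (reward C s) * expect C () s v"
| "bellman C c v (Inr j) = c j"

lemma continuous_operator_bellman:
  assumes C_romdp: "is_romdp C" and c_nonneg: "\<And>j. j < n_exits C \<Longrightarrow> 0 \<le> c j"
  shows "continuous_operator (targets C) (bellman C c)"
proof
  fix t assume t_target: "t \<in> targets C"
  show "0 \<le> bellman C c (\<lambda>_. 0) t"
    using t_target c_nonneg by (cases t) auto
  show "bellman C c v t \<le> bellman C c w t"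
    if "\<And>t. t \<in> targets C \<Longrightarrow> v t \<le> w t" for v w
    using t_target that
    by (cases t)
      (auto intro!: mult_left_mono expect_mono[OF C_romdp] Dual_nonneg is_romdpD(6)[OF C_romdp])
  show "(\<lambda>n. bellman C c (X n) t) \<longlonglongrightarrow> bellman C c v t"
    if "\<And>t. t \<in> targets C \<Longrightarrow> (\<lambda>n. X n t) \<longlonglongrightarrow> v t" for X v
    using that by (cases t) (auto intro!: tendsto_mult tendsto_expect)
qed

lemma supersolution_bellman_iff:
  "supersolution (targets C) (bellman C c) v \<longleftrightarrow>
     (\<forall>t\<in>targets C. 0 \<le> v t) \<and> (\<forall>j<n_exits C. c j \<le> v (Inr j)) \<and>
     (\<forall>s\<in>positions C. bellman C c v (Inl s) \<le> v (Inl s))"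
  by (auto simp: supersolution_def ball_targets)

abbreviation unit_payoff :: "nat \<Rightarrow> nat \<Rightarrow> dual" where
  "unit_payoff j \<equiv> \<lambda>i. of_bool (i = j)"

definition paths_from :: "('q, unit) romdp \<Rightarrow> nat \<Rightarrow> 'q + nat \<Rightarrow> 'q list set" where
  "paths_from C j t = {ss. set ss \<subseteq> positions C \<and> hd (map Inl ss @ [Inr j]) = t}"

definition path_weight :: "('q, unit) romdp \<Rightarrow> nat \<Rightarrow> 'q list \<Rightarrow> dual" where
  "path_weight C j ss = Dual (path_prob C j ss) (path_prob C j ss * path_reward C ss)"

definition reach :: "('q, unit) romdp \<Rightarrow> nat \<Rightarrow> 'q + nat \<Rightarrow> dual" where
  "reach C j t = Dual (\<Sum>\<^sub>\<infinity>ss\<in>paths_from C j t. path_prob C j ss)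
     (\<Sum>\<^sub>\<infinity>ss\<in>paths_from C j t. path_prob C j ss * path_reward C ss)"

lemma hd_path_in_targets:
  "set ss \<subseteq> positions C \<Longrightarrow> j < n_exits C \<Longrightarrow> hd (map Inl ss @ [Inr j]) \<in> targets C"
  by (cases ss) auto

lemma path_weight_Nil [simp]: "path_weight C j [] = 1"
  by (simp add: path_weight_def path_prob_def path_reward_def one_dual_def)

lemma path_prob_Cons:
  "path_prob C j (s # ss) = trans_prob C s () (hd (map Inl ss @ [Inr j])) * path_prob C j ss"
  unfolding path_prob_def
  by (simp add: prod.lessThan_Suc_shift hd_conv_nth del: prod.lessThan_Suc)

lemma path_reward_Cons: "path_reward C (s # ss) = reward C s + path_reward C ss"
  unfolding path_reward_def by (simp add: sum.lessThan_Suc_shift del: sum.lessThan_Suc)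

lemma path_weight_Cons: "path_weight C j (s # ss) =
    Dual 1 (reward C s) * (trans_prob C s () (hd (map Inl ss @ [Inr j])) *\<^sub>R path_weight C j ss)"
  by (intro dual_eqI)
    (simp_all add: path_weight_def path_prob_Cons path_reward_Cons algebra_simps)

lemma path_prob_nonneg:
  assumes "is_romdp C" "j < n_exits C" "set ss \<subseteq> positions C"
  shows "0 \<le> path_prob C j ss"
  using assms(3)
proof (induction ss)
  case (Cons s ss)
  then show ?case
    using hd_path_in_targets[OF _ assms(2), of ss] is_romdpD(4)[OF assms(1)]
    by (auto simp: path_prob_Cons)
qed (simp add: path_prob_def)

lemma path_reward_nonneg: "is_romdp C \<Longrightarrow> set ss \<subseteq> positions C \<Longrightarrow> 0 \<le> path_reward C ss"
  unfolding path_reward_def by (intro sum_nonneg is_romdpD) (auto simp: subset_iff)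

lemma reach_nonneg: "is_romdp C \<Longrightarrow> j < n_exits C \<Longrightarrow> 0 \<le> reach C j t"
  unfolding reach_def paths_from_def
  by (intro Dual_nonneg infsum_nonneg mult_nonneg_nonneg path_prob_nonneg path_reward_nonneg) auto

lemma finite_paths_from_length:
  assumes "finite (positions C)"
  shows "finite {ss \<in> paths_from C j t. length ss < n}"
  by (rule finite_subset[OF _ finite_lists_length_le[OF assms, of n]]) (auto simp: paths_from_def)

lemma paths_from_Inr: "paths_from C j (Inr i) = (if i = j then {[]} else {})"
  by (auto simp: paths_from_def hd_append hd_map split: if_splits)

lemma paths_from_Inl:
  assumes "s \<in> positions C" "j < n_exits C"
  shows "paths_from C j (Inl s) = (#) s ` (\<Union>t\<in>targets C. paths_from C j t)"
proof (intro equalityI subsetI)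
  fix ss assume "ss \<in> paths_from C j (Inl s)"
  then obtain ss' where "ss = s # ss'" "set ss' \<subseteq> positions C"
    by (cases ss) (auto simp: paths_from_def)
  then show "ss \<in> (#) s ` (\<Union>t\<in>targets C. paths_from C j t)"
    using hd_path_in_targets[OF _ assms(2)] by (auto simp: paths_from_def)
qed (use assms(1) in \<open>auto simp: paths_from_def\<close>)

lemma bellman_iterate_eq_sum_paths:
  assumes C_romdp: "is_romdp C" and j_exit: "j < n_exits C" and t_target: "t \<in> targets C"
  shows "kleene_iterate (bellman C (unit_payoff j)) n t =
    (\<Sum>ss | ss \<in> paths_from C j t \<and> length ss < n. path_weight C j ss)"
  using t_target
proof (induction n arbitrary: t)
  case (Suc n)
  show ?case
  proof (cases t)
    case (Inr i)
    then have "{ss \<in> paths_from C j t. length ss < Suc n} = (if i = j then {[]} else {})"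
      by (auto simp: paths_from_Inr)
    then show ?thesis by (simp add: Inr)
  next
    case (Inl s)
    then have s_pos: "s \<in> positions C" using Suc.prems by simp
    let ?P = "\<lambda>t. {ss \<in> paths_from C j t. length ss < n}"
    have "{ss \<in> paths_from C j t. length ss < Suc n} = (#) s ` (\<Union>t\<in>targets C. ?P t)"
      by (auto simp: Inl paths_from_Inl[OF s_pos j_exit] intro!: imageI)
    then have "(\<Sum>ss | ss \<in> paths_from C j t \<and> length ss < Suc n. path_weight C j ss) =
        (\<Sum>ss\<in>(\<Union>t\<in>targets C. ?P t). path_weight C j (s # ss))"
      by (simp add: sum.reindex)
    also have "\<dots> = (\<Sum>t\<in>targets C. \<Sum>ss\<in>?P t. path_weight C j (s # ss))"
      using is_romdpD(1,2)[OF C_romdp] finite_paths_from_length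
      by (intro sum.UNION_disjoint) (auto simp: paths_from_def)
    also have "\<dots> = (\<Sum>t\<in>targets C. \<Sum>ss\<in>?P t.
        Dual 1 (reward C s) * (trans_prob C s () t *\<^sub>R path_weight C j ss))"
      by (intro sum.cong) (auto simp: path_weight_Cons paths_from_def)
    also have "\<dots> = bellman C (unit_payoff j) (kleene_iterate (bellman C (unit_payoff j)) n) t"
      using Suc.IH by (simp add: Inl expect_def sum_distrib_left scaleR_sum_right)
    finally show ?thesis by simp
  qed
qed simp

section \<open>Finiteness of expected rewards\<close>

definition exit_prob_upto :: "('q, unit) romdp \<Rightarrow> nat \<Rightarrow> 'q + nat \<Rightarrow> real" where
  "exit_prob_upto C n t = real_part (kleene_iterate (bellman C (\<lambda>_. 1)) n t)"

lemma exit_prob_upto_simps [simp]: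
  "exit_prob_upto C 0 t = 0"
  "exit_prob_upto C (Suc n) (Inl s) = expect C () s (exit_prob_upto C n)"
  "exit_prob_upto C (Suc n) (Inr j) = 1"
  by (simp_all add: exit_prob_upto_def[abs_def] real_part_expect)

lemma continuous_operator_bellman_one:
  "is_romdp C \<Longrightarrow> continuous_operator (targets C) (bellman C (\<lambda>_. 1))"
  by (intro continuous_operator_bellman) (simp_all add: less_eq_dual_def)

lemma exit_prob_upto_nonneg: "is_romdp C \<Longrightarrow> t \<in> targets C \<Longrightarrow> 0 \<le> exit_prob_upto C n t"
  using continuous_operator.iterate_nonneg[OF continuous_operator_bellman_one, of C t n]
  by (simp add: exit_prob_upto_def less_eq_dual_def)

lemma exit_prob_upto_le_one:
  assumes "is_romdp C" "t \<in> targets C"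
  shows "exit_prob_upto C n t \<le> 1"
  using assms(2)
proof (induction n arbitrary: t)
  case (Suc n)
  show ?case
  proof (cases t)
    case (Inl s)
    then have s_pos: "s \<in> positions C" using Suc.prems by simp
    have "expect C () s (exit_prob_upto C n) \<le> expect C () s (\<lambda>_. 1)"
      by (rule expect_mono[OF assms(1) s_pos Suc.IH])
    also have "\<dots> \<le> 1"
      by (rule expect_one_le[OF assms(1) s_pos])
    finally show ?thesis by (simp add: Inl)
  qed simp
qed simp

lemma incseq_exit_prob_upto:
  assumes "is_romdp C" "t \<in> targets C"
  shows "incseq (\<lambda>n. exit_prob_upto C n t)"
  using continuous_operator.iterate_le_Suc[OF continuous_operator_bellman_one[OF assms(1)] assms(2)]
  by (intro incseq_SucI) (simp add: exit_prob_upto_def less_eq_dual_def)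

definition exit_prob :: "('q, unit) romdp \<Rightarrow> 'q + nat \<Rightarrow> real" where
  "exit_prob C t = lim (\<lambda>n. exit_prob_upto C n t)"

lemma exit_prob_upto_tendsto:
  assumes "is_romdp C" "t \<in> targets C"
  shows "(\<lambda>n. exit_prob_upto C n t) \<longlonglongrightarrow> exit_prob C t"
proof -
  have "convergent (\<lambda>n. exit_prob_upto C n t)"
    using incseq_convergent[OF incseq_exit_prob_upto[OF assms], of 1]
      exit_prob_upto_le_one[OF assms]
    by (metis convergentI)
  then show ?thesis
    by (simp add: exit_prob_def convergent_LIMSEQ_iff)
qed

lemma exit_prob_upto_le:
  "is_romdp C \<Longrightarrow> t \<in> targets C \<Longrightarrow> exit_prob_upto C n t \<le> exit_prob C t"
  by (rule incseq_le[OF incseq_exit_prob_upto exit_prob_upto_tendsto])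

lemma exit_prob_nonneg: "is_romdp C \<Longrightarrow> t \<in> targets C \<Longrightarrow> 0 \<le> exit_prob C t"
  using exit_prob_upto_le[of C t 0] by simp

lemma exit_prob_Inl:
  assumes "is_romdp C" "s \<in> positions C"
  shows "exit_prob C (Inl s) = expect C () s (exit_prob C)"
proof (rule LIMSEQ_unique)
  show "(\<lambda>n. exit_prob_upto C (Suc n) (Inl s)) \<longlonglongrightarrow> exit_prob C (Inl s)"
    using assms by (intro LIMSEQ_Suc exit_prob_upto_tendsto) auto
  show "(\<lambda>n. exit_prob_upto C (Suc n) (Inl s)) \<longlonglongrightarrow> expect C () s (exit_prob C)"
    using assms by (auto intro!: tendsto_expect exit_prob_upto_tendsto)
qed

lemma ex_uniform_half_approximation:
  fixes p :: "'i \<Rightarrow> real"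
  assumes "finite I" "\<And>i. i \<in> I \<Longrightarrow> (\<lambda>n. q n i) \<longlonglongrightarrow> p i" "\<And>n i. i \<in> I \<Longrightarrow> 0 \<le> q n i"
  shows "\<exists>n. \<forall>i\<in>I. p i - q n i \<le> p i / 2"
proof -
  have "\<forall>\<^sub>F n in sequentially. p i - q n i \<le> p i / 2" if i_in: "i \<in> I" for i
  proof (cases "p i = 0")
    case False
    then have "p i / 2 < p i"
      using LIMSEQ_le_const[OF assms(2)[OF i_in]] assms(3)[OF i_in] by fastforce
    then have "\<forall>\<^sub>F n in sequentially. p i / 2 < q n i"
      by (rule order_tendstoD(1)[OF assms(2)[OF i_in]])
    then show ?thesis
      by eventually_elim simp
  qed (simp add: assms(3)[OF i_in])
  then have "\<forall>\<^sub>F n in sequentially. \<forall>i\<in>I. p i - q n i \<le> p i / 2"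
    by (intro eventually_ball_finite assms(1)) simp
  then show ?thesis
    by (auto dest: eventually_happens)
qed

text \<open>Recurrent positions are where the expected reward could diverge. If \<open>D k\<close> is the probability
  of reaching an exit only after \<open>k\<close> or more positions, some \<open>n\<close> satisfies \<open>D n \<le> exit_prob / 2\<close>,
  so \<open>2 \<rho> (D 0 + \<dots> + D (n - 1))\<close> dominates the expected reward when \<open>\<rho>\<close> bounds the rewards.\<close>

lemma ex_expected_reward_bound:
  assumes C_romdp: "is_romdp C"
  shows "\<exists>r. (\<forall>t\<in>targets C. 0 \<le> r t) \<and>
    (\<forall>s\<in>positions C. expect C () s r + reward C s * exit_prob C (Inl s) \<le> r (Inl s))"
proof -
  obtain n where half:
      "\<And>t. t \<in> targets C \<Longrightarrow> exit_prob C t - exit_prob_upto C n t \<le> exit_prob C t / 2"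
    using ex_uniform_half_approximation[OF is_romdpD(2)[OF C_romdp],
        of "exit_prob_upto C" "exit_prob C"]
      exit_prob_upto_tendsto[OF C_romdp] exit_prob_upto_nonneg[OF C_romdp] by blast
  define D where "D k t = exit_prob C t - exit_prob_upto C k t" for k t
  have D_nonneg: "0 \<le> D k t" if "t \<in> targets C" for k t
    using exit_prob_upto_le[OF C_romdp that] by (simp add: D_def)
  have D_step: "expect C () s (D k) = D (Suc k) (Inl s)" if "s \<in> positions C" for k s
    by (simp add: D_def[abs_def] expect_diff exit_prob_Inl[OF C_romdp that])
  define \<rho> where "\<rho> = (\<Sum>s\<in>positions C. reward C s)"
  have reward_le: "reward C s \<le> \<rho>" if "s \<in> positions C" for s
    unfolding \<rho>_def using that is_romdpD[OF C_romdp] by (intro member_le_sum) auto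
  have \<rho>_nonneg: "0 \<le> \<rho>"
    unfolding \<rho>_def using is_romdpD[OF C_romdp] by (intro sum_nonneg) auto
  define r where "r = (\<lambda>t. (\<Sum>k<n. D k t) * (2 * \<rho>))"
  have "expect C () s r + reward C s * exit_prob C (Inl s) \<le> r (Inl s)"
    if s_pos: "s \<in> positions C" for s
  proof -
    have "expect C () s r = (\<Sum>k<n. D (Suc k) (Inl s)) * (2 * \<rho>)"
      unfolding r_def by (simp add: expect_mult_right expect_sum D_step[OF s_pos])
    also have "(\<Sum>k<n. D (Suc k) (Inl s)) = (\<Sum>k<n. D k (Inl s)) - (D 0 (Inl s) - D n (Inl s))"
      using sum.lessThan_Suc_shift[of "\<lambda>k. D k (Inl s)" n] by simp
    finally have "expect C () s r = r (Inl s) - (D 0 (Inl s) - D n (Inl s)) * 2 * \<rho>"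
      by (simp add: r_def algebra_simps)
    moreover have "exit_prob C (Inl s) * \<rho> \<le> (D 0 (Inl s) - D n (Inl s)) * 2 * \<rho>"
      using half[of "Inl s"] s_pos \<rho>_nonneg by (intro mult_right_mono) (simp_all add: D_def)
    moreover have "reward C s * exit_prob C (Inl s) \<le> exit_prob C (Inl s) * \<rho>"
      using reward_le[OF s_pos] exit_prob_nonneg[OF C_romdp, of "Inl s"] s_pos
      by (simp add: mult.commute mult_right_mono)
    ultimately show ?thesis by simp
  qed
  moreover have "0 \<le> r t" if "t \<in> targets C" for t
    unfolding r_def using that D_nonneg \<rho>_nonneg by (intro mult_nonneg_nonneg sum_nonneg) auto
  ultimately show ?thesis by blast
qed

lemma ex_bellman_supersolution:
  assumes C_romdp: "is_romdp C"
  shows "\<exists>u. supersolution (targets C) (bellman C (\<lambda>_. 1)) u"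
proof -
  obtain r where r_nonneg: "\<And>t. t \<in> targets C \<Longrightarrow> 0 \<le> r t"
    and r_step: "\<And>s. s \<in> positions C \<Longrightarrow>
      expect C () s r + reward C s * exit_prob C (Inl s) \<le> r (Inl s)"
    using ex_expected_reward_bound[OF C_romdp] by blast
  let ?u = "\<lambda>t. Dual (exit_prob C t) (r t)"
  have "supersolution (targets C) (bellman C (\<lambda>_. 1)) ?u"
    unfolding supersolution_bellman_iff
  proof (intro conjI ballI allI impI)
    show "0 \<le> ?u t" if "t \<in> targets C" for t
      using that by (intro Dual_nonneg exit_prob_nonneg[OF C_romdp] r_nonneg)
    show "1 \<le> ?u (Inr j)" if "j < n_exits C" for j
      using that exit_prob_upto_le[OF C_romdp, of "Inr j" 1] r_nonneg
      by (simp add: less_eq_dual_def)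
    show "bellman C (\<lambda>_. 1) ?u (Inl s) \<le> ?u (Inl s)" if "s \<in> positions C" for s
      using r_step[OF that] exit_prob_Inl[OF C_romdp that]
      by (simp add: less_eq_dual_def real_part_expect dual_part_expect)
  qed
  then show ?thesis by blast
qed

section \<open>Expected exit values\<close>

lemma has_sum_incseq_exhaustion:
  fixes f :: "'b \<Rightarrow> real"
  assumes nonneg: "\<And>x. x \<in> S \<Longrightarrow> 0 \<le> f x"
    and F_exhausts: "incseq F" "\<And>n. finite (F n)" "(\<Union>n. F n) = S"
    and lim: "(\<lambda>n. sum f (F n)) \<longlonglongrightarrow> L"
  shows "(f has_sum L) S"
proof -
  have "subset.chain UNIV (range F)"
    using F_exhausts(1) by (auto simp: subset_chain_def incseq_def) (metis in_mono nle_le)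
  then have ex_superset: "\<exists>n. X \<subseteq> F n" if "finite X" "X \<subseteq> S" for X
    using finite_subset_Union_chain[of X "range F"] that F_exhausts(3) by blast
  have F_subset: "F n \<subseteq> S" for n
    using F_exhausts(3) by blast
  have "incseq (\<lambda>n. sum f (F n))"
    by (intro incseq_SucI sum_mono2 F_exhausts(2) incseq_SucD[OF F_exhausts(1)])
      (use F_subset nonneg in blast)
  then have sum_le: "sum f (F n) \<le> L" for n
    by (rule incseq_le[OF _ lim])
  have "sum f X \<le> L" if "finite X" "X \<subseteq> S" for X
  proof -
    obtain n where "X \<subseteq> F n" using ex_superset \<open>finite X\<close> \<open>X \<subseteq> S\<close> by blast
    then have "sum f X \<le> sum f (F n)"
      by (rule sum_mono2[OF F_exhausts(2)]) (use F_subset nonneg in blast)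
    then show ?thesis using sum_le order_trans by blast
  qed
  then have "f summable_on S"
    using nonneg by (intro nonneg_bdd_above_summable_on) (auto intro!: bdd_aboveI)
  then have "(sum f \<longlongrightarrow> infsum f S) (finite_subsets_at_top S)"
    using has_sum_infsum by (auto simp: has_sum_def)
  moreover have "filterlim F (finite_subsets_at_top S) sequentially"
    unfolding filterlim_finite_subsets_at_top
    using ex_superset F_exhausts(2) F_subset incseqD[OF F_exhausts(1)]
    by (metis (no_types, lifting) eventually_sequentiallyI order_trans)
  ultimately have "(\<lambda>n. sum f (F n)) \<longlonglongrightarrow> infsum f S"
    by (rule filterlim_compose)
  then have "infsum f S = L"
    by (rule LIMSEQ_unique[OF _ lim])
  then show ?thesis
    using \<open>f summable_on S\<close> has_sum_infsum by blast
qed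

lemma
  assumes C_romdp: "is_romdp C" and j_exit: "j < n_exits C" and t_target: "t \<in> targets C"
  shows path_prob_summable: "path_prob C j summable_on paths_from C j t"
    and bellman_iterate_tendsto_reach:
      "(\<lambda>n. kleene_iterate (bellman C (unit_payoff j)) n t) \<longlonglongrightarrow> reach C j t"
proof -
  interpret continuous_operator "targets C" "bellman C (unit_payoff j)"
    by (intro continuous_operator_bellman C_romdp) simp
  obtain u where u_super: "supersolution (targets C) (bellman C (\<lambda>_. 1)) u"
    using ex_bellman_supersolution[OF C_romdp] ..
  have "(of_bool b :: dual) \<le> 1" for b
    by (simp add: less_eq_dual_def)
  then have "supersolution (targets C) (bellman C (unit_payoff j)) u"
    using u_super order_trans unfolding supersolution_bellman_iff bellman.simps by blast
  then obtain L where lim: "(\<lambda>n. kleene_iterate (bellman C (unit_payoff j)) n t) \<longlonglongrightarrow> L"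
    using iterate_convergent[OF _ t_target] by (auto simp: convergent_def)
  let ?F = "\<lambda>n. {ss \<in> paths_from C j t. length ss < n}"
  have F_exhausts: "incseq ?F" "finite (?F n)" "(\<Union>n. ?F n) = paths_from C j t" for n
    using finite_paths_from_length[OF is_romdpD(1)[OF C_romdp]] by (auto simp: incseq_def)
  have sums: "(\<lambda>n. \<Sum>ss\<in>?F n. path_weight C j ss) \<longlonglongrightarrow> L"
    using lim unfolding bellman_iterate_eq_sum_paths[OF C_romdp j_exit t_target] .
  have prob: "(path_prob C j has_sum real_part L) (paths_from C j t)"
    using sums path_prob_nonneg[OF C_romdp j_exit]
    by (intro has_sum_incseq_exhaustion[OF _ F_exhausts])
      (auto simp: tendsto_dual_iff path_weight_def paths_from_def)
  then show "path_prob C j summable_on paths_from C j t"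
    by (rule has_sum_imp_summable)
  have "((\<lambda>ss. path_prob C j ss * path_reward C ss) has_sum dual_part L) (paths_from C j t)"
    using sums path_prob_nonneg[OF C_romdp j_exit] path_reward_nonneg[OF C_romdp]
    by (intro has_sum_incseq_exhaustion[OF _ F_exhausts])
      (auto simp: tendsto_dual_iff path_weight_def paths_from_def)
  then have "reach C j t = L"
    using prob by (simp add: reach_def infsumI)
  then show "(\<lambda>n. kleene_iterate (bellman C (unit_payoff j)) n t) \<longlonglongrightarrow> reach C j t"
    using lim by simp
qed

definition exit_value :: "('q, unit) romdp \<Rightarrow> (nat \<Rightarrow> dual) \<Rightarrow> 'q + nat \<Rightarrow> dual" where
  "exit_value C c t = (\<Sum>j<n_exits C. reach C j t * c j)"

lemma exit_value_unit_payoff: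
  "exit_value C (unit_payoff j) t = (if j < n_exits C then reach C j t else 0)"
  by (simp add: exit_value_def)

lemma exit_value_cong: "(\<And>j. j < n_exits C \<Longrightarrow> c j = d j) \<Longrightarrow> exit_value C c t = exit_value C d t"
  by (simp add: exit_value_def)

lemma exit_value_nonneg:
  "is_romdp C \<Longrightarrow> (\<And>j. j < n_exits C \<Longrightarrow> 0 \<le> c j) \<Longrightarrow> 0 \<le> exit_value C c t"
  unfolding exit_value_def by (intro sum_nonneg mult_nonneg_nonneg reach_nonneg) auto

lemma exit_value_eq_0: "t \<notin> targets C \<Longrightarrow> exit_value C c t = 0"
proof -
  assume t_notin: "t \<notin> targets C"
  have "paths_from C j t = {}" if "j < n_exits C" for j
    using hd_path_in_targets[OF _ that] t_notin by (auto simp: paths_from_def)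
  then show ?thesis
    by (simp add: exit_value_def reach_def zero_dual_def[symmetric])
qed

lemma bellman_iterate_linear:
  assumes "t \<in> targets C"
  shows "kleene_iterate (bellman C c) n t =
    (\<Sum>j<n_exits C. kleene_iterate (bellman C (unit_payoff j)) n t * c j)"
  using assms
proof (induction n arbitrary: t)
  case (Suc n)
  show ?case
  proof (cases t)
    case (Inl s)
    have "expect C () s (kleene_iterate (bellman C c) n) = expect C () s (\<lambda>t.
        \<Sum>j<n_exits C. kleene_iterate (bellman C (unit_payoff j)) n t * c j)"
      by (rule expect_cong) (rule Suc.IH)
    then show ?thesis
      by (simp add: Inl expect_sum expect_mult_right sum_distrib_left mult.assoc)
  next
    case (Inr i)
    then show ?thesis using Suc.prems by simp
  qed
qed simp

lemma bellman_iterate_tendsto_exit_value: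
  assumes "is_romdp C" "t \<in> targets C"
  shows "(\<lambda>n. kleene_iterate (bellman C c) n t) \<longlonglongrightarrow> exit_value C c t"
  unfolding bellman_iterate_linear[OF assms(2), where c = c] exit_value_def
  using assms by (intro tendsto_intros bellman_iterate_tendsto_reach) auto

lemma exit_value_fixed_point:
  assumes "is_romdp C" "\<And>j. j < n_exits C \<Longrightarrow> 0 \<le> c j" "t \<in> targets C"
  shows "bellman C c (exit_value C c) t = exit_value C c t"
  by (rule continuous_operator.limit_fixed_point[OF continuous_operator_bellman[OF assms(1,2)]
        bellman_iterate_tendsto_exit_value[OF assms(1)] assms(3)])

lemma exit_value_Inr:
  "is_romdp C \<Longrightarrow> (\<And>j. j < n_exits C \<Longrightarrow> 0 \<le> c j) \<Longrightarrow> i < n_exits C \<Longrightarrow> exit_value C c (Inr i) = c i"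
  using exit_value_fixed_point[of C c "Inr i"] by simp

lemma exit_value_le_supersolution:
  assumes "is_romdp C" "\<And>j. j < n_exits C \<Longrightarrow> 0 \<le> c j"
    and "supersolution (targets C) (bellman C c) v" "t \<in> targets C"
  shows "exit_value C c t \<le> v t"
  by (rule continuous_operator.limit_le_supersolution[OF continuous_operator_bellman[OF assms(1,2)]
        bellman_iterate_tendsto_exit_value[OF assms(1)] assms(3,4)])

lemma exit_value_le_embeds:
  assumes A_romdp: "is_romdp A" and B_romdp: "is_romdp B" and emb: "embeds f h A B"
    and c_nonneg: "\<And>j. j < n_exits B \<Longrightarrow> 0 \<le> c j" and t_target: "t \<in> targets A"
  shows "exit_value A (\<lambda>j. exit_value B c (h (Inr j))) t \<le> exit_value B c (h t)"
proof (rule exit_value_le_supersolution[OF A_romdp _ _ t_target])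
  let ?v = "exit_value B c" and ?d = "\<lambda>j. exit_value B c (h (Inr j))"
  show "0 \<le> ?d j" for j
    by (intro exit_value_nonneg B_romdp c_nonneg)
  have "bellman A ?d (\<lambda>t. ?v (h t)) (Inl s) = ?v (h (Inl s))" if s_pos: "s \<in> positions A" for s
  proof -
    have "bellman A ?d (\<lambda>t. ?v (h t)) (Inl s) = bellman B c ?v (Inl (f s))"
      by (simp add: expect_embeds[OF is_romdpD(2)[OF A_romdp] is_romdpD(2)[OF B_romdp] emb s_pos]
          embedsD(3)[OF emb s_pos])
    also have "\<dots> = ?v (Inl (f s))"
      using embedsD(2)[OF emb s_pos] by (intro exit_value_fixed_point B_romdp c_nonneg) auto
    finally show ?thesis by (simp add: embedsD(1)[OF emb])
  qed
  then show "supersolution (targets A) (bellman A ?d) (\<lambda>t. ?v (h t))"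
    unfolding supersolution_bellman_iff
    by (auto simp del: bellman.simps intro!: exit_value_nonneg B_romdp c_nonneg)
qed

lemma bellman_iterate_embeds_le:
  assumes A_romdp: "is_romdp A" and B_romdp: "is_romdp B" and emb: "embeds f h A B"
    and c_nonneg: "\<And>j. j < n_exits B \<Longrightarrow> 0 \<le> c j" and t_target: "t \<in> targets A" "h t \<in> targets B"
  shows "kleene_iterate (bellman B c) n (h t) \<le> exit_value A (\<lambda>j. exit_value B c (h (Inr j))) t"
  using t_target
proof (induction n arbitrary: t)
  case 0
  show ?case by (simp add: exit_value_nonneg A_romdp B_romdp c_nonneg)
next
  case (Suc n)
  let ?d = "\<lambda>j. exit_value B c (h (Inr j))" and ?x = "kleene_iterate (bellman B c) n"
  have d_nonneg: "0 \<le> ?d j" for j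
    by (intro exit_value_nonneg B_romdp c_nonneg)
  show ?case
  proof (cases t)
    case (Inl s)
    then have s_pos: "s \<in> positions A" using Suc.prems by simp
    have "expect B () (f s) ?x \<le> expect A () s (exit_value A ?d)"
      by (intro expect_embeds_le[OF A_romdp is_romdpD(2)[OF B_romdp] emb s_pos] Suc.IH)
    then have "bellman B c ?x (Inl (f s)) \<le> bellman A ?d (exit_value A ?d) (Inl s)"
      unfolding bellman.simps embedsD(3)[OF emb s_pos]
      by (intro mult_left_mono Dual_nonneg is_romdpD(6)[OF A_romdp s_pos]) auto
    then show ?thesis
      using exit_value_fixed_point[OF A_romdp d_nonneg Suc.prems(1)]
      by (simp add: Inl embedsD(1)[OF emb] del: bellman.simps)
  next
    case (Inr j)
    interpret continuous_operator "targets B" "bellman B c"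
      by (intro continuous_operator_bellman B_romdp c_nonneg)
    have "kleene_iterate (bellman B c) (Suc n) (h t) \<le> exit_value B c (h t)"
      using exit_value_fixed_point[OF B_romdp c_nonneg] exit_value_nonneg[OF B_romdp c_nonneg]
        Suc.prems(2)
      by (intro iterate_le_supersolution) (auto simp: supersolution_def)
    then show ?thesis
      using Inr Suc.prems(1) exit_value_Inr[OF A_romdp d_nonneg] by simp
  qed
qed

theorem exit_value_embeds:
  assumes A_romdp: "is_romdp A" and B_romdp: "is_romdp B" and emb: "embeds f h A B"
    and c_nonneg: "\<And>j. j < n_exits B \<Longrightarrow> 0 \<le> c j" and t_target: "t \<in> targets A"
  shows "exit_value B c (h t) = exit_value A (\<lambda>j. exit_value B c (h (Inr j))) t"
proof (rule antisym)
  show "exit_value B c (h t) \<le> exit_value A (\<lambda>j. exit_value B c (h (Inr j))) t"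
  proof (cases "h t \<in> targets B")
    case True
    show ?thesis
      by (rule LIMSEQ_dual_le_const[OF bellman_iterate_tendsto_exit_value[OF B_romdp True]
            bellman_iterate_embeds_le[OF A_romdp B_romdp emb c_nonneg t_target True]])
  qed (simp add: exit_value_eq_0 exit_value_nonneg A_romdp B_romdp c_nonneg)
qed (rule exit_value_le_embeds[OF A_romdp B_romdp emb c_nonneg t_target])

lemma exit_value_embeds_map_sum:
  assumes A_romdp: "is_romdp A" and B_romdp: "is_romdp B" and emb: "embeds f (map_sum f g) A B"
    and g_exits: "\<And>j. j < n_exits A \<Longrightarrow> g j < n_exits B"
    and c_nonneg: "\<And>j. j < n_exits B \<Longrightarrow> 0 \<le> c j" and t_target: "t \<in> targets A"
  shows "exit_value B c (map_sum f g t) = exit_value A (\<lambda>j. c (g j)) t"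
proof -
  have "exit_value B c (map_sum f g t) = exit_value A (\<lambda>j. exit_value B c (Inr (g j))) t"
    using exit_value_embeds[OF A_romdp B_romdp emb c_nonneg t_target] by simp
  also have "\<dots> = exit_value A (\<lambda>j. c (g j)) t"
    by (intro exit_value_cong exit_value_Inr B_romdp c_nonneg g_exits)
  finally show ?thesis .
qed

section \<open>Solution matrices\<close>

definition solution_mat :: "('q, unit) romdp \<Rightarrow> dual mat" where
  "solution_mat C = mat (n_ents C) (n_exits C) (\<lambda>(i, j). reach C j (entr C i))"

lemma dim_solution_mat [simp]:
  "dim_row (solution_mat C) = n_ents C" "dim_col (solution_mat C) = n_exits C"
  by (simp_all add: solution_mat_def)

lemma solution_mat_eq_exit_value:
  "i < n_ents C \<Longrightarrow> j < n_exits C \<Longrightarrow>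
     solution_mat C $$ (i, j) = exit_value C (unit_payoff j) (entr C i)"
  by (simp add: solution_mat_def exit_value_unit_payoff)

definition mc_of_dual :: "dual mat \<Rightarrow> mc_arrow" where
  "mc_of_dual M = map_mat (\<lambda>x. (real_part x, dual_part x)) M"

lemma mc_solution_eq: "mc_solution C = mc_of_dual (solution_mat C)"
  by (intro eq_matI)
    (simp_all add: mc_solution_def mc_of_dual_def solution_mat_def RPr_def ERw_def reach_def
      paths_def paths_from_def)

lemma p_mat_mc_of_dual [simp]: "p_mat (mc_of_dual M) = map_mat real_part M"
  and r_mat_mc_of_dual [simp]: "r_mat (mc_of_dual M) = map_mat dual_part M"
  by (auto simp: mc_of_dual_def)

lemma map_dual_part_mult:
  assumes "M \<in> carrier_mat m k" "N \<in> carrier_mat k n"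
  shows "map_mat dual_part (M * N) =
    map_mat real_part M * map_mat dual_part N + map_mat dual_part M * map_mat real_part N"
  using assms by (intro eq_matI) (auto simp: scalar_prod_def sum.distrib)

lemma mc_comp_mc_of_dual:
  assumes "M \<in> carrier_mat m k" "N \<in> carrier_mat k n"
  shows "mc_comp (mc_of_dual M) (mc_of_dual N) = mc_of_dual (M * N)"
proof -
  have "mc_comp (mc_of_dual M) (mc_of_dual N) =
      pair_mat (map_mat real_part (M * N)) (map_mat dual_part (M * N))"
    by (simp add: mc_comp_def real_part.mat_hom_mult[OF assms] map_dual_part_mult[OF assms])
  also have "\<dots> = mc_of_dual (M * N)"
    by (intro eq_matI) (auto simp: pair_mat_def mc_of_dual_def)
  finally show ?thesis .
qed

lemma mc_sum_mc_of_dual: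
  "mc_sum (mc_of_dual M) (mc_of_dual N) = mc_of_dual
     (four_block_mat M (0\<^sub>m (dim_row M) (dim_col N)) (0\<^sub>m (dim_row N) (dim_col M)) N)"
  by (intro eq_matI) (auto simp: mc_sum_def mc_of_dual_def zero_prod_def)

lemma mc_solution_in_mc_hom:
  assumes C_romdp: "is_romdp C"
  shows "mc_solution C \<in> mc_hom (n_ents C) (n_exits C)"
proof -
  have "(\<Sum>j<n_exits C. real_part (reach C j t)) \<le> 1" if t_target: "t \<in> targets C" for t
  proof -
    have "(\<lambda>n. exit_prob_upto C n t) \<longlonglongrightarrow> real_part (exit_value C (\<lambda>_. 1) t)"
      using bellman_iterate_tendsto_exit_value[OF C_romdp t_target, of "\<lambda>_. 1"]
      by (simp add: tendsto_dual_iff exit_prob_upto_def)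
    then have "real_part (exit_value C (\<lambda>_. 1) t) \<le> 1"
      by (rule LIMSEQ_le_const2) (use exit_prob_upto_le_one[OF C_romdp t_target] in blast)
    then show ?thesis by (simp add: exit_value_def)
  qed
  moreover have "dual_part (reach C j t) = 0"
    if t_target: "t \<in> targets C" and j_exit: "j < n_exits C" and zero: "real_part (reach C j t) = 0"
      for t j
  proof -
    have "path_prob C j ss = 0" if "ss \<in> paths_from C j t" for ss
      using that zero path_prob_nonneg[OF C_romdp j_exit]
        path_prob_summable[OF C_romdp j_exit t_target]
      by (intro nonneg_infsum_le_0D[of "path_prob C j"]) (auto simp: reach_def paths_from_def)
    then have "(\<Sum>\<^sub>\<infinity>ss\<in>paths_from C j t. path_prob C j ss * path_reward C ss) = 0"
      by (intro infsum_0) simp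
    then show ?thesis by (simp add: reach_def)
  qed
  ultimately show ?thesis
    using reach_nonneg[OF C_romdp] is_romdpD(3)[OF C_romdp]
    by (auto simp: mc_hom_def mc_solution_eq mc_of_dual_def solution_mat_def less_eq_dual_def)
qed

section \<open>Isomorphisms\<close>

definition iso_via :: "('q \<Rightarrow> 'r) \<Rightarrow> ('q, 'a) romdp \<Rightarrow> ('r, 'a) romdp \<Rightarrow> bool" where
  "iso_via \<eta> A B \<longleftrightarrow> n_ents B = n_ents A \<and> n_exits B = n_exits A \<and>
     bij_betw \<eta> (positions A) (positions B) \<and>
     (\<forall>i<n_ents A. entr B i = map_sum \<eta> id (entr A i)) \<and> embeds \<eta> (map_sum \<eta> id) A B"

lemma romdp_isoE:
  assumes "romdp_iso A B"
  obtains \<eta> where "iso_via \<eta> A B"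
proof -
  obtain \<eta> where \<eta>_bij: "bij_betw \<eta> (positions A) (positions B)"
    "\<And>s a t. s \<in> positions A \<Longrightarrow> t \<in> targets A \<Longrightarrow>
      trans_prob B (\<eta> s) a (map_sum \<eta> id t) = trans_prob A s a t"
    "\<And>s. s \<in> positions A \<Longrightarrow> reward B (\<eta> s) = reward A s"
    and entr: "\<forall>i<n_ents A. entr B i = map_sum \<eta> id (entr A i)"
    and dims: "n_ents B = n_ents A" "n_exits B = n_exits A"
    using assms unfolding romdp_iso_def by metis
  have "targets B = map_sum \<eta> id ` targets A"
    by (simp add: targets_def Plus_def image_Un image_image dims
        flip: bij_betw_imp_surj_on[OF \<eta>_bij(1)])
  then have "embeds \<eta> (map_sum \<eta> id) A B"
    using \<eta>_bij dims by (intro embeds_map_sum) (auto simp: bij_betw_def)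
  then show thesis
    using that \<eta>_bij(1) entr dims by (auto simp: iso_via_def)
qed

lemma accessors_iso_via_subset:
  assumes iso: "iso_via \<eta> A B" and j_exit: "j < n_exits B"
  shows "accessors B (Inr j) \<subseteq> map_sum id (map_prod \<eta> id) ` accessors A (Inr j)"
proof
  have bij: "bij_betw \<eta> (positions A) (positions B)" and emb: "embeds \<eta> (map_sum \<eta> id) A B"
    and dims: "n_ents B = n_ents A"
    and entr: "\<And>i. i < n_ents A \<Longrightarrow> entr B i = map_sum \<eta> id (entr A i)"
    using iso by (auto simp: iso_via_def)
  fix z assume z_acc: "z \<in> accessors B (Inr j)"
  show "z \<in> map_sum id (map_prod \<eta> id) ` accessors A (Inr j)"
  proof (cases z)
    case (Inl i)
    then have i_ent: "i < n_ents A" "map_sum \<eta> id (entr A i) = Inr j"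
      using z_acc dims by (auto simp: entr)
    then have "entr A i = Inr j" by (cases "entr A i") auto
    then show ?thesis using Inl i_ent by (intro image_eqI[of _ _ "Inl i"]) auto
  next
    case (Inr sa)
    obtain s a where s_pos: "s \<in> positions A" "z = Inr (\<eta> s, a)"
      using z_acc bij_betw_imp_surj_on[OF bij] Inr by (cases sa) auto
    then obtain t where "map_sum \<eta> id t = Inr j" "Inr (s, a) \<in> accessors A t"
      using accessors_embedsE[OF emb s_pos(1), of "Inr j" a] z_acc j_exit by auto
    then show ?thesis using s_pos by (intro image_eqI[of _ _ "Inr (s, a)"]) (cases t; auto)+
  qed
qed

lemma is_romdp_iso_via:
  assumes iso: "iso_via \<eta> A B" and A_romdp: "is_romdp A"
  shows "is_romdp B"
proof (rule is_romdpI)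
  have bij: "bij_betw \<eta> (positions A) (positions B)" and emb: "embeds \<eta> (map_sum \<eta> id) A B"
    and dims: "n_ents B = n_ents A" "n_exits B = n_exits A"
    and entr: "\<And>i. i < n_ents A \<Longrightarrow> entr B i = map_sum \<eta> id (entr A i)"
    using iso by (auto simp: iso_via_def)
  show finite_B: "finite (positions B)"
    using is_romdpD(1)[OF A_romdp] bij bij_betw_finite by blast
  show "entr B i \<in> targets B" if "i < n_ents B" for i
    using that is_romdpD(3)[OF A_romdp, of i] bij dims
    by (cases "entr A i") (auto simp: entr dest: bij_betwE)
  show "proper_position B s" if s_pos: "s \<in> positions B" for s
  proof -
    obtain s' where "s' \<in> positions A" "s = \<eta> s'"
      using s_pos bij_betw_imp_surj_on[OF bij] by blast
    moreover have "finite (targets B)" using finite_B by (simp add: targets_def)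
    ultimately show ?thesis using proper_position_embeds[OF A_romdp _ emb] by blast
  qed
  show "subsingleton (accessors B (Inr j))" if "j < n_exits B" for j
    using subsingleton_image[OF accessors_iso_via_subset[OF iso that]]
      subsingleton_accessors[OF A_romdp, of j] that dims by simp
qed

lemma mc_solution_iso_via:
  assumes C_romdp: "is_romdp C" and iso: "iso_via \<eta> C D"
  shows "mc_solution D = mc_solution C"
proof -
  have D_romdp: "is_romdp D" and emb: "embeds \<eta> (map_sum \<eta> id) C D"
    and dims: "n_ents D = n_ents C" "n_exits D = n_exits C"
    and entr: "\<And>i. i < n_ents C \<Longrightarrow> entr D i = map_sum \<eta> id (entr C i)"
    using iso is_romdp_iso_via[OF iso C_romdp] by (auto simp: iso_via_def)
  have "exit_value D c (map_sum \<eta> id t) = exit_value C c t"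
    if "t \<in> targets C" "\<And>j. 0 \<le> c j" for c t
    using exit_value_embeds_map_sum[OF C_romdp D_romdp emb, of c t] that dims by simp
  then have "solution_mat D = solution_mat C"
    using is_romdpD(3)[OF C_romdp] dims
    by (intro eq_matI) (simp_all add: solution_mat_eq_exit_value entr)
  then show ?thesis by (simp add: mc_solution_eq)
qed

lemma romdp_solution_iso:
  assumes A_romdp: "is_romdp A" and iso: "romdp_iso A B"
  shows "romdp_solution B = romdp_solution A"
proof -
  obtain \<eta> where \<eta>_iso: "iso_via \<eta> A B" using iso romdp_isoE by blast
  then have bij: "bij_betw \<eta> (positions A) (positions B)" by (simp add: iso_via_def)
  have solution_eq: "mc_solution (induced_mc B \<sigma>) = mc_solution (induced_mc A \<tau>)"
    if "\<And>s. s \<in> positions A \<Longrightarrow> \<sigma> (\<eta> s) = \<tau> s" for \<sigma> \<tau>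
    using \<eta>_iso embeds_induced_mc[of \<eta> _ A B \<sigma> \<tau>] that
    by (intro mc_solution_iso_via is_romdp_induced_mc A_romdp)
      (auto simp: iso_via_def)
  show ?thesis
  proof (intro equalityI subsetI)
    fix f assume "f \<in> romdp_solution B"
    then show "f \<in> romdp_solution A"
      using solution_eq[of _ "_ \<circ> \<eta>"] by (auto simp: romdp_solution_def)
  next
    fix f assume "f \<in> romdp_solution A"
    then obtain \<tau> where "f = mc_solution (induced_mc A \<tau>)" by (auto simp: romdp_solution_def)
    also have "\<dots> = mc_solution (induced_mc B (\<tau> \<circ> the_inv_into (positions A) \<eta>))"
      using bij by (intro solution_eq[symmetric]) (simp add: the_inv_into_f_f bij_betw_def)
    finally show "f \<in> romdp_solution B" by (auto simp: romdp_solution_def)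
  qed
qed

lemma iso_class_nonempty:
  fixes A :: "('q, 'a) romdp"
  assumes A_romdp: "is_romdp A"
  shows "iso_class A \<noteq> {}"
proof -
  obtain h :: "'q \<Rightarrow> nat" where h_inj: "inj_on h (positions A)"
    using finite_imp_inj_to_nat_seg[OF is_romdpD(1)[OF A_romdp]] by blast
  define g where "g = the_inv_into (positions A) h"
  have g_h: "g (h s) = s" if "s \<in> positions A" for s
    using h_inj that by (simp add: g_def the_inv_into_f_f)
  define B where "B = \<lparr> n_ents = n_ents A, n_exits = n_exits A, positions = h ` positions A,
    entr = (\<lambda>i. map_sum h id (entr A i)),
    trans_prob = (\<lambda>s a t. trans_prob A (g s) a (map_sum g id t)), reward = (\<lambda>s. reward A (g s)) \<rparr>"
  have "map_sum g id (map_sum h id t) = t" if "t \<in> targets A" for t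
    using that by (cases t) (auto simp: g_h)
  then have iso: "romdp_iso A B"
    using h_inj g_h by (auto simp: romdp_iso_def B_def bij_betw_def intro!: exI[of _ h])
  then have "is_romdp B"
    using A_romdp is_romdp_iso_via by (blast elim: romdp_isoE)
  then show ?thesis
    using iso by (auto simp: iso_class_def)
qed

lemma solR_iso_class:
  assumes "is_romdp A"
  shows "solR (iso_class A) = romdp_solution A"
  using iso_class_nonempty[OF assms] romdp_solution_iso[OF assms]
  by (auto simp: solR_def iso_class_def)

section \<open>Sequential composition\<close>

lemma accessors_PlusE:
  assumes "z \<in> accessors A t" "positions A = P <+> Q"
  obtains (entrance) i where "z = Inl i" "i < n_ents A"
  | (left) s a where "z = Inr (Inl s, a)" "s \<in> P"
  | (right) s a where "z = Inr (Inr s, a)" "s \<in> Q"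
proof (cases z)
  case (Inl i)
  then show thesis using that(1) assms(1) by simp
next
  case (Inr sa)
  then obtain s a where "z = Inr (s, a)" by (cases sa) auto
  then show thesis using that(2,3) assms by (cases s) auto
qed

lemma romdp_seq_simps [simp]:
  "n_ents (romdp_seq A B) = n_ents A" "n_exits (romdp_seq A B) = n_exits B"
  "positions (romdp_seq A B) = positions A <+> positions B"
  "trans_prob (romdp_seq A B) = seq_prob A B"
  "reward (romdp_seq A B) = case_sum (reward A) (reward B)"
  by (auto simp: romdp_seq_def)

definition seq_target :: "('r, 'a) romdp \<Rightarrow> 'q + nat \<Rightarrow> ('q + 'r) + nat" where
  "seq_target B = case_sum (Inl \<circ> Inl) (\<lambda>k. map_sum Inr id (entr B k))"

lemma seq_target_simps [simp]:
  "seq_target B (Inl s) = Inl (Inl s)" "seq_target B (Inr k) = map_sum Inr id (entr B k)"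
  by (simp_all add: seq_target_def)

lemma entr_romdp_seq: "entr (romdp_seq A B) i = seq_target B (entr A i)"
  by (simp add: romdp_seq_def seq_target_def split: sum.split)

lemma map_sum_Inr_in_targets_seq [simp]:
  "map_sum Inr id t \<in> targets (romdp_seq A B) \<longleftrightarrow> t \<in> targets B"
  by (cases t) auto

lemma seq_target_in_targets:
  assumes "is_romdp B" "n_exits A = n_ents B" "t \<in> targets A"
  shows "seq_target B t \<in> targets (romdp_seq A B)"
  using assms is_romdpD(3) by (cases t) fastforce+

lemma map_sum_Inr_id_simps [simp]:
  "map_sum Inr id t = map_sum Inr id u \<longleftrightarrow> t = u"
  "map_sum Inr id t \<noteq> Inl (Inl s)" "Inl (Inl s) \<noteq> map_sum Inr id t"
  by (cases t; cases u; auto)+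

lemma targets_seq_cases:
  obtains (left) s where "t = Inl (Inl s)" | (right) u where "t = map_sum Inr id u"
proof (cases t)
  case (Inl s)
  then show thesis using that(1) that(2)[of "Inl _"] by (cases s) auto
next
  case (Inr j)
  then show thesis using that(2)[of "Inr j"] by simp
qed

lemma embeds_seq_left:
  assumes B_romdp: "is_romdp B" and composable: "n_exits A = n_ents B"
  shows "embeds Inl (seq_target B) A (romdp_seq A B)"
  unfolding embeds_def
proof (intro conjI allI ballI impI)
  fix s a t assume "s \<in> positions A" and t_target: "t \<in> targets (romdp_seq A B)"
  show "trans_prob (romdp_seq A B) (Inl s) a t =
    (\<Sum>t' | t' \<in> targets A \<and> seq_target B t' = t. trans_prob A s a t')"
  proof (cases t rule: targets_seq_cases)
    case (left s')
    then have "{t' \<in> targets A. seq_target B t' = t} = {Inl s'}"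
      using t_target by (auto simp: targets_def)
    then show ?thesis by (simp add: left)
  next
    case (right u)
    then have "{t' \<in> targets A. seq_target B t' = t} = Inr ` ({..<n_exits A} \<inter> {k. entr B k = u})"
      by (auto simp: targets_def)
    then show ?thesis
      by (cases u) (simp_all add: right sum.reindex)
  qed
next
  show "trans_prob A s a t = 0" if "t \<in> targets A" "seq_target B t \<notin> targets (romdp_seq A B)"
    for s a t
    using seq_target_in_targets[OF B_romdp composable] that by blast
qed auto

lemma embeds_seq_right: "embeds Inr (map_sum Inr id) B (romdp_seq A B)"
proof (rule embeds_map_sum)
  show "trans_prob (romdp_seq A B) (Inr s) a (map_sum Inr id t) = trans_prob B s a t" for s a t
    by (cases t) auto
  show "trans_prob (romdp_seq A B) (Inr s) a t = 0"
    if "t \<in> targets (romdp_seq A B)" "t \<notin> map_sum Inr id ` targets B" for s a t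
    using that by (cases t rule: targets_seq_cases) auto
qed auto

lemma accessors_seq_subset:
  assumes A_romdp: "is_romdp A" and B_romdp: "is_romdp B" and composable: "n_exits A = n_ents B"
    and j_exit: "j < n_exits B"
  shows "accessors (romdp_seq A B) (Inr j) \<subseteq> (\<Union>w\<in>accessors B (Inr j). case w of
      Inl k \<Rightarrow> map_sum id (map_prod Inl id) ` accessors A (Inr k)
    | Inr (s, a) \<Rightarrow> {Inr (Inr s, a)})" (is "_ \<subseteq> ?U")
proof
  let ?S = "romdp_seq A B"
  have wired_accessor: "map_sum id (map_prod Inl id) x \<in> ?U"
    if x_acc: "x \<in> accessors A t" and t_target: "t \<in> targets A" "seq_target B t = Inr j" for x t
  proof -
    obtain k where "t = Inr k" "entr B k = Inr j"
      using t_target(2) by (cases t; cases "entr B (projr t)") auto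
    then show ?thesis
      using x_acc t_target(1) composable by (intro UN_I[of "Inl k"]) auto
  qed
  fix z assume z_acc: "z \<in> accessors ?S (Inr j)"
  show "z \<in> ?U"
    using z_acc romdp_seq_simps(3)
  proof (cases rule: accessors_PlusE)
    case (entrance i)
    then show ?thesis
      using wired_accessor[of "Inl i" "entr A i"] z_acc is_romdpD(3)[OF A_romdp]
      by (simp add: entr_romdp_seq)
  next
    case (left s a)
    obtain t where "t \<in> targets A" "seq_target B t = Inr j" "Inr (s, a) \<in> accessors A t"
      using z_acc j_exit left(1)
        accessors_embedsE[OF embeds_seq_left[OF B_romdp composable] left(2), of "Inr j" a]
      by auto
    then show ?thesis using wired_accessor[of "Inr (s, a)" t] left(1) by simp
  next
    case (right s a)
    then show ?thesis using z_acc by (intro UN_I[of "Inr (s, a)"]) auto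
  qed
qed

lemma subsingleton_accessors_seq:
  assumes A_romdp: "is_romdp A" and B_romdp: "is_romdp B" and composable: "n_exits A = n_ents B"
    and j_exit: "j < n_exits B"
  shows "subsingleton (accessors (romdp_seq A B) (Inr j))"
proof -
  note accessors_subset = accessors_seq_subset[OF A_romdp B_romdp composable j_exit]
  consider (empty) "accessors B (Inr j) = {}" | (singleton) w where "accessors B (Inr j) = {w}"
    using subsingleton_accessors[OF B_romdp j_exit] by (auto simp: subsingleton_def)
  then show ?thesis
  proof cases
    case empty
    then show ?thesis using accessors_subset by (simp add: subsingleton_def)
  next
    case (singleton w)
    show ?thesis
    proof (cases w)
      case (Inl k)
      then have "k < n_exits A"
        using singleton composable accessors_simps(1)[of k B "Inr j"] by simp
      then show ?thesis
        using accessors_subset subsingleton_accessors[OF A_romdp]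
        by (simp add: singleton Inl subsingleton_image)
    next
      case (Inr sa)
      then show ?thesis
        using accessors_subset by (cases sa) (auto simp: singleton intro!: subsingletonI)
    qed
  qed
qed

lemma is_romdp_seq:
  assumes A_romdp: "is_romdp A" and B_romdp: "is_romdp B" and composable: "n_exits A = n_ents B"
  shows "is_romdp (romdp_seq A B)"
proof (rule is_romdpI)
  let ?S = "romdp_seq A B"
  show finite_positions: "finite (positions ?S)"
    using is_romdpD(1)[OF A_romdp] is_romdpD(1)[OF B_romdp] by simp
  show "entr ?S i \<in> targets ?S" if "i < n_ents ?S" for i
    using is_romdpD(3)[OF A_romdp] seq_target_in_targets[OF B_romdp composable] that
    by (simp add: entr_romdp_seq)
  have finite_targets: "finite (targets ?S)"
    using finite_positions by (simp add: targets_def)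
  show "proper_position ?S s" if "s \<in> positions ?S" for s
    using that
      proper_position_embeds[OF A_romdp finite_targets embeds_seq_left[OF B_romdp composable]]
      proper_position_embeds[OF B_romdp finite_targets embeds_seq_right] by auto
  show "subsingleton (accessors ?S (Inr j))" if "j < n_exits ?S" for j
    using that by (simp add: subsingleton_accessors_seq[OF assms])
qed

lemma solution_mat_seq:
  assumes A_romdp: "is_romdp A" and B_romdp: "is_romdp B" and composable: "n_exits A = n_ents B"
  shows "solution_mat (romdp_seq A B) = solution_mat A * solution_mat B"
proof (rule eq_matI)
  let ?S = "romdp_seq A B"
  fix i j assume "i < dim_row (solution_mat A * solution_mat B)"
    and "j < dim_col (solution_mat A * solution_mat B)"
  then have i_ent: "i < n_ents A" and j_exit: "j < n_exits B" by auto
  note seq_romdp = is_romdp_seq[OF A_romdp B_romdp composable]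
  have B_value:
    "exit_value ?S (unit_payoff j) (map_sum Inr id (entr B k)) = solution_mat B $$ (k, j)"
    if "k < n_ents B" for k
    using exit_value_embeds_map_sum[OF B_romdp seq_romdp embeds_seq_right, of "unit_payoff j"]
      is_romdpD(3)[OF B_romdp] that j_exit
    by (simp add: solution_mat_eq_exit_value)
  have "solution_mat ?S $$ (i, j) = exit_value ?S (unit_payoff j) (seq_target B (entr A i))"
    using i_ent j_exit by (simp add: solution_mat_eq_exit_value entr_romdp_seq)
  also have "\<dots> = exit_value A (\<lambda>k. exit_value ?S (unit_payoff j) (seq_target B (Inr k))) (entr A i)"
    using is_romdpD(3)[OF A_romdp i_ent]
    by (intro exit_value_embeds[OF A_romdp seq_romdp embeds_seq_left[OF B_romdp composable]]) auto
  also have "\<dots> = exit_value A (\<lambda>k. solution_mat B $$ (k, j)) (entr A i)"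
    using composable by (intro exit_value_cong) (simp add: B_value)
  also have "\<dots> = (solution_mat A * solution_mat B) $$ (i, j)"
    using i_ent j_exit composable
    by (simp add: exit_value_def scalar_prod_def solution_mat_def lessThan_atLeast0)
  finally show "solution_mat ?S $$ (i, j) = (solution_mat A * solution_mat B) $$ (i, j)" .
qed auto

lemma mc_solution_seq:
  assumes "is_romdp A" "is_romdp B" "n_exits A = n_ents B"
  shows "mc_solution (romdp_seq A B) = mc_comp (mc_solution A) (mc_solution B)"
  unfolding mc_solution_eq solution_mat_seq[OF assms] using assms(3)
  by (intro mc_comp_mc_of_dual[symmetric]) auto

section \<open>Sums\<close>

lemma romdp_sum_simps [simp]:
  "n_ents (romdp_sum A B) = n_ents A + n_ents B" "n_exits (romdp_sum A B) = n_exits A + n_exits B"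
  "positions (romdp_sum A B) = positions A <+> positions B"
  "trans_prob (romdp_sum A B) = sum_prob A B"
  "reward (romdp_sum A B) = case_sum (reward A) (reward B)"
  by (auto simp: romdp_sum_def)

lemma entr_romdp_sum: "entr (romdp_sum A B) i =
    (if i < n_ents A then map_sum Inl id (entr A i)
     else map_sum Inr (\<lambda>j. j + n_exits A) (entr B (i - n_ents A)))"
  by (simp add: romdp_sum_def)

lemma targets_sum_cases:
  assumes "t \<in> targets (romdp_sum A B)"
  obtains (left) u where "u \<in> targets A" "t = map_sum Inl id u"
  | (right) u where "u \<in> targets B" "t = map_sum Inr (\<lambda>j. j + n_exits A) u"
proof (cases t)
  case (Inl s)
  then show thesis using assms that(1)[of "Inl _"] that(2)[of "Inl _"] by (cases s) auto
next
  case (Inr j)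
  then show thesis
    using assms that(1)[of "Inr j"] that(2)[of "Inr (j - n_exits A)"]
    by (cases "j < n_exits A") auto
qed

lemma embeds_sum_left: "embeds Inl (map_sum Inl id) A (romdp_sum A B)"
proof (rule embeds_map_sum)
  show "trans_prob (romdp_sum A B) (Inl s) a (map_sum Inl id t) = trans_prob A s a t"
    if "t \<in> targets A" for s a t
    using that by (cases t) auto
  show "trans_prob (romdp_sum A B) (Inl s) a t = 0"
    if "t \<in> targets (romdp_sum A B)" "t \<notin> map_sum Inl id ` targets A" for s a t
    using that(1)
  proof (cases rule: targets_sum_cases)
    case (right u)
    then show ?thesis by (cases u) auto
  qed (use that(2) in blast)
qed auto

lemma embeds_sum_right: "embeds Inr (map_sum Inr (\<lambda>j. j + n_exits A)) B (romdp_sum A B)"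
proof (rule embeds_map_sum)
  show "trans_prob (romdp_sum A B) (Inr s) a (map_sum Inr (\<lambda>j. j + n_exits A) t) =
      trans_prob B s a t"
    for s a t
    by (cases t) auto
  show "trans_prob (romdp_sum A B) (Inr s) a t = 0"
    if "t \<in> targets (romdp_sum A B)" "t \<notin> map_sum Inr (\<lambda>j. j + n_exits A) ` targets B" for s a t
    using that(1)
  proof (cases rule: targets_sum_cases)
    case (left u)
    then show ?thesis by (cases u) auto
  qed (use that(2) in blast)
qed (auto simp: inj_on_def)

lemma accessors_sum_subset:
  assumes A_romdp: "is_romdp A"
  shows "accessors (romdp_sum A B) (Inr j) \<subseteq> (if j < n_exits A
    then map_sum id (map_prod Inl id) ` accessors A (Inr j)
    else map_sum (\<lambda>i. i + n_ents A) (map_prod Inr id) ` accessors B (Inr (j - n_exits A)))"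
    (is "_ \<subseteq> ?U")
proof
  fix z assume z_acc: "z \<in> accessors (romdp_sum A B) (Inr j)"
  show "z \<in> ?U"
    using z_acc romdp_sum_simps(3)
  proof (cases rule: accessors_PlusE)
    case (entrance i)
    show ?thesis
    proof (cases "i < n_ents A")
      case True
      then show ?thesis
        using z_acc entrance is_romdpD(3)[OF A_romdp, of i]
        by (cases "entr A i") (auto simp: entr_romdp_sum intro!: image_eqI[of _ _ "Inl i"])
    next
      case False
      then show ?thesis
        using z_acc entrance by (cases "entr B (i - n_ents A)")
          (auto simp: entr_romdp_sum intro!: image_eqI[of _ _ "Inl (i - n_ents A)"])
    qed
  next
    case (left s a)
    then show ?thesis
      using z_acc by (auto split: if_splits intro!: image_eqI[of _ _ "Inr (s, a)"])
  next
    case (right s a)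
    then show ?thesis
      using z_acc by (auto split: if_splits intro!: image_eqI[of _ _ "Inr (s, a)"])
  qed
qed

lemma is_romdp_sum:
  assumes A_romdp: "is_romdp A" and B_romdp: "is_romdp B"
  shows "is_romdp (romdp_sum A B)"
proof (rule is_romdpI)
  let ?S = "romdp_sum A B"
  show finite_positions: "finite (positions ?S)"
    using is_romdpD(1)[OF A_romdp] is_romdpD(1)[OF B_romdp] by simp
  have finite_targets: "finite (targets ?S)"
    using finite_positions by (simp add: targets_def)
  show "proper_position ?S s" if "s \<in> positions ?S" for s
    using that proper_position_embeds[OF A_romdp finite_targets embeds_sum_left]
      proper_position_embeds[OF B_romdp finite_targets embeds_sum_right] by auto
  show "entr ?S i \<in> targets ?S" if "i < n_ents ?S" for i
  proof (cases "i < n_ents A")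
    case True
    then show ?thesis
      using is_romdpD(3)[OF A_romdp, of i] by (cases "entr A i") (auto simp: entr_romdp_sum)
  next
    case False
    then show ?thesis
      using is_romdpD(3)[OF B_romdp, of "i - n_ents A"] that
      by (cases "entr B (i - n_ents A)") (auto simp: entr_romdp_sum)
  qed
  show "subsingleton (accessors ?S (Inr j))" if "j < n_exits ?S" for j
    using that accessors_sum_subset[OF A_romdp, of B j] subsingleton_accessors[OF A_romdp]
      subsingleton_accessors[OF B_romdp, of "j - n_exits A"]
    by (auto split: if_splits intro: subsingleton_image)
qed

lemma solution_mat_sum:
  assumes A_romdp: "is_romdp A" and B_romdp: "is_romdp B"
  shows "solution_mat (romdp_sum A B) = four_block_mat (solution_mat A)
    (0\<^sub>m (n_ents A) (n_exits B)) (0\<^sub>m (n_ents B) (n_exits A)) (solution_mat B)"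
    (is "_ = ?M")
proof (rule eq_matI)
  let ?S = "romdp_sum A B"
  fix i j assume "i < dim_row ?M" and "j < dim_col ?M"
  then have i_ent: "i < n_ents A + n_ents B" and j_exit: "j < n_exits A + n_exits B" by auto
  note sum_romdp = is_romdp_sum[OF A_romdp B_romdp]
  show "solution_mat ?S $$ (i, j) = ?M $$ (i, j)"
  proof (cases "i < n_ents A")
    case True
    then have "solution_mat ?S $$ (i, j) = exit_value A (unit_payoff j) (entr A i)"
      using exit_value_embeds_map_sum[OF A_romdp sum_romdp embeds_sum_left, of "unit_payoff j"]
        is_romdpD(3)[OF A_romdp] j_exit
      by (simp add: solution_mat_eq_exit_value entr_romdp_sum)
    then show ?thesis
      using True i_ent j_exit by (simp add: exit_value_unit_payoff solution_mat_def)
  next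
    case False
    let ?i = "i - n_ents A"
    have "solution_mat ?S $$ (i, j) = exit_value B (\<lambda>k. unit_payoff j (k + n_exits A)) (entr B ?i)"
      using exit_value_embeds_map_sum[OF B_romdp sum_romdp embeds_sum_right, of "unit_payoff j"]
        is_romdpD(3)[OF B_romdp, of ?i] i_ent j_exit False
      by (simp add: solution_mat_eq_exit_value entr_romdp_sum)
    also have "\<dots> = (if j < n_exits A then 0
        else exit_value B (unit_payoff (j - n_exits A)) (entr B ?i))"
      by (auto simp: exit_value_def intro!: sum.cong)
    finally show ?thesis
      using False i_ent j_exit by (simp add: solution_mat_eq_exit_value)
  qed
qed auto

lemma mc_solution_sum:
  assumes "is_romdp A" "is_romdp B"
  shows "mc_solution (romdp_sum A B) = mc_sum (mc_solution A) (mc_solution B)"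
  by (simp add: mc_solution_eq solution_mat_sum[OF assms] mc_sum_mc_of_dual)

section \<open>Identities and swaps\<close>

lemma is_romdp_id: "is_romdp (romdp_id m)"
  by (rule is_romdpI) (auto simp: romdp_id_def accessors_def subsingleton_def)

lemma is_romdp_swap: "is_romdp (romdp_swap m n)"
  by (rule is_romdpI) (auto simp: romdp_swap_def accessors_def subsingleton_def split: if_splits)

lemma mc_solution_wires:
  assumes C_romdp: "is_romdp C" and entr: "\<And>i. i < n_ents C \<Longrightarrow> entr C i = Inr (g i)"
  shows "mc_solution C = mat (n_ents C) (n_exits C) (\<lambda>(i, j). (of_bool (j = g i), 0))"
proof -
  have "reach C j (entr C i) = of_bool (j = g i)" if "i < n_ents C" "j < n_exits C" for i j
  proof -
    have "g i < n_exits C"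
      using is_romdpD(3)[OF C_romdp that(1)] that by (simp add: entr)
    then have "exit_value C (unit_payoff j) (Inr (g i)) = of_bool (g i = j)"
      by (intro exit_value_Inr C_romdp) simp_all
    then show ?thesis
      using that by (simp add: entr exit_value_unit_payoff eq_commute[of j])
  qed
  then show ?thesis
    by (intro eq_matI) (auto simp: mc_solution_eq mc_of_dual_def solution_mat_def)
qed

lemma romdp_solution_id: "romdp_solution (romdp_id m :: ('q, 'a) romdp) = {mc_id m}"
proof -
  have "mc_solution (induced_mc (romdp_id m) \<tau>) = mc_id m" for \<tau> :: "'q \<Rightarrow> 'a"
    using mc_solution_wires[OF is_romdp_induced_mc[OF is_romdp_id], of m \<tau> id]
    by (auto simp: mc_id_def romdp_id_def intro!: eq_matI)
  then show ?thesis by (simp add: romdp_solution_def)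
qed

lemma romdp_solution_swap: "romdp_solution (romdp_swap m n :: ('q, 'a) romdp) = {mc_swap m n}"
proof -
  have "mc_solution (induced_mc (romdp_swap m n) \<tau>) = mc_swap m n" for \<tau> :: "'q \<Rightarrow> 'a"
    using mc_solution_wires[OF is_romdp_induced_mc[OF is_romdp_swap], of m n \<tau>
        "\<lambda>i. if i < m then i + n else i - m"]
    by (simp add: mc_swap_def romdp_swap_def)
  then show ?thesis by (simp add: romdp_solution_def)
qed

section \<open>Traces of roMDPs\<close>

lemma romdp_trace_simps [simp]:
  "n_ents (romdp_trace l A) = n_ents A - l" "n_exits (romdp_trace l A) = n_exits A - l"
  "positions (romdp_trace l A) = positions A" "reward (romdp_trace l A) = reward A"
  "entr (romdp_trace l A) = trace_entr l A"
  by (simp_all add: romdp_trace_def)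

inductive feeds_to :: "nat \<Rightarrow> ('q, 'a) romdp \<Rightarrow> 'q + nat \<Rightarrow> 'q + nat \<Rightarrow> bool" for l A where
  stop: "t \<notin> Inr ` {..<l} \<Longrightarrow> feeds_to l A t t"
| feed: "k < l \<Longrightarrow> feeds_to l A (entr A k) t \<Longrightarrow> feeds_to l A (Inr k) t"

lemma feeds_to_Inr_iff: "k < l \<Longrightarrow> feeds_to l A (Inr k) t \<longleftrightarrow> feeds_to l A (entr A k) t"
  by (auto intro: feeds_to.feed elim: feeds_to.cases)

lemma feeds_to_end: "feeds_to l A t t' \<Longrightarrow> t' \<notin> Inr ` {..<l}"
  by (induction rule: feeds_to.induct) auto

lemma feeds_to_unique: "feeds_to l A t t1 \<Longrightarrow> feeds_to l A t t2 \<Longrightarrow> t1 = t2"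
proof (induction rule: feeds_to.induct)
  case (stop t)
  then show ?case by (auto elim: feeds_to.cases)
next
  case (feed k t)
  then show ?case by (simp add: feeds_to_Inr_iff)
qed

lemma feeds_to_in_targets:
  assumes "is_romdp A" "l \<le> n_ents A"
  shows "feeds_to l A t t' \<Longrightarrow> t \<in> targets A \<Longrightarrow> t' \<in> targets A"
  by (induction rule: feeds_to.induct) (use is_romdpD(3)[OF assms(1)] assms(2) in auto)

lemma trace_seq_Suc_shift:
  "trace_seq A i (Suc n) = (case entr A i of Inl s \<Rightarrow> Inl s | Inr k \<Rightarrow> trace_seq A k n)"
  by (induction n) (auto split: sum.split)

lemma feeds_to_imp_trace_seq:
  assumes "feeds_to l A t t'" "entr A i = t"
  shows "\<exists>n. trace_seq A i (Suc n) = t' \<and> (\<forall>m. 0 < m \<and> m \<le> n \<longrightarrow> trace_seq A i m \<in> Inr ` {..<l})"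
  using assms
proof (induction arbitrary: i rule: feeds_to.induct)
  case (stop t)
  then show ?case by (intro exI[of _ 0]) (auto split: sum.split)
next
  case (feed k t)
  then obtain n where n_steps: "trace_seq A k (Suc n) = t"
    "\<forall>m. 0 < m \<and> m \<le> n \<longrightarrow> trace_seq A k m \<in> Inr ` {..<l}" by blast
  have "trace_seq A i m \<in> Inr ` {..<l}" if "0 < m" "m \<le> Suc n" for m
    using that n_steps(2) feed.hyps(1) feed.prems
    by (cases m; cases "m - 1") (auto simp: trace_seq_Suc_shift simp del: trace_seq.simps(2))
  moreover have "trace_seq A i (Suc (Suc n)) = t"
    using n_steps(1) feed.prems by (subst trace_seq_Suc_shift) simp
  ultimately show ?case by blast
qed

lemma trace_seq_imp_feeds_to:
  assumes "trace_seq A i n = t" "t \<notin> Inr ` {..<l}" "\<forall>m<n. trace_seq A i m \<in> Inr ` {..<l}"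
  shows "feeds_to l A (Inr i) t"
  using assms
proof (induction n arbitrary: i)
  case 0
  then show ?case by (auto intro: feeds_to.stop)
next
  case (Suc n)
  have i_lt: "i < l" using Suc.prems(3)[rule_format, of 0] by auto
  show ?case
  proof (cases "entr A i")
    case (Inl s)
    then show ?thesis
      using Suc.prems(1,2) i_lt trace_seq_Suc_shift[of A i n]
      by (simp add: feeds_to_Inr_iff feeds_to.stop del: trace_seq.simps(2))
  next
    case (Inr k)
    have "trace_seq A k m \<in> Inr ` {..<l}" if "m < n" for m
      using Suc.prems(3)[rule_format, of "Suc m"] that Inr trace_seq_Suc_shift[of A i m] by simp
    then have "feeds_to l A (Inr k) t"
      using Suc.prems(1,2) Inr trace_seq_Suc_shift[of A i n] by (intro Suc.IH) auto
    then show ?thesis using i_lt Inr by (simp add: feeds_to_Inr_iff)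
  qed
qed

lemma trace_prec_eq:
  assumes "t \<notin> Inr ` {..<l}"
  shows "trace_prec l A t = {i. i < l \<and> feeds_to l A (Inr i) t}"
proof -
  have "\<exists>n. trace_seq A i n = t \<and> (\<forall>m<n. trace_seq A i m \<in> Inr ` {..<l})"
    if i_lt: "i < l" "feeds_to l A (Inr i) t" for i
  proof -
    obtain n where "trace_seq A i (Suc n) = t"
      "\<forall>m. 0 < m \<and> m \<le> n \<longrightarrow> trace_seq A i m \<in> Inr ` {..<l}"
      using i_lt feeds_to_imp_trace_seq[of l A "entr A i" t i] by (auto simp: feeds_to_Inr_iff)
    moreover have "trace_seq A i 0 \<in> Inr ` {..<l}" using i_lt(1) by simp
    ultimately show ?thesis by (metis less_Suc_eq_le not_gr_zero)
  qed
  then show ?thesis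
    unfolding trace_prec_def using trace_seq_imp_feeds_to[OF _ assms] by blast
qed

abbreviation shift_exits :: "nat \<Rightarrow> 'q + nat \<Rightarrow> 'q + nat" where
  "shift_exits l \<equiv> map_sum id (\<lambda>j. j + l)"

lemma shift_exits_inject: "shift_exits l t = shift_exits l t' \<longleftrightarrow> t = t'"
  by (cases t; cases t') auto

lemma shift_exits_notin: "shift_exits l t \<notin> Inr ` {..<l}"
  by (cases t) auto

lemma shift_exits_cases:
  obtains (fed_back) k where "t = Inr k" "k < l" | (shifted) u where "t = shift_exits l u"
proof (cases t)
  case (Inl s)
  then show thesis using that(2)[of "Inl s"] by simp
next
  case (Inr k)
  then show thesis using that(1)[of k] that(2)[of "Inr (k - l)"] by (cases "k < l") auto
qed

lemma shift_exits_in_targets: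
  "l \<le> n_exits A \<Longrightarrow> shift_exits l t \<in> targets A \<longleftrightarrow> t \<in> targets (romdp_trace l A)"
  by (cases t) auto

text \<open>On wires that are fed back forever \<open>trace_target\<close> is \<open>Inr (n_exits A)\<close>, which is not a target
  of the trace, so that exit values vanish there.\<close>

definition trace_target :: "nat \<Rightarrow> ('q, 'a) romdp \<Rightarrow> 'q + nat \<Rightarrow> 'q + nat" where
  "trace_target l A t = (if \<exists>u. feeds_to l A t (shift_exits l u)
     then THE u. feeds_to l A t (shift_exits l u) else Inr (n_exits A))"

lemma trace_target_eq:
  assumes "feeds_to l A t (shift_exits l u)"
  shows "trace_target l A t = u"
proof -
  have "feeds_to l A t (shift_exits l u') \<longleftrightarrow> u' = u" for u'
    using assms feeds_to_unique shift_exits_inject by metis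
  then show ?thesis by (simp add: trace_target_def)
qed

lemma trace_target_shift_exits [simp]: "trace_target l A (shift_exits l t) = t"
  by (intro trace_target_eq feeds_to.stop shift_exits_notin)

lemma trace_target_Inl [simp]: "trace_target l A (Inl s) = Inl s"
  using trace_target_shift_exits[of l A "Inl s"] by simp

lemma trace_target_Inr_add: "trace_target l A (Inr (j + l)) = Inr j"
  using trace_target_shift_exits[of l A "Inr j"] by simp

lemma trace_target_feed: "k < l \<Longrightarrow> trace_target l A (Inr k) = trace_target l A (entr A k)"
  by (simp add: trace_target_def feeds_to_Inr_iff)

lemma trace_target_eq_iff:
  assumes "u \<in> targets (romdp_trace l A)"
  shows "trace_target l A t = u \<longleftrightarrow> feeds_to l A t (shift_exits l u)"
proof
  assume target_eq: "trace_target l A t = u"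
  have "u \<noteq> Inr (n_exits A)" using assms by auto
  then obtain u' where "feeds_to l A t (shift_exits l u')"
    using target_eq by (auto simp: trace_target_def split: if_splits)
  then show "feeds_to l A t (shift_exits l u)" using target_eq trace_target_eq by metis
qed (rule trace_target_eq)

lemma trace_entr_eq:
  assumes "feeds_to l A (entr A (i + l)) t"
  shows "trace_entr l A i = trace_target l A (entr A (i + l))"
proof -
  obtain u where t_eq: "t = shift_exits l u"
    using feeds_to_end[OF assms] by (cases t rule: shift_exits_cases[of _ l]) auto
  obtain n where n_steps: "trace_seq A (i + l) (Suc n) = t"
    "\<forall>m. 0 < m \<and> m \<le> n \<longrightarrow> trace_seq A (i + l) m \<in> Inr ` {..<l}"
    using feeds_to_imp_trace_seq[OF assms refl] by blast
  have "(LEAST k. k \<ge> 1 \<and> trace_seq A (i + l) k \<notin> Inr ` {..<l}) = Suc n"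
  proof (rule Least_equality)
    show "Suc n \<ge> 1 \<and> trace_seq A (i + l) (Suc n) \<notin> Inr ` {..<l}"
      using n_steps(1) feeds_to_end[OF assms] by auto
    show "Suc n \<le> m" if "m \<ge> 1 \<and> trace_seq A (i + l) m \<notin> Inr ` {..<l}" for m
      by (rule ccontr) (use n_steps(2)[rule_format, of m] that in auto)
  qed
  then have "trace_entr l A i = map_sum id (\<lambda>j. j - l) t"
    using n_steps(1) by (simp add: trace_entr_def del: trace_seq.simps(2))
  also have "\<dots> = trace_target l A (entr A (i + l))"
    using assms trace_target_eq[of l A _ u] by (cases u) (auto simp: t_eq)
  finally show ?thesis .
qed

text \<open>By unique access, the wires below \<open>l\<close> that are fed back forever are permuted by the feedback,
  so each of them is accessed by another one and by nothing else.\<close>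

lemma looping_wire_accessed:
  assumes A_romdp: "is_romdp A" and l_le: "l \<le> n_ents A" "l \<le> n_exits A"
    and k_loops: "k < l" "\<nexists>t. feeds_to l A (Inr k) t"
  shows "\<exists>e<l. entr A e = Inr k"
proof -
  define L where "L = {k. k < l \<and> (\<nexists>t. feeds_to l A (Inr k) t)}"
  have "\<exists>k'\<in>L. entr A k = Inr k'" if "k \<in> L" for k
  proof -
    have "entr A k \<in> Inr ` {..<l}"
      using that by (metis (no_types, lifting) L_def feeds_to.feed feeds_to.stop mem_Collect_eq)
    then show ?thesis using that by (auto simp: L_def feeds_to_Inr_iff)
  qed
  then obtain f where f_next: "\<And>k. k \<in> L \<Longrightarrow> f k \<in> L \<and> entr A k = Inr (f k)" by metis
  have "inj_on f L"
  proof (rule inj_onI)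
    fix k k' assume kk'_L: "k \<in> L" "k' \<in> L" "f k = f k'"
    have "f k < n_exits A" using f_next[OF kk'_L(1)] l_le by (auto simp: L_def)
    then have "(Inl k :: nat + 'a \<times> 'b) = Inl k'"
      using f_next[OF kk'_L(1)] f_next[OF kk'_L(2)] kk'_L l_le
      by (intro subsingletonD[OF subsingleton_accessors[OF A_romdp, of "f k"]]) (auto simp: L_def)
    then show "k = k'" by simp
  qed
  moreover have "finite L" "f ` L \<subseteq> L"
    using f_next by (auto simp: L_def)
  ultimately have "f ` L = L"
    by (simp add: endo_inj_surj)
  moreover have "k \<in> L"
    using k_loops by (simp add: L_def)
  ultimately have "k \<in> f ` L"
    by simp
  then obtain e where "e \<in> L" "f e = k"
    by (elim imageE) simp
  then show ?thesis using f_next by (auto simp: L_def)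
qed

lemma ex_feeds_to:
  assumes A_romdp: "is_romdp A" and l_le: "l \<le> n_ents A" "l \<le> n_exits A"
    and x_acc: "x \<in> accessors A t" "x \<notin> Inl ` {..<l}"
  shows "\<exists>t'. feeds_to l A t t'"
proof (cases t rule: shift_exits_cases[of _ l])
  case (fed_back k)
  show ?thesis
  proof (rule ccontr)
    assume "\<not> ?thesis"
    then obtain e where e_lt: "e < l" "entr A e = Inr k"
      using looping_wire_accessed[OF A_romdp l_le fed_back(2)] fed_back(1) by auto
    have "x = Inl e"
      using e_lt l_le x_acc fed_back
      by (intro subsingletonD[OF subsingleton_accessors[OF A_romdp, of k]]) auto
    then show False using e_lt x_acc(2) by simp
  qed
next
  case (shifted u)
  then show ?thesis using feeds_to.stop[OF shift_exits_notin] by blast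
qed

lemma trace_target_in_targets:
  assumes A_romdp: "is_romdp A" and l_le: "l \<le> n_ents A" "l \<le> n_exits A"
    and x_acc: "x \<in> accessors A t" "x \<notin> Inl ` {..<l}" and t_target: "t \<in> targets A"
  shows "trace_target l A t \<in> targets (romdp_trace l A)"
proof -
  obtain t' where feeds: "feeds_to l A t t'" using ex_feeds_to[OF A_romdp l_le x_acc] ..
  then obtain u where "t' = shift_exits l u"
    using feeds_to_end[OF feeds] by (cases t' rule: shift_exits_cases[of _ l]) auto
  then show ?thesis
    using feeds feeds_to_in_targets[OF A_romdp l_le(1) feeds t_target] trace_target_eq
      shift_exits_in_targets[OF l_le(2)] by metis
qed

lemma trace_entr_eq_trace_target:
  assumes A_romdp: "is_romdp A" and l_le: "l \<le> n_ents A" "l \<le> n_exits A"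
    and i_ent: "i + l < n_ents A"
  shows "trace_entr l A i = trace_target l A (entr A (i + l))"
  using ex_feeds_to[OF A_romdp l_le, of "Inl (i + l)" "entr A (i + l)"] i_ent trace_entr_eq by auto

lemma embeds_trace:
  assumes A_romdp: "is_romdp A" and l_le: "l \<le> n_ents A" "l \<le> n_exits A"
  shows "embeds id (trace_target l A) A (romdp_trace l A)"
  unfolding embeds_def
proof (intro conjI allI ballI impI)
  let ?T = "romdp_trace l A"
  fix s a t assume s_pos: "s \<in> positions A" and t_target: "t \<in> targets ?T"
  have shift_in_targets: "shift_exits l t \<in> targets A"
    using t_target shift_exits_in_targets[OF l_le(2)] by blast
  have "{t' \<in> targets A. trace_target l A t' = t} =
      insert (shift_exits l t) (Inr ` trace_prec l A (shift_exits l t))" (is "?S = ?S'")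
  proof (intro equalityI subsetI)
    fix t' assume "t' \<in> ?S"
    then have "feeds_to l A t' (shift_exits l t)" using trace_target_eq_iff[OF t_target] by blast
    then show "t' \<in> ?S'"
      by (cases t' rule: shift_exits_cases[of _ l])
        (auto simp: trace_prec_eq[OF shift_exits_notin] dest: trace_target_eq)
  next
    fix t' assume "t' \<in> ?S'"
    then show "t' \<in> ?S"
      using shift_in_targets l_le(2)
      by (auto simp: trace_prec_eq[OF shift_exits_notin] trace_target_eq)
  qed
  moreover have "shift_exits l t \<notin> Inr ` trace_prec l A (shift_exits l t)"
    using shift_exits_notin[of l t] by (auto simp: trace_prec_def)
  ultimately show "trans_prob ?T (id s) a t =
      (\<Sum>t' | t' \<in> targets A \<and> trace_target l A t' = t. trans_prob A s a t')"
    by (simp add: romdp_trace_def Let_def sum.reindex trace_prec_def)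
next
  fix s a t assume s_pos: "s \<in> positions A" and t_target: "t \<in> targets A"
    and outside: "trace_target l A t \<notin> targets (romdp_trace l A)"
  show "trans_prob A s a t = 0"
    using trace_target_in_targets[OF A_romdp l_le _ _ t_target, of "Inr (s, a)"] outside s_pos
      is_romdpD(4)[OF A_romdp s_pos t_target, of a]
    by force
qed auto

definition fed_by :: "nat \<Rightarrow> ('q, 'a) romdp \<Rightarrow> (nat \<times> nat) set" where
  "fed_by l A = {(k', k). k < l \<and> entr A k = Inr k'}"

lemma accessors_fed_by:
  assumes A_romdp: "is_romdp A" and l_le: "l \<le> n_ents A"
    and fed: "(k', k) \<in> fed_by l A" and z_acc: "z \<in> accessors A (Inr k')"
  shows "z = Inl k"
proof -
  have k_ent: "k < n_ents A" "entr A k = Inr k'"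
    using fed l_le by (auto simp: fed_by_def)
  then have "k' < n_exits A"
    using is_romdpD(3)[OF A_romdp, of k] by simp
  then show ?thesis
    using k_ent by (intro subsingletonD[OF subsingleton_accessors[OF A_romdp] z_acc]) simp_all
qed

lemma single_valued_fed_by:
  assumes "is_romdp A" "l \<le> n_ents A"
  shows "single_valued (fed_by l A)"
proof (rule single_valuedI)
  fix k' k1 k2 assume fed: "(k', k1) \<in> fed_by l A" "(k', k2) \<in> fed_by l A"
  then have "Inl k2 \<in> accessors A (Inr k')"
    using assms(2) by (auto simp: fed_by_def)
  then show "k1 = k2"
    using accessors_fed_by[OF assms fed(1), of "Inl k2"] by simp
qed

lemma feeds_to_Inr_imp_fed_by_rtrancl:
  "feeds_to l A t (Inr e) \<Longrightarrow> \<exists>k. t = Inr k \<and> (e, k) \<in> (fed_by l A)\<^sup>*"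
proof (induction t "Inr e :: 'a + nat" rule: feeds_to.induct)
  case (feed k)
  then obtain k' where "entr A k = Inr k'" "(e, k') \<in> (fed_by l A)\<^sup>*" by blast
  moreover from this(1) have "(k', k) \<in> fed_by l A"
    using feed.hyps(1) by (simp add: fed_by_def)
  ultimately show ?case by (blast intro: rtrancl_into_rtrancl)
qed blast

lemma feeds_to_exit_accessor_unique:
  assumes A_romdp: "is_romdp A" and l_le: "l \<le> n_ents A"
    and x_acc: "x \<in> accessors A t" "x \<notin> Inl ` {..<l}" "t \<in> targets A" "feeds_to l A t (Inr e)"
    and y_acc: "y \<in> accessors A u" "y \<notin> Inl ` {..<l}" "feeds_to l A u (Inr e)"
  shows "x = y"
proof -
  have fed_by_stops: "k' = k"
    if z_acc: "z \<in> accessors A (Inr k)" "z \<notin> Inl ` {..<l}" and "(k, k') \<in> (fed_by l A)\<^sup>*"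
    for z k k'
    using that(3)
  proof (cases rule: converse_rtranclE)
    case (step k1)
    then show ?thesis
      using accessors_fed_by[OF A_romdp l_le step(1) z_acc(1)] z_acc(2) by (auto simp: fed_by_def)
  qed simp
  obtain k where k_fed: "t = Inr k" "(e, k) \<in> (fed_by l A)\<^sup>*"
    using feeds_to_Inr_imp_fed_by_rtrancl[OF x_acc(4)] by blast
  obtain k' where k'_fed: "u = Inr k'" "(e, k') \<in> (fed_by l A)\<^sup>*"
    using feeds_to_Inr_imp_fed_by_rtrancl[OF y_acc(3)] by blast
  have "(k, k') \<in> (fed_by l A)\<^sup>* \<or> (k', k) \<in> (fed_by l A)\<^sup>*"
    using single_valued_confluent[OF single_valued_fed_by[OF A_romdp l_le] k_fed(2) k'_fed(2)] .
  then have "k = k'"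
    using fed_by_stops x_acc(1,2) y_acc(1,2) k_fed(1) k'_fed(1) by blast
  then show ?thesis
    using x_acc y_acc k_fed(1) k'_fed(1)
    by (intro subsingletonD[OF subsingleton_accessors[OF A_romdp, of k]]) auto
qed

lemma accessors_trace:
  assumes A_romdp: "is_romdp A" and l_le: "l \<le> n_ents A" "l \<le> n_exits A"
    and j_exit: "j < n_exits A - l"
    and z_acc: "z \<in> accessors (romdp_trace l A) (Inr j)"
  shows "\<exists>t\<in>targets A. map_sum (\<lambda>i. i + l) id z \<in> accessors A t \<and> feeds_to l A t (Inr (j + l))"
proof -
  let ?T = "romdp_trace l A"
  have j_target: "Inr j \<in> targets ?T" using j_exit by simp
  show ?thesis
  proof (cases z)
    case (Inl i)
    then have i_ent: "i + l < n_ents A" "trace_target l A (entr A (i + l)) = Inr j"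
      using z_acc trace_entr_eq_trace_target[OF A_romdp l_le] by auto
    then show ?thesis
      using trace_target_eq_iff[OF j_target] is_romdpD(3)[OF A_romdp i_ent(1)] by (auto simp: Inl)
  next
    case (Inr sa)
    then obtain s a where z_eq: "z = Inr (s, a)" "s \<in> positions A"
      using z_acc by (cases sa) auto
    then obtain t where "t \<in> targets A" "trace_target l A t = Inr j" "Inr (s, a) \<in> accessors A t"
      using accessors_embedsE[OF embeds_trace[OF A_romdp l_le] z_eq(2) j_target, of a] z_acc
      by auto
    then show ?thesis
      using trace_target_eq_iff[OF j_target] by (auto simp: z_eq)
  qed
qed

lemma is_romdp_trace:
  assumes A_romdp: "is_romdp A" and l_le: "l \<le> n_ents A" "l \<le> n_exits A"
  shows "is_romdp (romdp_trace l A)"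
proof (rule is_romdpI)
  let ?T = "romdp_trace l A"
  show "finite (positions ?T)"
    using is_romdpD(1)[OF A_romdp] by simp
  then have finite_targets: "finite (targets ?T)"
    by (simp add: targets_def)
  show "entr ?T i \<in> targets ?T" if "i < n_ents ?T" for i
    using that trace_target_in_targets[OF A_romdp l_le, of "Inl (i + l)" "entr A (i + l)"]
      is_romdpD(3)[OF A_romdp, of "i + l"]
    by (simp add: trace_entr_eq_trace_target[OF A_romdp l_le] image_iff)
  show "proper_position ?T s" if "s \<in> positions ?T" for s
    using that proper_position_embeds[OF A_romdp finite_targets embeds_trace[OF A_romdp l_le]]
    by simp
  show "subsingleton (accessors ?T (Inr j))" if "j < n_exits ?T" for j
  proof (rule subsingletonI)
    fix x y assume xy_acc: "x \<in> accessors ?T (Inr j)" "y \<in> accessors ?T (Inr j)"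
    have j_exit: "j < n_exits A - l" using that by simp
    have "map_sum (\<lambda>i. i + l) id z \<notin> Inl ` {..<l}" for z :: "nat + 'a \<times> 'b"
      by (cases z) auto
    then have "map_sum (\<lambda>i. i + l) id x = map_sum (\<lambda>i. i + l) id y"
      using accessors_trace[OF A_romdp l_le j_exit xy_acc(1)]
        accessors_trace[OF A_romdp l_le j_exit xy_acc(2)]
        feeds_to_exit_accessor_unique[OF A_romdp l_le(1)]
      by (metis less_diff_conv)
    then show "x = y"
      by (cases x; cases y) auto
  qed
qed

section \<open>Exit values of a trace\<close>

definition split_exits :: "nat \<Rightarrow> (nat \<Rightarrow> dual) \<Rightarrow> (nat \<Rightarrow> dual) \<Rightarrow> nat \<Rightarrow> dual" where
  "split_exits l z c k = (if k < l then z k else c (k - l))"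

lemma split_exits_nonneg:
  "(\<And>k. k < l \<Longrightarrow> 0 \<le> z k) \<Longrightarrow> (\<And>j. 0 \<le> c j) \<Longrightarrow> 0 \<le> split_exits l z c k"
  by (simp add: split_exits_def)

lemma exit_value_trace:
  assumes A_romdp: "is_romdp A" and l_le: "l \<le> n_ents A" "l \<le> n_exits A"
    and c_nonneg: "\<And>j. 0 \<le> c j" and t_target: "t \<in> targets A"
  shows "exit_value (romdp_trace l A) c (trace_target l A t) = exit_value A
    (split_exits l (\<lambda>k. exit_value (romdp_trace l A) c (trace_target l A (Inr k))) c) t"
proof -
  let ?T = "romdp_trace l A"
  have T_romdp: "is_romdp ?T" by (rule is_romdp_trace[OF A_romdp l_le])
  have "exit_value ?T c (trace_target l A (Inr k)) = c (k - l)" if "l \<le> k" "k < n_exits A" for k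
    using exit_value_Inr[OF T_romdp c_nonneg, of "k - l"] trace_target_Inr_add[of l A "k - l"] that
    by simp
  then have "exit_value A (\<lambda>k. exit_value ?T c (trace_target l A (Inr k))) t =
      exit_value A (split_exits l (\<lambda>k. exit_value ?T c (trace_target l A (Inr k))) c) t"
    by (intro exit_value_cong) (simp add: split_exits_def)
  then show ?thesis
    using exit_value_embeds[OF A_romdp T_romdp embeds_trace[OF A_romdp l_le] c_nonneg t_target]
    by simp
qed

lemma exit_value_feeds_to_le:
  assumes A_romdp: "is_romdp A" and l_le: "l \<le> n_ents A" "l \<le> n_exits A"
    and z_nonneg: "\<And>k. k < l \<Longrightarrow> 0 \<le> z k" and c_nonneg: "\<And>j. 0 \<le> c j"
    and super: "\<And>k. k < l \<Longrightarrow> exit_value A (split_exits l z c) (entr A k) \<le> z k"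
    and "feeds_to l A t t'" "t \<in> targets A"
  shows "exit_value A (split_exits l z c) t' \<le> exit_value A (split_exits l z c) t"
  using assms(7,8)
proof (induction rule: feeds_to.induct)
  case (feed k t)
  let ?g = "exit_value A (split_exits l z c)"
  have "?g t \<le> ?g (entr A k)"
    using feed.IH feed.hyps(1) is_romdpD(3)[OF A_romdp, of k] l_le by simp
  also have "\<dots> \<le> z k"
    by (rule super[OF feed.hyps(1)])
  also have "z k = ?g (Inr k)"
    using exit_value_Inr[OF A_romdp, of "split_exits l z c" k] split_exits_nonneg[of l z c] z_nonneg
      c_nonneg feed
    by (simp add: split_exits_def)
  finally show ?case .
qed simp

lemma exit_value_trace_least:
  assumes A_romdp: "is_romdp A" and l_le: "l \<le> n_ents A" "l \<le> n_exits A"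
    and z_nonneg: "\<And>k. k < l \<Longrightarrow> 0 \<le> z k" and c_nonneg: "\<And>j. 0 \<le> c j"
    and super: "\<And>k. k < l \<Longrightarrow> exit_value A (split_exits l z c) (entr A k) \<le> z k"
    and t_target: "t \<in> targets A"
  shows "exit_value (romdp_trace l A) c (trace_target l A t) \<le> exit_value A (split_exits l z c) t"
proof -
  let ?T = "romdp_trace l A" and ?d = "split_exits l z c"
  let ?g = "exit_value A ?d"
  have T_romdp: "is_romdp ?T" by (rule is_romdp_trace[OF A_romdp l_le])
  have d_nonneg: "0 \<le> ?d k" for k by (intro split_exits_nonneg z_nonneg c_nonneg)
  have g_nonneg: "0 \<le> ?g t" for t by (intro exit_value_nonneg A_romdp d_nonneg)
  have g_le: "?g (shift_exits l (trace_target l A t)) \<le> ?g t"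
    if "t \<in> targets A" "trace_target l A t \<in> targets ?T" for t
    using exit_value_feeds_to_le[OF A_romdp l_le z_nonneg c_nonneg super _ that(1)]
      trace_target_eq_iff[OF that(2), of t] by simp
  have g_super: "supersolution (targets ?T) (bellman ?T c) (\<lambda>u. ?g (shift_exits l u))"
    unfolding supersolution_bellman_iff
  proof (intro conjI ballI allI impI)
    show "c j \<le> ?g (shift_exits l (Inr j))" if "j < n_exits ?T" for j
      using exit_value_Inr[OF A_romdp, of ?d "j + l"] d_nonneg that by (simp add: split_exits_def)
    fix s assume "s \<in> positions ?T"
    then have s_pos: "s \<in> positions A" by simp
    have "expect ?T () (id s) (\<lambda>u. ?g (shift_exits l u)) \<le> expect A () s ?g"
      using is_romdpD(2)[OF T_romdp]
      by (intro expect_embeds_le[OF A_romdp _ embeds_trace[OF A_romdp l_le] s_pos] g_le)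
    then have "bellman ?T c (\<lambda>u. ?g (shift_exits l u)) (Inl s) \<le> bellman A ?d ?g (Inl s)"
      using is_romdpD(6)[OF A_romdp s_pos] by (simp add: mult_left_mono Dual_nonneg)
    also have "\<dots> = ?g (Inl s)"
      using s_pos by (intro exit_value_fixed_point A_romdp d_nonneg) simp
    finally show "bellman ?T c (\<lambda>u. ?g (shift_exits l u)) (Inl s) \<le> ?g (shift_exits l (Inl s))"
      by simp
  qed (rule g_nonneg)
  show ?thesis
  proof (cases "trace_target l A t \<in> targets ?T")
    case True
    then show ?thesis
      using exit_value_le_supersolution[of ?T c, OF T_romdp c_nonneg g_super True]
        g_le[OF t_target True] by simp
  next
    case False
    then show ?thesis by (simp add: exit_value_eq_0 g_nonneg)
  qed
qed

section \<open>Neumann series\<close>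

lemma pow_mat_commute: "B \<in> carrier_mat n n \<Longrightarrow> B ^\<^sub>m d * B = B * B ^\<^sub>m d"
proof (induction d)
  case (Suc d)
  then show ?case by (simp add: assoc_mult_mat[of _ n n _ n _ n])
qed simp

definition affine_map :: "dual mat \<Rightarrow> (nat \<Rightarrow> dual) \<Rightarrow> (nat \<Rightarrow> dual) \<Rightarrow> nat \<Rightarrow> dual" where
  "affine_map B c z k = c k + (\<Sum>i<dim_col B. B $$ (k, i) * z i)"

lemma continuous_operator_affine_map:
  assumes "B \<in> carrier_mat l l" "\<And>i k. i < l \<Longrightarrow> k < l \<Longrightarrow> 0 \<le> B $$ (i, k)" "\<And>k. k < l \<Longrightarrow> 0 \<le> c k"
  shows "continuous_operator {..<l} (affine_map B c)"
proof
  show "affine_map B c v k \<le> affine_map B c w k"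
    if "\<And>i. i \<in> {..<l} \<Longrightarrow> v i \<le> w i" "k \<in> {..<l}" for v w k
    using that assms by (auto simp: affine_map_def intro!: sum_mono mult_left_mono)
  show "(\<lambda>n. affine_map B c (X n) k) \<longlonglongrightarrow> affine_map B c v k"
    if "\<And>i. i \<in> {..<l} \<Longrightarrow> (\<lambda>n. X n i) \<longlonglongrightarrow> v i" for X v k
    using that assms(1) unfolding affine_map_def by (auto intro!: tendsto_intros)
qed (use assms in \<open>auto simp: affine_map_def\<close>)

lemma index_pow_mat_Suc_mult:
  assumes B_carrier: "B \<in> carrier_mat l l" and C_carrier: "C \<in> carrier_mat l n" and "k < l" "j < n"
  shows "(B ^\<^sub>m Suc d * C) $$ (k, j) = (\<Sum>i<l. B $$ (k, i) * (B ^\<^sub>m d * C) $$ (i, j))"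
proof -
  have "B ^\<^sub>m Suc d * C = B * (B ^\<^sub>m d * C)"
    using B_carrier C_carrier by (simp add: pow_mat_commute assoc_mult_mat[of _ l l _ l _ n])
  then show ?thesis
    using assms by (simp add: scalar_prod_def lessThan_atLeast0 del: pow_mat.simps)
qed

lemma neumann_series_sums:
  fixes B C :: "dual mat"
  assumes B_carrier: "B \<in> carrier_mat l l"
    and B_nonneg: "\<And>i k. i < l \<Longrightarrow> k < l \<Longrightarrow> 0 \<le> B $$ (i, k)"
    and C_carrier: "C \<in> carrier_mat l n" and C_nonneg: "\<And>k. k < l \<Longrightarrow> 0 \<le> C $$ (k, j)"
    and j_exit: "j < n"
  defines "\<Phi> \<equiv> affine_map B (\<lambda>k. C $$ (k, j))"
  assumes y_super: "supersolution {..<l} \<Phi> y"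
    and least: "\<And>z k. supersolution {..<l} \<Phi> z \<Longrightarrow> k < l \<Longrightarrow> y k \<le> z k" and k_lt: "k < l"
  shows "(\<lambda>d. (B ^\<^sub>m d * C) $$ (k, j)) sums y k"
proof -
  interpret continuous_operator "{..<l}" \<Phi>
    unfolding \<Phi>_def by (intro continuous_operator_affine_map B_carrier B_nonneg C_nonneg)
  have "kleene_iterate \<Phi> m k = (\<Sum>d<m. (B ^\<^sub>m d * C) $$ (k, j))" if "k < l" for m k
    using that
  proof (induction m arbitrary: k)
    case (Suc m)
    have "kleene_iterate \<Phi> (Suc m) k = C $$ (k, j) + (\<Sum>i<l. B $$ (k, i) * kleene_iterate \<Phi> m i)"
      using B_carrier by (simp add: \<Phi>_def affine_map_def)
    also have "\<dots> = C $$ (k, j) + (\<Sum>i<l. B $$ (k, i) * (\<Sum>d<m. (B ^\<^sub>m d * C) $$ (i, j)))"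
      using Suc.IH by simp
    also have "\<dots> = (B ^\<^sub>m 0 * C) $$ (k, j) + (\<Sum>d<m. (B ^\<^sub>m Suc d * C) $$ (k, j))"
      using B_carrier C_carrier
      by (simp add: index_pow_mat_Suc_mult[OF B_carrier C_carrier Suc.prems j_exit] sum_distrib_left
          sum.swap[of _ "{..<m}"] del: pow_mat.simps(2))
    also have "\<dots> = (\<Sum>d<Suc m. (B ^\<^sub>m d * C) $$ (k, j))"
      by (simp only: sum.lessThan_Suc_shift)
    finally show ?case .
  qed simp
  moreover have "(\<lambda>m. kleene_iterate \<Phi> m k) \<longlonglongrightarrow> y k"
    by (rule iterate_tendsto_least[OF y_super]) (use least k_lt in auto)
  ultimately show ?thesis
    using k_lt by (simp add: sums_def)
qed

section \<open>The trace as a series\<close>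

definition subblock :: "'b mat \<Rightarrow> nat \<Rightarrow> nat \<Rightarrow> nat \<Rightarrow> nat \<Rightarrow> 'b mat" where
  "subblock M r c nr nc = mat nr nc (\<lambda>(i, j). M $$ (r + i, c + j))"

lemma subblock_carrier [simp]: "subblock M r c nr nc \<in> carrier_mat nr nc"
  and dim_subblock [simp]:
    "dim_row (subblock M r c nr nc) = nr" "dim_col (subblock M r c nr nc) = nc"
  by (simp_all add: subblock_def)

lemma index_subblock [simp]:
  "i < nr \<Longrightarrow> j < nc \<Longrightarrow> subblock M r c nr nc $$ (i, j) = M $$ (r + i, c + j)"
  by (simp add: subblock_def)

definition feedback_term :: "nat \<Rightarrow> dual mat \<Rightarrow> nat \<Rightarrow> dual mat" where
  "feedback_term l M d = subblock M l 0 (dim_row M - l) l * subblock M 0 0 l l ^\<^sub>m d *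
     subblock M 0 l l (dim_col M - l)"

lemma index_feedback_term:
  assumes "i < dim_row M - l" "j < dim_col M - l"
  shows "feedback_term l M d $$ (i, j) = (\<Sum>k<l. M $$ (l + i, k) *
    (subblock M 0 0 l l ^\<^sub>m d * subblock M 0 l l (dim_col M - l)) $$ (k, j))"
proof -
  have "feedback_term l M d = subblock M l 0 (dim_row M - l) l *
      (subblock M 0 0 l l ^\<^sub>m d * subblock M 0 l l (dim_col M - l))"
    unfolding feedback_term_def
    by (intro assoc_mult_mat[of _ "dim_row M - l" l _ l _ "dim_col M - l"]) auto
  then show ?thesis
    using assms by (simp add: scalar_prod_def lessThan_atLeast0)
qed

lemma sum_lessThan_add:
  fixes f :: "nat \<Rightarrow> 'b::comm_monoid_add"
  shows "(\<Sum>k<m + n. f k) = (\<Sum>k<m. f k) + (\<Sum>k<n. f (m + k))"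
  by (induction n) (simp_all add: add.assoc)

lemma exit_value_split_exits:
  assumes "l \<le> n_exits A" "j < n_exits A - l"
  shows "exit_value A (split_exits l z (unit_payoff j)) t =
    reach A (l + j) t + (\<Sum>k<l. reach A k t * z k)"
  using assms
    sum_lessThan_add[of "\<lambda>k. reach A k t * split_exits l z (unit_payoff j) k" l "n_exits A - l"]
  by (simp add: exit_value_def split_exits_def add.commute)

lemma affine_map_solution_mat:
  assumes "l \<le> n_ents A" "l \<le> n_exits A" "j < n_exits A - l" "k < l"
  defines "M \<equiv> solution_mat A"
  shows "affine_map (subblock M 0 0 l l) (\<lambda>k. subblock M 0 l l (n_exits A - l) $$ (k, j)) z k =
    exit_value A (split_exits l z (unit_payoff j)) (entr A k)"
  using assms by (simp add: affine_map_def exit_value_split_exits solution_mat_def)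

lemma wire_value_sums:
  fixes A :: "('q, unit) romdp"
  assumes A_romdp: "is_romdp A" and l_le: "l \<le> n_ents A" "l \<le> n_exits A"
    and j_exit: "j < n_exits A - l" and k_lt: "k < l"
  defines "M \<equiv> solution_mat A"
  shows "(\<lambda>d. (subblock M 0 0 l l ^\<^sub>m d * subblock M 0 l l (n_exits A - l)) $$ (k, j)) sums
    exit_value (romdp_trace l A) (unit_payoff j) (trace_target l A (Inr k))"
proof -
  let ?T = "romdp_trace l A"
  let ?B = "subblock M 0 0 l l" and ?C = "subblock M 0 l l (n_exits A - l)"
  define y where "y = (\<lambda>k. exit_value ?T (unit_payoff j) (trace_target l A (Inr k)))"
  have supersolution_iff: "supersolution {..<l} (affine_map ?B (\<lambda>k. ?C $$ (k, j))) z \<longleftrightarrow>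
      (\<forall>k<l. 0 \<le> z k \<and> exit_value A (split_exits l z (unit_payoff j)) (entr A k) \<le> z k)" for z
    using l_le j_exit by (auto simp: supersolution_def M_def affine_map_solution_mat)
  have "(\<lambda>d. (?B ^\<^sub>m d * ?C) $$ (k, j)) sums y k"
  proof (rule neumann_series_sums[OF _ _ _ _ j_exit])
    show "supersolution {..<l} (affine_map ?B (\<lambda>k. ?C $$ (k, j))) y"
      unfolding supersolution_iff
    proof (intro allI impI conjI)
      fix k assume k_lt: "k < l"
      show "0 \<le> y k"
        unfolding y_def by (intro exit_value_nonneg is_romdp_trace A_romdp l_le) simp
      have "exit_value A (split_exits l y (unit_payoff j)) (entr A k) = y k"
        using exit_value_trace[OF A_romdp l_le, of "unit_payoff j" "entr A k"]
          is_romdpD(3)[OF A_romdp, of k] k_lt l_le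
        by (simp add: y_def trace_target_feed)
      then show "exit_value A (split_exits l y (unit_payoff j)) (entr A k) \<le> y k" by simp
    qed
    show "y k \<le> z k"
      if z_super: "supersolution {..<l} (affine_map ?B (\<lambda>k. ?C $$ (k, j))) z" and k_lt: "k < l"
      for z k
    proof -
      have "y k \<le> exit_value A (split_exits l z (unit_payoff j)) (Inr k)"
        unfolding y_def using z_super k_lt l_le unfolding supersolution_iff
        by (intro exit_value_trace_least A_romdp l_le) auto
      also have "\<dots> = z k"
        using exit_value_Inr[OF A_romdp, of "split_exits l z (unit_payoff j)" k]
          split_exits_nonneg[of l z "unit_payoff j"] z_super k_lt l_le
        unfolding supersolution_iff by (simp add: split_exits_def)
      finally show ?thesis .
    qed
  qed (use l_le j_exit k_lt in \<open>auto simp: M_def solution_mat_def reach_nonneg[OF A_romdp]\<close>)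
  then show ?thesis by (simp add: y_def)
qed

lemma feedback_term_solution_mat_sums:
  fixes A :: "('q, unit) romdp"
  assumes A_romdp: "is_romdp A" and l_le: "l \<le> n_ents A" "l \<le> n_exits A"
    and i_ent: "i < n_ents A - l" and j_exit: "j < n_exits A - l"
  shows "(\<lambda>d. feedback_term l (solution_mat A) d $$ (i, j)) sums
    (solution_mat (romdp_trace l A) $$ (i, j) - solution_mat A $$ (l + i, l + j))"
proof -
  let ?T = "romdp_trace l A" and ?M = "solution_mat A"
  let ?y = "\<lambda>k. exit_value ?T (unit_payoff j) (trace_target l A (Inr k))"
  have "(\<lambda>d. feedback_term l ?M d $$ (i, j)) sums (\<Sum>k<l. ?M $$ (l + i, k) * ?y k)"
    using i_ent j_exit by (simp only: index_feedback_term dim_solution_mat)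
      (intro sums_sum sums_mult wire_value_sums[OF A_romdp l_le j_exit], simp)
  moreover have "solution_mat ?T $$ (i, j) =
      exit_value A (split_exits l ?y (unit_payoff j)) (entr A (i + l))"
    using exit_value_trace[OF A_romdp l_le, of "unit_payoff j" "entr A (i + l)"]
      is_romdpD(3)[OF A_romdp, of "i + l"] i_ent j_exit
    by (simp add: solution_mat_eq_exit_value trace_entr_eq_trace_target[OF A_romdp l_le])
  then have "solution_mat ?T $$ (i, j) = ?M $$ (l + i, l + j) + (\<Sum>k<l. ?M $$ (l + i, k) * ?y k)"
    using i_ent j_exit l_le by (simp add: exit_value_split_exits solution_mat_def add.commute)
  ultimately show ?thesis by simp
qed

section \<open>The trace of dual matrices\<close>

text \<open>The matrix of \<open>M = P + \<epsilon>R\<close> as a map of pairs: its first block row is \<open>(P R)\<close>, and the map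
  taking \<open>M\<close> to \<open>((P R), (0 P))\<close> is multiplicative.\<close>

definition dual_row :: "dual mat \<Rightarrow> real mat" where
  "dual_row M = four_block_mat (map_mat real_part M) (map_mat dual_part M)
     (0\<^sub>m 0 (dim_col M)) (0\<^sub>m 0 (dim_col M))"

definition dual_block :: "dual mat \<Rightarrow> real mat" where
  "dual_block M = four_block_mat (map_mat real_part M) (map_mat dual_part M)
     (0\<^sub>m (dim_row M) (dim_col M)) (map_mat real_part M)"

definition dual_col :: "dual mat \<Rightarrow> real mat" where
  "dual_col M = map_mat dual_part M @\<^sub>r map_mat real_part M"

lemma dual_row_mult_dual_block:
  assumes M_carrier: "M \<in> carrier_mat m l" and N_carrier: "N \<in> carrier_mat l l"
  shows "dual_row M * dual_block N = dual_row (M * N)"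
proof -
  have "dual_row M * dual_block N = four_block_mat
      (map_mat real_part M * map_mat real_part N + map_mat dual_part M * 0\<^sub>m l l)
      (map_mat real_part M * map_mat dual_part N + map_mat dual_part M * map_mat real_part N)
      (0\<^sub>m 0 l * map_mat real_part N + 0\<^sub>m 0 l * 0\<^sub>m l l)
      (0\<^sub>m 0 l * map_mat dual_part N + 0\<^sub>m 0 l * map_mat real_part N)"
    unfolding dual_row_def dual_block_def using assms
    by (subst mult_four_block_mat[of _ m l _ l _ 0 _ _ l _ l]) auto
  also have "\<dots> = dual_row (M * N)"
    unfolding dual_row_def real_part.mat_hom_mult[OF M_carrier N_carrier]
      map_dual_part_mult[OF M_carrier N_carrier]
    using assms by (intro cong_four_block_mat) auto
  finally show ?thesis .
qed

lemma dual_row_carrier: "M \<in> carrier_mat m l \<Longrightarrow> dual_row M \<in> carrier_mat m (l + l)"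
  unfolding dual_row_def using four_block_carrier_mat[of "map_mat real_part M" m l "0\<^sub>m 0 l" 0 l]
  by auto

lemma dual_block_carrier: "M \<in> carrier_mat l l \<Longrightarrow> dual_block M \<in> carrier_mat (l + l) (l + l)"
  unfolding dual_block_def by auto

lemma dual_row_mult_dual_block_pow:
  assumes M_carrier: "M \<in> carrier_mat m l" and N_carrier: "N \<in> carrier_mat l l"
  shows "dual_row M * dual_block N ^\<^sub>m d = dual_row (M * N ^\<^sub>m d)"
proof (induction d)
  case 0
  have "dual_row M * 1\<^sub>m (l + l) = dual_row M"
    using dual_row_carrier[OF M_carrier] by simp
  moreover have "dim_row (dual_block N) = l + l"
    using dual_block_carrier[OF N_carrier] by auto
  ultimately show ?case using M_carrier N_carrier by simp
next
  case (Suc d)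
  have "dual_row M * dual_block N ^\<^sub>m Suc d = dual_row M * dual_block N ^\<^sub>m d * dual_block N"
    using assoc_mult_mat[OF dual_row_carrier[OF M_carrier]
        pow_carrier_mat[OF dual_block_carrier[OF N_carrier]]
        dual_block_carrier[OF N_carrier]] by simp
  also have "\<dots> = dual_row (M * N ^\<^sub>m d) * dual_block N"
    by (simp only: Suc)
  also have "\<dots> = dual_row (M * N ^\<^sub>m d * N)"
    using M_carrier N_carrier by (intro dual_row_mult_dual_block[of _ m l]) auto
  also have "M * N ^\<^sub>m d * N = M * N ^\<^sub>m Suc d"
    using assoc_mult_mat[OF M_carrier pow_carrier_mat[OF N_carrier] N_carrier] by simp
  finally show ?case .
qed

lemma dual_row_mult_dual_col:
  assumes M_carrier: "M \<in> carrier_mat m l" and N_carrier: "N \<in> carrier_mat l n"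
  shows "dual_row M * dual_col N = map_mat dual_part (M * N)"
proof -
  have "dual_row M * dual_col N = four_block_mat
      (map_mat real_part M * map_mat dual_part N + map_mat dual_part M * map_mat real_part N)
      (map_mat real_part M * 0\<^sub>m l 0 + map_mat dual_part M * 0\<^sub>m l 0)
      (0\<^sub>m 0 l * map_mat dual_part N + 0\<^sub>m 0 l * map_mat real_part N)
      (0\<^sub>m 0 l * 0\<^sub>m l 0 + 0\<^sub>m 0 l * 0\<^sub>m l 0)"
    unfolding dual_row_def dual_col_def append_rows_def using assms
    by (subst mult_four_block_mat[of _ m l _ l _ 0 _ _ n _ 0]) auto
  also have "\<dots> = map_mat dual_part (M * N)"
    unfolding map_dual_part_mult[OF M_carrier N_carrier] using assms by (intro eq_matI) auto
  finally show ?thesis .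
qed

lemma map_real_part_feedback_term:
  assumes "M \<in> carrier_mat (l + m) (l + n)"
  shows "map_mat real_part (feedback_term l M d) = map_mat real_part (subblock M l 0 m l) *
    map_mat real_part (subblock M 0 0 l l) ^\<^sub>m d * map_mat real_part (subblock M 0 l l n)"
  (is "_ = map_mat _ ?A * map_mat _ ?B ^\<^sub>m d * map_mat _ ?C")
  using assms real_part.mat_hom_mult[of "?A * ?B ^\<^sub>m d" m l ?C n]
    real_part.mat_hom_mult[of ?A m l "?B ^\<^sub>m d" l] real_part.mat_hom_pow[of ?B l d]
  by (simp add: feedback_term_def mult_carrier_mat[of _ m l] pow_carrier_mat)

lemma map_dual_part_feedback_term:
  assumes "M \<in> carrier_mat (l + m) (l + n)"
  shows "map_mat dual_part (feedback_term l M d) = dual_row (subblock M l 0 m l) *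
    dual_block (subblock M 0 0 l l) ^\<^sub>m d * dual_col (subblock M 0 l l n)"
  (is "_ = dual_row ?A * dual_block ?B ^\<^sub>m d * dual_col ?C")
  using assms dual_row_mult_dual_col[of "?A * ?B ^\<^sub>m d" m l ?C n]
  by (simp add: feedback_term_def dual_row_mult_dual_block_pow[of _ m l]
      mult_carrier_mat[of _ m l] pow_carrier_mat)

lemma mc_trace_mc_of_dual:
  assumes M_carrier: "M \<in> carrier_mat (l + m) (l + n)" and N_carrier: "N \<in> carrier_mat m n"
    and sums: "\<And>i j. i < m \<Longrightarrow> j < n \<Longrightarrow>
      (\<lambda>d. feedback_term l M d $$ (i, j)) sums (N $$ (i, j) - M $$ (l + i, l + j))"
  shows "mc_trace l (mc_of_dual M) = mc_of_dual N"
proof -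
  let ?A = "subblock M l 0 m l" and ?B = "subblock M 0 0 l l" and ?C = "subblock M 0 l l n"
  have submat: "submat (map_mat f M) r c nr nc = map_mat f (subblock M r c nr nc)"
    if "r + nr \<le> l + m" "c + nc \<le> l + n" for f :: "dual \<Rightarrow> real" and r c nr nc
    using that M_carrier by (intro eq_matI) (auto simp: submat_def)
  have series: "f (M $$ (l + i, l + j)) + (\<Sum>d. map_mat f (feedback_term l M d) $$ (i, j)) =
      f (N $$ (i, j))" if "bounded_linear f" "i < m" "j < n" for f :: "dual \<Rightarrow> real" and i j
    using sums_unique[OF bounded_linear.sums[OF that(1) sums[OF that(2,3)]]] M_carrier that
    by (simp add: feedback_term_def linear_diff bounded_linear.linear)
  have dims: "dim_row (mc_of_dual M) - l = m" "dim_col (mc_of_dual M) - l = n"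
    using M_carrier by (auto simp: mc_of_dual_def)
  have "mc_trace l (mc_of_dual M) = mat m n (\<lambda>(i, j).
      (real_part (M $$ (l + i, l + j)) + (\<Sum>d. (map_mat real_part ?A *
        map_mat real_part ?B ^\<^sub>m d * map_mat real_part ?C) $$ (i, j)),
       dual_part (M $$ (l + i, l + j)) + (\<Sum>d. (dual_row ?A * dual_block ?B ^\<^sub>m d *
        dual_col ?C) $$ (i, j))))"
    unfolding mc_trace_def Let_def dims p_mat_mc_of_dual r_mat_mc_of_dual
    using M_carrier
    by (intro cong_mat) (simp_all add: submat dual_row_def dual_block_def dual_col_def)
  also have "\<dots> = mat m n (\<lambda>(i, j). (real_part (N $$ (i, j)), dual_part (N $$ (i, j))))"
    unfolding map_real_part_feedback_term[OF M_carrier, symmetric]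
      map_dual_part_feedback_term[OF M_carrier, symmetric]
    by (intro cong_mat)
      (simp_all only: prod.case series bounded_linear_real_part bounded_linear_dual_part)
  also have "\<dots> = mc_of_dual N"
    using N_carrier by (intro eq_matI) (auto simp: mc_of_dual_def)
  finally show ?thesis .
qed

lemma mc_solution_trace:
  assumes "is_romdp A" "l \<le> n_ents A" "l \<le> n_exits A"
  shows "mc_solution (romdp_trace l A) = mc_trace l (mc_solution A)"
  unfolding mc_solution_eq using assms feedback_term_solution_mat_sums[OF assms]
  by (intro mc_trace_mc_of_dual[symmetric, of _ _ "n_ents A - l" "n_exits A - l"]) auto

section \<open>Functoriality of the Int construction\<close>

text \<open>The family \<open>arr\<close> may exceed \<open>hom C\<close>. This allows to take for it all sets of roMDPs with the
  given numbers of entrances and exits, for which closure under the operations does not require that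
  these respect isomorphism.\<close>

locale strict_traced_functor =
  fixes C :: "'f tsmc" and D :: "'g tsmc" and F :: "'f \<Rightarrow> 'g" and arr :: "nat \<Rightarrow> nat \<Rightarrow> 'f set"
  assumes hom_subset_arr: "hom C m n \<subseteq> arr m n"
    and map_hom: "f \<in> hom C m n \<Longrightarrow> F f \<in> hom D m n"
    and ident: "ident C m \<in> arr m m" "F (ident C m) = ident D m"
    and swp: "swp C m n \<in> arr (m + n) (n + m)" "F (swp C m n) = swp D m n"
    and cmp: "f \<in> arr m k \<Longrightarrow> g \<in> arr k n \<Longrightarrow> cmp C f g \<in> arr m n"
      "f \<in> arr m k \<Longrightarrow> g \<in> arr k n \<Longrightarrow> F (cmp C f g) = cmp D (F f) (F g)"
    and tens: "f \<in> arr m n \<Longrightarrow> g \<in> arr m' n' \<Longrightarrow> tens C f g \<in> arr (m + m') (n + n')"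
      "f \<in> arr m n \<Longrightarrow> g \<in> arr m' n' \<Longrightarrow> F (tens C f g) = tens D (F f) (F g)"
    and tr: "f \<in> arr (l + m) (l + n) \<Longrightarrow> tr C l f \<in> arr m n"
      "f \<in> arr (l + m) (l + n) \<Longrightarrow> F (tr C l f) = tr D l (F f)"
begin

definition lifts :: "nat \<Rightarrow> nat \<Rightarrow> 'f \<Rightarrow> 'g \<Rightarrow> bool" where
  "lifts m n f g \<longleftrightarrow> f \<in> arr m n \<and> F f = g"

lemma lifts_hom: "f \<in> hom C m n \<Longrightarrow> lifts m n f (F f)"
  using hom_subset_arr by (auto simp: lifts_def)

lemma lifts_ident: "lifts m m (ident C m) (ident D m)"
  by (simp add: lifts_def ident)

lemma lifts_swp: "lifts (m + n) (n + m) (swp C m n) (swp D m n)"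
  by (simp add: lifts_def swp)

lemma lifts_cmp: "lifts m k f f' \<Longrightarrow> lifts k' n g g' \<Longrightarrow> k = k' \<Longrightarrow> lifts m n (cmp C f g) (cmp D f' g')"
  using cmp by (auto simp: lifts_def)

lemma lifts_tens:
  "lifts m n f f' \<Longrightarrow> lifts k l g g' \<Longrightarrow> lifts (m + k) (n + l) (tens C f g) (tens D f' g')"
  using tens by (auto simp: lifts_def)

lemma lifts_tr: "lifts a b f f' \<Longrightarrow> a = l + m \<Longrightarrow> b = l + n \<Longrightarrow> lifts m n (tr C l f) (tr D l f')"
  using tr by (auto simp: lifts_def)

lemma lifts_int_comp:
  assumes f_lifts: "lifts (m + l') (l + m') f f'" and g_lifts: "lifts (l + n') (n + l') g g'"
  shows "lifts (m + n') (n + m') (int_comp C (m, m') (l, l') (n, n') f g)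
    (int_comp D (m, m') (l, l') (n, n') f' g')"
  unfolding int_comp.simps
  by (rule lifts_tr,
      (rule f_lifts g_lifts lifts_cmp lifts_tens lifts_ident lifts_swp | simp add: add.assoc)+)

lemma lifts_int_tens:
  assumes f_lifts: "lifts (m + n') (n + m') f f'" and g_lifts: "lifts (k + l') (l + k') g g'"
  shows "lifts (m + k + (n' + l')) (n + l + (m' + k'))
    (int_tens C (m, m') (n, n') (k, k') (l, l') f g)
    (int_tens D (m, m') (n, n') (k, k') (l, l') f' g')"
proof -
  have "lifts (m + (k + n') + l') (n + (l + m') + k')
    (int_tens C (m, m') (n, n') (k, k') (l, l') f g)
    (int_tens D (m, m') (n, n') (k, k') (l, l') f' g')"
    unfolding int_tens.simps
    by (rule f_lifts g_lifts lifts_cmp lifts_tens lifts_ident lifts_swp | simp add: add.assoc)+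
  then show ?thesis by (simp add: add.assoc)
qed

theorem compact_closed_functor_Int:
  "compact_closed_functor (Int_cat C) (Int_cat D) (Int_functor F)"
proof -
  have comp: "F (int_comp C (m, m') (l, l') (n, n') f g) =
      int_comp D (m, m') (l, l') (n, n') (F f) (F g)"
    if "f \<in> hom C (m + l') (l + m')" "g \<in> hom C (l + n') (n + l')" for m m' l l' n n' f g
    using lifts_int_comp[OF lifts_hom lifts_hom] that by (simp add: lifts_def del: int_comp.simps)
  have tensor: "F (int_tens C (m, m') (n, n') (k, k') (l, l') f g) =
      int_tens D (m, m') (n, n') (k, k') (l, l') (F f) (F g)"
    if "f \<in> hom C (m + n') (n + m')" "g \<in> hom C (k + l') (l + k')" for m m' n n' k k' l l' f g
    using lifts_int_tens[OF lifts_hom lifts_hom] that by (simp add: lifts_def del: int_tens.simps)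
  have sym: "F (tens C (swp C m k) (swp C k' m')) = tens D (swp D m k) (swp D k' m')" for m k m' k'
    using lifts_tens[OF lifts_swp lifts_swp] by (simp add: lifts_def)
  show ?thesis
    unfolding compact_closed_functor_def Int_cat_def Int_functor_def
    by (auto simp: map_hom ident swp comp tensor sym simp del: int_comp.simps int_tens.simps)
qed

end

section \<open>The solution functor\<close>

lemma induced_mc_seq:
  "induced_mc (romdp_seq A B) \<tau> = romdp_seq (induced_mc A (\<tau> \<circ> Inl)) (induced_mc B (\<tau> \<circ> Inr))"
proof -
  have "\<tau> s = a \<Longrightarrow> seq_prob A B s a t =
      seq_prob (induced_mc A (\<tau> \<circ> Inl)) (induced_mc B (\<tau> \<circ> Inr)) s u t" for s a t and u :: unit
    by (induction A B s a t rule: seq_prob.induct) auto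
  then show ?thesis
    by (intro romdp.equality) (auto simp: fun_eq_iff romdp_seq_def induced_mc_def split: sum.split)
qed

lemma induced_mc_sum:
  "induced_mc (romdp_sum A B) \<tau> = romdp_sum (induced_mc A (\<tau> \<circ> Inl)) (induced_mc B (\<tau> \<circ> Inr))"
proof -
  have "\<tau> s = a \<Longrightarrow> sum_prob A B s a t =
      sum_prob (induced_mc A (\<tau> \<circ> Inl)) (induced_mc B (\<tau> \<circ> Inr)) s u t" for s a t and u :: unit
    by (induction A B s a t rule: sum_prob.induct) auto
  then show ?thesis
    by (intro romdp.equality) (auto simp: fun_eq_iff romdp_sum_def induced_mc_def)
qed

lemma induced_mc_trace: "induced_mc (romdp_trace l A) \<tau> = romdp_trace l (induced_mc A \<tau>)"
proof -
  have "trace_seq (induced_mc A \<tau>) i k = trace_seq A i k" for i k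
    by (induction k) (auto split: sum.split)
  then show ?thesis
    by (intro romdp.equality)
      (auto simp: fun_eq_iff romdp_trace_def induced_mc_def trace_entr_def trace_prec_def Let_def)
qed

lemma romdp_solution_Plus:
  fixes A :: "('q, 'a) romdp" and B :: "('r, 'a) romdp" and C :: "('q + 'r, 'a) romdp"
  assumes "\<And>\<tau>. mc_solution (induced_mc C \<tau>) =
    F (mc_solution (induced_mc A (\<tau> \<circ> Inl))) (mc_solution (induced_mc B (\<tau> \<circ> Inr)))"
  shows "romdp_solution C = {F f g | f g. f \<in> romdp_solution A \<and> g \<in> romdp_solution B}"
proof -
  have "\<exists>\<tau>. \<tau> \<circ> Inl = \<tau>\<^sub>1 \<and> \<tau> \<circ> Inr = \<tau>\<^sub>2" for \<tau>\<^sub>1 :: "'q \<Rightarrow> 'a" and \<tau>\<^sub>2 :: "'r \<Rightarrow> 'a"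
    by (rule exI[of _ "case_sum \<tau>\<^sub>1 \<tau>\<^sub>2"]) auto
  then show ?thesis
    unfolding romdp_solution_def assms by (auto; metis)
qed

lemma romdp_solution_seq:
  assumes "is_romdp A" "is_romdp B" "n_exits A = n_ents B"
  shows "romdp_solution (romdp_seq A B) =
    {mc_comp f g | f g. f \<in> romdp_solution A \<and> g \<in> romdp_solution B}"
  using assms
  by (intro romdp_solution_Plus) (simp add: induced_mc_seq mc_solution_seq is_romdp_induced_mc)

lemma romdp_solution_sum:
  assumes "is_romdp A" "is_romdp B"
  shows "romdp_solution (romdp_sum A B) =
    {mc_sum f g | f g. f \<in> romdp_solution A \<and> g \<in> romdp_solution B}"
  using assms
  by (intro romdp_solution_Plus) (simp add: induced_mc_sum mc_solution_sum is_romdp_induced_mc)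

lemma romdp_solution_trace:
  assumes "is_romdp A" "l \<le> n_ents A" "l \<le> n_exits A"
  shows "romdp_solution (romdp_trace l A) = mc_trace l ` romdp_solution A"
  using mc_solution_trace[OF is_romdp_induced_mc[OF assms(1)]] assms(2,3)
  by (auto simp: romdp_solution_def induced_mc_trace)

lemma romdp_solution_subset_mc_hom: "is_romdp A \<Longrightarrow> romdp_solution A \<subseteq> mc_hom (n_ents A) (n_exits A)"
  using mc_solution_in_mc_hom[OF is_romdp_induced_mc] by (force simp: romdp_solution_def)

lemma solR_UN: "solR (\<Union>A\<in>X. F A) = (\<Union>A\<in>X. solR (F A))"
  by (auto simp: solR_def)

definition romdp_sets :: "nat \<Rightarrow> nat \<Rightarrow> 'a romdp_arrow set" where
  "romdp_sets m n = Pow {A. is_romdp A \<and> n_ents A = m \<and> n_exits A = n}"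

lemma romdp_setsD:
  assumes "X \<in> romdp_sets m n" "A \<in> X"
  shows "is_romdp A" "n_ents A = m" "n_exits A = n"
  using assms by (auto simp: romdp_sets_def)

lemma iso_class_in_romdp_sets: "n_ents A = m \<Longrightarrow> n_exits A = n \<Longrightarrow> iso_class A \<in> romdp_sets m n"
  by (auto simp: romdp_sets_def iso_class_def romdp_iso_def)

lemma UN_in_romdp_sets:
  "(\<And>A. A \<in> X \<Longrightarrow> F A \<in> romdp_sets m n) \<Longrightarrow> (\<Union>A\<in>X. F A) \<in> romdp_sets m n"
  by (auto simp: romdp_sets_def)

lemma roMDP_in_romdp_sets:
  "hom roMDP m n \<subseteq> romdp_sets m n"
  "ident roMDP m \<in> romdp_sets m m"
  "swp roMDP m n \<in> romdp_sets (m + n) (n + m)"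
  "X \<in> romdp_sets m k \<Longrightarrow> Y \<in> romdp_sets k n \<Longrightarrow> cmp roMDP X Y \<in> romdp_sets m n"
  "X \<in> romdp_sets m n \<Longrightarrow> Y \<in> romdp_sets m' n' \<Longrightarrow> tens roMDP X Y \<in> romdp_sets (m + m') (n + n')"
  "X \<in> romdp_sets (l + m) (l + n) \<Longrightarrow> tr roMDP l X \<in> romdp_sets m n"
  unfolding roMDP_def tsmc.simps
  by (intro subsetI UN_in_romdp_sets iso_class_in_romdp_sets;
      auto simp: romdp_id_def romdp_swap_def romdp_sets_def iso_class_def romdp_iso_def subset_iff)+

lemma solR_hom: "X \<in> hom roMDP m n \<Longrightarrow> solR X \<in> hom semR m n"
  using romdp_solution_subset_mc_hom by (fastforce simp: roMDP_def semR_def solR_iso_class)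

lemma solR_ident: "solR (ident roMDP m) = ident semR m"
  by (simp add: roMDP_def semR_def solR_iso_class is_romdp_id romdp_solution_id)

lemma solR_swp: "solR (swp roMDP m n) = swp semR m n"
  by (simp add: roMDP_def semR_def solR_iso_class is_romdp_swap romdp_solution_swap)

lemma solR_cmp:
  assumes X_sets: "X \<in> romdp_sets m k" and Y_sets: "Y \<in> romdp_sets k n"
  shows "solR (cmp roMDP X Y) = cmp semR (solR X) (solR Y)"
proof -
  have "solR (cmp roMDP X Y) = (\<Union>A\<in>X. \<Union>B\<in>Y. cmp semR (romdp_solution A) (romdp_solution B))"
    using romdp_setsD[OF X_sets] romdp_setsD[OF Y_sets]
    by (simp add: roMDP_def solR_UN semR_def solR_iso_class is_romdp_seq romdp_solution_seq)
  also have "\<dots> = cmp semR (solR X) (solR Y)"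
    by (auto simp: semR_def solR_def)
  finally show ?thesis .
qed

lemma solR_tens:
  assumes X_sets: "X \<in> romdp_sets m n" and Y_sets: "Y \<in> romdp_sets m' n'"
  shows "solR (tens roMDP X Y) = tens semR (solR X) (solR Y)"
proof -
  have "solR (tens roMDP X Y) = (\<Union>A\<in>X. \<Union>B\<in>Y. tens semR (romdp_solution A) (romdp_solution B))"
    using romdp_setsD[OF X_sets] romdp_setsD[OF Y_sets]
    by (simp add: roMDP_def solR_UN semR_def solR_iso_class is_romdp_sum romdp_solution_sum)
  also have "\<dots> = tens semR (solR X) (solR Y)"
    by (auto simp: semR_def solR_def)
  finally show ?thesis .
qed

lemma solR_tr:
  assumes X_sets: "X \<in> romdp_sets (l + m) (l + n)"
  shows "solR (tr roMDP l X) = tr semR l (solR X)"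
proof -
  have "solR (tr roMDP l X) = (\<Union>A\<in>X. tr semR l (romdp_solution A))"
    using romdp_setsD[OF X_sets]
    by (simp add: roMDP_def solR_UN semR_def solR_iso_class is_romdp_trace romdp_solution_trace)
  also have "\<dots> = tr semR l (solR X)"
    by (auto simp: semR_def solR_def)
  finally show ?thesis .
qed

theorem strict_traced_functor_solR:
  "strict_traced_functor (roMDP :: ('a::finite) romdp_arrow tsmc) semR solR romdp_sets"
  by unfold_locales
    (rule roMDP_in_romdp_sets solR_hom solR_ident solR_swp solR_cmp solR_tens solR_tr; assumption)+

theorem theorem6:
  shows "compact_closed_functor (oMDP :: (nat \<times> nat, ('a::finite) romdp_arrow) compact_closed) Sem Sol \<and>
    (\<forall>X Y Z. \<forall>A \<in> cc_hom (oMDP :: (nat \<times> nat, 'a romdp_arrow) compact_closed) X Y.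
       \<forall>B \<in> cc_hom oMDP Y Z.
         farr Sol X Z (cc_comp oMDP X Y Z A B) =
         cc_comp Sem X Y Z (farr Sol X Y A) (farr Sol Y Z B)) \<and>
    (\<forall>X Y X' Y'. \<forall>A' \<in> cc_hom (oMDP :: (nat \<times> nat, 'a romdp_arrow) compact_closed) X Y.
       \<forall>B' \<in> cc_hom oMDP X' Y'.
         farr Sol (cc_tens_obj oMDP X X') (cc_tens_obj oMDP Y Y') (cc_tens oMDP X Y X' Y' A' B') =
         cc_tens Sem X Y X' Y' (farr Sol X Y A') (farr Sol X' Y' B'))"
proof -
  have solution_functor: "compact_closed_functor (oMDP :: (_, 'a romdp_arrow) compact_closed) Sem Sol"
    unfolding oMDP_def Sem_def Sol_def
    by (rule strict_traced_functor.compact_closed_functor_Int[OF strict_traced_functor_solR])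
  have fobj: "fobj (Sol :: (_, 'a romdp_arrow, _, _) functor_data) X = X"
    and farr: "farr (Sol :: (_, 'a romdp_arrow, _, _) functor_data) X Y f = solR f" for X Y f
    by (simp_all add: Sol_def Int_functor_def)
  show ?thesis
    using solution_functor unfolding compact_closed_functor_def fobj farr by simp
qed

end
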